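(* In IITT, for any well-formed context $\Delta$, the algorithmic equality relations are partial equivalence relations (symmetric and transitive) on well-typed expressions: (a) $\Delta\vdash T\Longleftrightarrow_{\mathsf{ty}}T'$ is symmetric and transitive on the set of $T$ with $\Delta\vdash T$; (b) for each $T$ with $\Delta\vdash T$, $\Delta\vdash t\Longleftrightarrow_{\mathsf{tm}}t':T$ is symmetric and transitive on the set of $t$ with $\Delta\vdash t:T$; (c) the relation "$\Delta\vdash n\Longleftrightarrow_{\mathsf{ne}}n':U$ for some $U$" is symmetric and transitive on the set of expressions typable in $\Delta$.
   Context: Irrelevant Intensional Type Theory (IITT) is defined as follows. Sorts are $\mathsf{Set}_k$ ($k\in\mathbb{N}$), with $\mathsf{Axiom}=\{(\mathsf{Set}_i,\mathsf{Set}_{i+1})\}$ and $\mathsf{Rule}=\{(\mathsf{Set}_i,\mathsf{Set}_j,\mathsf{Set}_{\max(i,j)})\}$. Annotations $\star\in\{:,\div\}$ (relevant, irrelevant). Expressions: $t,u,T,U ::= s \mid (x\star U)\to^{s,s'}T \mid x \mid \lambda x\star U.\,t \mid t\star u$ (relevant/irrelevant dependent function types annotated with domain sort $s$ and codomain sort $s'$; abstractions; relevant application $t\,u$ and irrelevant application $t\div u$), modulo $\alpha$-equivalence; $[u/x]t$ is substitution. Contexts $\Gamma ::= ()\mid\Gamma.x\star T$. Resurrection $\Gamma^\oplus$ turns every $x\div T$ into $x:T$. Abbreviations: $\Gamma\vdash t\div T$ means $\Gamma^\oplus\vdash t:T$; $\Gamma\vdash t=t'\div T$ means $\Gamma\vdash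 t\div T$ and $\Gamma\vdash t'\div T$; $\Gamma\vdash T$ means $\Gamma\vdash T:s$ for some sort $s$; $\Gamma\vdash T=T'$ means $\Gamma\vdash T=T':s$ for some $s$. Rules: $\vdash()$; from $\vdash\Gamma$, $\Gamma\vdash T$ infer $\vdash\Gamma.x\star T$; from $\vdash\Gamma$, $(s,s')\in\mathsf{Axiom}$ infer $\Gamma\vdash s:s'$; from $\Gamma\vdash U:s_1$, $\Gamma.x\star U\vdash T:s_2$, $(s_1,s_2,s_3)\in\mathsf{Rule}$ infer $\Gamma\vdash(x\star U)\to^{s_1,s_2}T:s_3$; from $\vdash\Gamma$, $(x:U)\in\Gamma$ infer $\Gamma\vdash x:U$; from $\Gamma.x\star U\vdash t:T$, $\Gamma\vdash(x\star U)\to^{s,s'}T$ infer $\Gamma\vdash\lambda x\star U.t:(x\star U)\to^{s,s'}T$; from $\Gamma\vdash t:(x\star U)\to^{s,s'}T$, $\Gamma\vdash u\star U$ infer $\Gamma\vdash t\star u:[u/x]T$; from $\Gamma\vdash t:T$, $\Gamma\vdash T=T'$ infer $\Gamma\vdash t:T'$; $\beta$: from $\Gamma.x\star U\vdash t:T$, $\Gamma\vdash u\star U$ infer $\Gamma\vdash(\lambda x\star U.t)\star u=[u/x]t:[u/x]T$; $\eta$: from $\Gamma\vdash t:(x\star U)\to^{s,s'}T$ infer $\Gamma\vdash t=\lambda x\star U.(t\star x):(x\star U)\to^{s,s'}T$; reflexivity, symmetry, transitivity; congruence for function types (from $\Gamma\vdash U=U':s_1$, $\Gamma.x\star U\vdash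 T=T':s_2$, $(s_1,s_2,s_3)\in\mathsf{Rule}$), for abstractions (from $\Gamma\vdash U=U':s_1$, $\Gamma.x\star U\vdash T:s_2$, $\Gamma.x\star U\vdash t=t':T$ infer $\Gamma\vdash\lambda x\star U.t=\lambda x\star U'.t':(x\star U)\to^{s_1,s_2}T$), for application (from $\Gamma\vdash t=t':(x\star U)\to^{s,s'}T$ and $\Gamma\vdash u=u'\star U$ infer $\Gamma\vdash t\star u=t'\star u':[u/x]T$); conversion: from $\Gamma\vdash t=t':T$, $\Gamma\vdash T=T'$ infer $\Gamma\vdash t=t':T'$. Weak head normal forms $a,A ::= s\mid(x\star U)\to^{s,s'}T\mid\lambda x\star U.t\mid n$; neutrals $n,N ::= x\mid n\star u$. Weak head evaluation: $a\searrow a$ for whnf $a$; if $t\searrow f$ and $f\,@^\star u\searrow a$ then $t\star u\searrow a$; if $[u/x]t\searrow a$ then $(\lambda x\star U.t)\,@^\star u\searrow a$; $n\,@^\star u\searrow n\star u$. Algorithmic equality (mutually inductive; long arrows on whnf types): Type equality: $\Delta\vdash T\Longleftrightarrow_{\mathsf{ty}}T'$ if $T\searrow A$, $T'\searrow A'$, $\Delta\vdash A\longleftrightarrow_{\mathsf{ty}}A'$; $\Delta\vdash s\longleftrightarrow_{\mathsf{ty}}s$; $\Delta\vdash(x\star U)\to^{s,s'}T\longleftrightarrow_{\mathsf{ty}}(x\star U')\to^{s,s'}T'$ if $\Delta\vdash U\Longleftrightarrow_{\mathsf{ty}}U'$ and $\Delta.x\star U\vdash T\Longleftrightarrow_{\mathsf{ty}}T'$;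 $\Delta\vdash N\longleftrightarrow_{\mathsf{ty}}N'$ for neutrals if $\Delta\vdash N\Longleftrightarrow_{\mathsf{ne}}N':T$ for some $T$. Structural equality (type is output): $\Delta\vdash x\Longleftrightarrow_{\mathsf{ne}}x:T$ if $(x:T)\in\Delta$; $\Delta\vdash n\,u\Longleftrightarrow_{\mathsf{ne}}n'\,u':[u/x]T$ if $\Delta\vdash n\longleftrightarrow_{\mathsf{ne}}n':(x:U)\to^{s,s'}T$ and $\Delta\vdash u\Longleftrightarrow_{\mathsf{tm}}u':U$; $\Delta\vdash n\div u\Longleftrightarrow_{\mathsf{ne}}n'\div u':[u/x]T$ if $\Delta\vdash n\longleftrightarrow_{\mathsf{ne}}n':(x\div U)\to^{s,s'}T$; $\Delta\vdash n\longleftrightarrow_{\mathsf{ne}}n':A$ if $\Delta\vdash n\Longleftrightarrow_{\mathsf{ne}}n':T$ and $T\searrow A$. Type-directed equality: $\Delta\vdash t\Longleftrightarrow_{\mathsf{tm}}t':T$ if $T\searrow A$ and $\Delta\vdash t\longleftrightarrow_{\mathsf{tm}}t':A$; $\Delta\vdash t\longleftrightarrow_{\mathsf{tm}}t':(x\star U)\to^{s,s'}T$ if $\Delta.x\star U\vdash t\star x\Longleftrightarrow_{\mathsf{tm}}t'\star x:T$; $\Delta\vdash T\longleftrightarrow_{\mathsf{tm}}T':s$ if $\Delta\vdash T\Longleftrightarrow_{\mathsf{ty}}T'$; $\Delta\vdash t\longleftrightarrow_{\mathsf{tm}}t':N$ for neutral $N$ if $t\searrow n$, $t'\searrow n'$,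 and $\Delta\vdash n\Longleftrightarrow_{\mathsf{ne}}n':T$ for some $T$. *)

theory Defs
  imports Main
begin

text \<open>
  Expressions modulo alpha-equivalence are rendered with de Bruijn indices: \<open>Pi st U s s' T\<close> is
  the function type over \<open>U\<close> with annotation \<open>st\<close>, domain sort \<open>s\<close>, codomain sort \<open>s'\<close>, and
  codomain \<open>T\<close>; \<open>Pi\<close> and \<open>Lam\<close> bind index 0 in their last argument.
\<close>

datatype srt = Set nat

definition Axiom :: "(srt \<times> srt) set" where
  "Axiom = {(Set i, Set (i + 1)) | i. True}"

definition Rule :: "(srt \<times> srt \<times> srt) set" where
  "Rule = {(Set i, Set j, Set (max i j)) | i j. True}"

datatype ann = Rel | Irr

datatype exp =
    Sort srt
  | Pi ann exp srt srt exp
  | Var nat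
  | Lam ann exp exp
  | App ann exp exp

fun up_ren :: "(nat \<Rightarrow> nat) \<Rightarrow> nat \<Rightarrow> nat" where
  "up_ren r 0 = 0"
| "up_ren r (Suc i) = Suc (r i)"

primrec rename :: "(nat \<Rightarrow> nat) \<Rightarrow> exp \<Rightarrow> exp" where
  "rename r (Sort s) = Sort s"
| "rename r (Pi st U s s' T) = Pi st (rename r U) s s' (rename (up_ren r) T)"
| "rename r (Var i) = Var (r i)"
| "rename r (Lam st U t) = Lam st (rename r U) (rename (up_ren r) t)"
| "rename r (App st t u) = App st (rename r t) (rename r u)"

abbreviation lift :: "exp \<Rightarrow> exp" where
  "lift \<equiv> rename Suc"

fun up_subst :: "(nat \<Rightarrow> exp) \<Rightarrow> nat \<Rightarrow> exp" where
  "up_subst \<sigma> 0 = Var 0"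
| "up_subst \<sigma> (Suc i) = lift (\<sigma> i)"

primrec subst :: "(nat \<Rightarrow> exp) \<Rightarrow> exp \<Rightarrow> exp" where
  "subst \<sigma> (Sort s) = Sort s"
| "subst \<sigma> (Pi st U s s' T) = Pi st (subst \<sigma> U) s s' (subst (up_subst \<sigma>) T)"
| "subst \<sigma> (Var i) = \<sigma> i"
| "subst \<sigma> (Lam st U t) = Lam st (subst \<sigma> U) (subst (up_subst \<sigma>) t)"
| "subst \<sigma> (App st t u) = App st (subst \<sigma> t) (subst \<sigma> u)"

fun single :: "exp \<Rightarrow> nat \<Rightarrow> exp" where
  "single u 0 = u"
| "single u (Suc i) = Var i"

text \<open>\<open>inst u T\<close> is \<open>[u/x]T\<close> for the variable \<open>x\<close> with index 0; the binder is removed.\<close>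

definition inst :: "exp \<Rightarrow> exp \<Rightarrow> exp" where
  "inst u T = subst (single u) T"

text \<open>
  The head of the list is the most recently added hypothesis, so the type at position \<open>i\<close> lives in
  \<open>drop (i + 1) \<Gamma>\<close> and is weakened on lookup. Only relevant hypotheses can be looked up.
\<close>

type_synonym ctx = "(ann \<times> exp) list"

definition in_ctx :: "nat \<Rightarrow> exp \<Rightarrow> ctx \<Rightarrow> bool" where
  "in_ctx i T \<Gamma> \<longleftrightarrow> (\<exists>U. i < length \<Gamma> \<and> \<Gamma> ! i = (Rel, U) \<and> T = rename (\<lambda>j. j + (i + 1)) U)"

definition resurrect :: "ctx \<Rightarrow> ctx" where
  "resurrect \<Gamma> = map (\<lambda>(_, T). (Rel, T)) \<Gamma>"

text \<open>
  The judgement \<open>\<Gamma> \<turnstile> t \<star> T\<close> is typing of \<open>t\<close> in \<open>ctx_at \<star> \<Gamma>\<close>.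
\<close>

fun ctx_at :: "ann \<Rightarrow> ctx \<Rightarrow> ctx" where
  "ctx_at Rel \<Gamma> = \<Gamma>"
| "ctx_at Irr \<Gamma> = resurrect \<Gamma>"

inductive
  wf_ctx :: "ctx \<Rightarrow> bool" ("\<turnstile> _" [50] 50) and
  typing :: "ctx \<Rightarrow> exp \<Rightarrow> exp \<Rightarrow> bool" ("_ \<turnstile> _ \<Colon> _" [51, 51, 51] 50) and
  equality :: "ctx \<Rightarrow> exp \<Rightarrow> exp \<Rightarrow> exp \<Rightarrow> bool" ("_ \<turnstile> _ \<doteq> _ \<Colon> _" [51, 51, 51, 51] 50)
where
  wf_empty: "\<turnstile> []"
| wf_ext: "\<lbrakk>\<turnstile> \<Gamma>; \<Gamma> \<turnstile> T \<Colon> Sort s\<rbrakk> \<Longrightarrow> \<turnstile> (st, T) # \<Gamma>"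

| ty_sort: "\<lbrakk>\<turnstile> \<Gamma>; (s, s') \<in> Axiom\<rbrakk> \<Longrightarrow> \<Gamma> \<turnstile> Sort s \<Colon> Sort s'"
| ty_pi: "\<lbrakk>\<Gamma> \<turnstile> U \<Colon> Sort s1; (st, U) # \<Gamma> \<turnstile> T \<Colon> Sort s2; (s1, s2, s3) \<in> Rule\<rbrakk>
    \<Longrightarrow> \<Gamma> \<turnstile> Pi st U s1 s2 T \<Colon> Sort s3"
| ty_var: "\<lbrakk>\<turnstile> \<Gamma>; in_ctx i U \<Gamma>\<rbrakk> \<Longrightarrow> \<Gamma> \<turnstile> Var i \<Colon> U"
| ty_lam: "\<lbrakk>(st, U) # \<Gamma> \<turnstile> t \<Colon> T; \<Gamma> \<turnstile> Pi st U s s' T \<Colon> Sort s3\<rbrakk>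
    \<Longrightarrow> \<Gamma> \<turnstile> Lam st U t \<Colon> Pi st U s s' T"
| ty_app: "\<lbrakk>\<Gamma> \<turnstile> t \<Colon> Pi st U s s' T; ctx_at st \<Gamma> \<turnstile> u \<Colon> U\<rbrakk>
    \<Longrightarrow> \<Gamma> \<turnstile> App st t u \<Colon> inst u T"
| ty_conv: "\<lbrakk>\<Gamma> \<turnstile> t \<Colon> T; \<Gamma> \<turnstile> T \<doteq> T' \<Colon> Sort s\<rbrakk> \<Longrightarrow> \<Gamma> \<turnstile> t \<Colon> T'"

| eq_beta: "\<lbrakk>(st, U) # \<Gamma> \<turnstile> t \<Colon> T; ctx_at st \<Gamma> \<turnstile> u \<Colon> U\<rbrakk>
    \<Longrightarrow> \<Gamma> \<turnstile> App st (Lam st U t) u \<doteq> inst u t \<Colon> inst u T"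
| eq_eta: "\<Gamma> \<turnstile> t \<Colon> Pi st U s s' T
    \<Longrightarrow> \<Gamma> \<turnstile> t \<doteq> Lam st U (App st (lift t) (Var 0)) \<Colon> Pi st U s s' T"
| eq_refl: "\<Gamma> \<turnstile> t \<Colon> T \<Longrightarrow> \<Gamma> \<turnstile> t \<doteq> t \<Colon> T"
| eq_sym: "\<Gamma> \<turnstile> t \<doteq> t' \<Colon> T \<Longrightarrow> \<Gamma> \<turnstile> t' \<doteq> t \<Colon> T"
| eq_trans: "\<lbrakk>\<Gamma> \<turnstile> t1 \<doteq> t2 \<Colon> T; \<Gamma> \<turnstile> t2 \<doteq> t3 \<Colon> T\<rbrakk> \<Longrightarrow> \<Gamma> \<turnstile> t1 \<doteq> t3 \<Colon> T"
| eq_pi: "\<lbrakk>\<Gamma> \<turnstile> U \<doteq> U' \<Colon> Sort s1; (st, U) # \<Gamma> \<turnstile> T \<doteq> T' \<Colon> Sort s2; (s1, s2, s3) \<in> Rule\<rbrakk>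
    \<Longrightarrow> \<Gamma> \<turnstile> Pi st U s1 s2 T \<doteq> Pi st U' s1 s2 T' \<Colon> Sort s3"
| eq_lam: "\<lbrakk>\<Gamma> \<turnstile> U \<doteq> U' \<Colon> Sort s1; (st, U) # \<Gamma> \<turnstile> T \<Colon> Sort s2; (st, U) # \<Gamma> \<turnstile> t \<doteq> t' \<Colon> T\<rbrakk>
    \<Longrightarrow> \<Gamma> \<turnstile> Lam st U t \<doteq> Lam st U' t' \<Colon> Pi st U s1 s2 T"
| eq_app_rel: "\<lbrakk>\<Gamma> \<turnstile> t \<doteq> t' \<Colon> Pi Rel U s s' T; \<Gamma> \<turnstile> u \<doteq> u' \<Colon> U\<rbrakk>
    \<Longrightarrow> \<Gamma> \<turnstile> App Rel t u \<doteq> App Rel t' u' \<Colon> inst u T"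
| eq_app_irr: "\<lbrakk>\<Gamma> \<turnstile> t \<doteq> t' \<Colon> Pi Irr U s s' T; resurrect \<Gamma> \<turnstile> u \<Colon> U; resurrect \<Gamma> \<turnstile> u' \<Colon> U\<rbrakk>
    \<Longrightarrow> \<Gamma> \<turnstile> App Irr t u \<doteq> App Irr t' u' \<Colon> inst u T"
| eq_conv: "\<lbrakk>\<Gamma> \<turnstile> t \<doteq> t' \<Colon> T; \<Gamma> \<turnstile> T \<doteq> T' \<Colon> Sort s\<rbrakk> \<Longrightarrow> \<Gamma> \<turnstile> t \<doteq> t' \<Colon> T'"

definition is_type :: "ctx \<Rightarrow> exp \<Rightarrow> bool" where
  "is_type \<Gamma> T \<longleftrightarrow> (\<exists>s. \<Gamma> \<turnstile> T \<Colon> Sort s)"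

inductive neutral :: "exp \<Rightarrow> bool" where
  "neutral (Var i)"
| "neutral n \<Longrightarrow> neutral (App st n u)"

inductive whnf :: "exp \<Rightarrow> bool" where
  "whnf (Sort s)"
| "whnf (Pi st U s s' T)"
| "whnf (Lam st U t)"
| "neutral n \<Longrightarrow> whnf n"

text \<open>\<open>app_eval st f u a\<close> is active application: \<open>f @ u\<close> evaluates to \<open>a\<close>, with annotation \<open>st\<close>.\<close>

inductive
  eval :: "exp \<Rightarrow> exp \<Rightarrow> bool" ("_ \<searrow> _" [51, 51] 50) and
  app_eval :: "ann \<Rightarrow> exp \<Rightarrow> exp \<Rightarrow> exp \<Rightarrow> bool"
where
  ev_whnf: "whnf a \<Longrightarrow> a \<searrow> a"
| ev_app: "\<lbrakk>t \<searrow> f; app_eval st f u a\<rbrakk> \<Longrightarrow> App st t u \<searrow> a"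
| app_lam: "inst u t \<searrow> a \<Longrightarrow> app_eval st (Lam st U t) u a"
| app_ne: "neutral n \<Longrightarrow> app_eval st n u (App st n u)"

text \<open>
  The suffix \<open>_w\<close> marks the long-arrow judgements, whose types (or compared types, for \<open>ty_eq_w\<close>)
  are weak head normal.
\<close>

inductive
  ty_eq :: "ctx \<Rightarrow> exp \<Rightarrow> exp \<Rightarrow> bool" and
  ty_eq_w :: "ctx \<Rightarrow> exp \<Rightarrow> exp \<Rightarrow> bool" and
  ne_eq :: "ctx \<Rightarrow> exp \<Rightarrow> exp \<Rightarrow> exp \<Rightarrow> bool" and
  ne_eq_w :: "ctx \<Rightarrow> exp \<Rightarrow> exp \<Rightarrow> exp \<Rightarrow> bool" and
  tm_eq :: "ctx \<Rightarrow> exp \<Rightarrow> exp \<Rightarrow> exp \<Rightarrow> bool" and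
  tm_eq_w :: "ctx \<Rightarrow> exp \<Rightarrow> exp \<Rightarrow> exp \<Rightarrow> bool"
where
  alg_ty: "\<lbrakk>T \<searrow> A; T' \<searrow> A'; ty_eq_w \<Delta> A A'\<rbrakk> \<Longrightarrow> ty_eq \<Delta> T T'"

| alg_ty_sort: "ty_eq_w \<Delta> (Sort s) (Sort s)"
| alg_ty_pi: "\<lbrakk>ty_eq \<Delta> U U'; ty_eq ((st, U) # \<Delta>) T T'\<rbrakk>
    \<Longrightarrow> ty_eq_w \<Delta> (Pi st U s s' T) (Pi st U' s s' T')"
| alg_ty_ne: "\<lbrakk>neutral N; neutral N'; ne_eq \<Delta> N N' T\<rbrakk> \<Longrightarrow> ty_eq_w \<Delta> N N'"

| alg_ne_var: "in_ctx i T \<Delta> \<Longrightarrow> ne_eq \<Delta> (Var i) (Var i) T"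
| alg_ne_app_rel: "\<lbrakk>ne_eq_w \<Delta> n n' (Pi Rel U s s' T); tm_eq \<Delta> u u' U\<rbrakk>
    \<Longrightarrow> ne_eq \<Delta> (App Rel n u) (App Rel n' u') (inst u T)"
| alg_ne_app_irr: "ne_eq_w \<Delta> n n' (Pi Irr U s s' T)
    \<Longrightarrow> ne_eq \<Delta> (App Irr n u) (App Irr n' u') (inst u T)"

| alg_ne_w: "\<lbrakk>ne_eq \<Delta> n n' T; T \<searrow> A\<rbrakk> \<Longrightarrow> ne_eq_w \<Delta> n n' A"

| alg_tm: "\<lbrakk>T \<searrow> A; tm_eq_w \<Delta> t t' A\<rbrakk> \<Longrightarrow> tm_eq \<Delta> t t' T"

| alg_tm_pi: "tm_eq ((st, U) # \<Delta>) (App st (lift t) (Var 0)) (App st (lift t') (Var 0)) T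
    \<Longrightarrow> tm_eq_w \<Delta> t t' (Pi st U s s' T)"
| alg_tm_sort: "ty_eq \<Delta> T T' \<Longrightarrow> tm_eq_w \<Delta> T T' (Sort s)"
| alg_tm_ne: "\<lbrakk>neutral N; t \<searrow> n; t' \<searrow> n'; ne_eq \<Delta> n n' T\<rbrakk> \<Longrightarrow> tm_eq_w \<Delta> t t' N"

end

(*
  Erase expressions to an untyped calculus: drop the domains of abstractions, all irrelevant
  arguments and irrelevant variables, and identify all sorts. Declaratively equal expressions have
  beta-eta convertible erasures, and on erasures beta-eta is confluent, so function types are
  injective for convertibility and subject reduction holds for typing up to convertibility; no
  normalization argument is needed. By standardization, a type convertible to a sort, a function
  type or a neutral type evaluates to one of the same shape. Hence the algorithmic derivations can
  be transported along convertible contexts and types, which gives symmetry and transitivity by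
  induction on derivations.
*)

theory Submission
  imports Defs
begin

section \<open>Erased terms and confluence of beta-eta reduction\<close>

text \<open>With domain annotations beta-eta reduction is not confluent: for
  \<open>t = Lam st V b\<close>, the expression \<open>Lam st U (App st (lift t) (Var 0))\<close>
  contracts by beta to \<open>Lam st U b\<close> and by eta to \<open>Lam st V b\<close>. Dropping
  domains makes the two contracta equal. Irrelevant arguments have to go as well, because
  declarative equality identifies any two of them.

  The algorithm is biased to the left: codomains are compared under the left domain, and a neutral
  application receives the type \<open>inst u T\<close> of its left argument. Reversing or composing
  derivations therefore replaces contexts and types by convertible ones, and the rules apply again
  only if the new type evaluates to the same shape.

  Eta is the obstacle to reading that shape off a reduction. A reduction to a function type may end
  in an eta contraction, in which case weak head reduction stops earlier, at an abstraction. A type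
  is never an abstraction, but saying so takes typing that is stable under weak head reduction. This
  is why subject reduction stands next to standardization.\<close>

datatype trm =
    TSort
  | TBul
  | TVar nat
  | TPi trm trm
  | TIPi trm trm
  | TLam trm
  | TILam trm
  | TApp trm trm
  | TIApp trm

primrec ren :: "(nat \<Rightarrow> nat) \<Rightarrow> trm \<Rightarrow> trm" where
  "ren r TSort = TSort"
| "ren r TBul = TBul"
| "ren r (TVar i) = TVar (r i)"
| "ren r (TPi A B) = TPi (ren r A) (ren (up_ren r) B)"
| "ren r (TIPi A B) = TIPi (ren r A) (ren r B)"
| "ren r (TLam t) = TLam (ren (up_ren r) t)"
| "ren r (TILam t) = TILam (ren r t)"
| "ren r (TApp t u) = TApp (ren r t) (ren r u)"
| "ren r (TIApp t) = TIApp (ren r t)"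

abbreviation shift :: "trm \<Rightarrow> trm" where
  "shift \<equiv> ren Suc"

definition up :: "(nat \<Rightarrow> trm) \<Rightarrow> nat \<Rightarrow> trm" where
  "up \<sigma> = case_nat (TVar 0) (\<lambda>i. shift (\<sigma> i))"

primrec sub :: "(nat \<Rightarrow> trm) \<Rightarrow> trm \<Rightarrow> trm" where
  "sub \<sigma> TSort = TSort"
| "sub \<sigma> TBul = TBul"
| "sub \<sigma> (TVar i) = \<sigma> i"
| "sub \<sigma> (TPi A B) = TPi (sub \<sigma> A) (sub (up \<sigma>) B)"
| "sub \<sigma> (TIPi A B) = TIPi (sub \<sigma> A) (sub \<sigma> B)"
| "sub \<sigma> (TLam t) = TLam (sub (up \<sigma>) t)"
| "sub \<sigma> (TILam t) = TILam (sub \<sigma> t)"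
| "sub \<sigma> (TApp t u) = TApp (sub \<sigma> t) (sub \<sigma> u)"
| "sub \<sigma> (TIApp t) = TIApp (sub \<sigma> t)"

abbreviation sub1 :: "trm \<Rightarrow> trm \<Rightarrow> trm" where
  "sub1 u \<equiv> sub (case_nat u TVar)"

section \<open>Substitution calculus of erased terms\<close>

lemma up_simps [simp]: "up \<sigma> 0 = TVar 0" "up \<sigma> (Suc i) = shift (\<sigma> i)"
  by (simp_all add: up_def)

lemma up_ren_comp: "up_ren r (up_ren s i) = up_ren (\<lambda>i. r (s i)) i"
  by (cases i) auto

lemma ren_ren: "ren r (ren s t) = ren (\<lambda>i. r (s i)) t"
  by (induction t arbitrary: r s) (simp_all add: up_ren_comp)

lemma sub_ren: "sub \<sigma> (ren r t) = sub (\<lambda>i. \<sigma> (r i)) t"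
proof (induction t arbitrary: \<sigma> r)
  have *: "(\<lambda>i. up \<sigma> (up_ren r i)) = up (\<lambda>i. \<sigma> (r i))" for \<sigma> r
  proof
    show "up \<sigma> (up_ren r i) = up (\<lambda>i. \<sigma> (r i)) i" for i
      by (cases i) auto
  qed
  case (TPi A B) then show ?case by (simp add: *)
next
  have *: "(\<lambda>i. up \<sigma> (up_ren r i)) = up (\<lambda>i. \<sigma> (r i))" for \<sigma> r
  proof
    show "up \<sigma> (up_ren r i) = up (\<lambda>i. \<sigma> (r i)) i" for i
      by (cases i) auto
  qed
  case (TLam t) then show ?case by (simp add: *)
qed auto

lemma ren_shift: "ren (up_ren r) (shift t) = shift (ren r t)"
  by (simp add: ren_ren)

lemma ren_up: "(\<lambda>i. ren (up_ren r) (up \<sigma> i)) = up (\<lambda>i. ren r (\<sigma> i))"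
proof
  show "ren (up_ren r) (up \<sigma> i) = up (\<lambda>i. ren r (\<sigma> i)) i" for i
    by (cases i) (auto simp: ren_shift)
qed

lemma ren_sub: "ren r (sub \<sigma> t) = sub (\<lambda>i. ren r (\<sigma> i)) t"
  by (induction t arbitrary: \<sigma> r) (simp_all add: ren_up)

lemma sub_shift: "sub (up \<sigma>) (shift t) = shift (sub \<sigma> t)"
  by (simp add: sub_ren ren_sub)

lemma sub_up: "(\<lambda>i. sub (up \<tau>) (up \<sigma> i)) = up (\<lambda>i. sub \<tau> (\<sigma> i))"
proof
  show "sub (up \<tau>) (up \<sigma> i) = up (\<lambda>i. sub \<tau> (\<sigma> i)) i" for i
    by (cases i) (auto simp: sub_shift)
qed

lemma sub_sub: "sub \<tau> (sub \<sigma> t) = sub (\<lambda>i. sub \<tau> (\<sigma> i)) t"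
  by (induction t arbitrary: \<sigma> \<tau>) (simp_all add: sub_up)

lemma up_TVar [simp]: "up TVar = TVar"
proof
  show "up TVar i = TVar i" for i by (cases i) auto
qed

lemma sub_TVar [simp]: "sub TVar t = t"
  by (induction t) simp_all

lemma ren_as_sub: "ren r t = sub (\<lambda>i. TVar (r i)) t"
  using ren_sub[of r TVar t] by simp

lemma sub1_shift [simp]: "sub (case_nat u \<sigma>) (shift t) = sub \<sigma> t"
  by (simp add: sub_ren)

lemma shift_inject [simp]: "shift t = shift u \<longleftrightarrow> t = u"
  by (metis sub1_shift sub_TVar)

lemma sub_sub1: "sub \<sigma> (sub1 u t) = sub1 (sub \<sigma> u) (sub (up \<sigma>) t)"
proof -
  have "(\<lambda>i. sub \<sigma> (case_nat u TVar i)) = (\<lambda>i. sub1 (sub \<sigma> u) (up \<sigma> i))"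
  proof
    show "sub \<sigma> (case_nat u TVar i) = sub1 (sub \<sigma> u) (up \<sigma> i)" for i
      by (cases i) auto
  qed
  then show ?thesis by (simp add: sub_sub)
qed

lemma ren_sub1: "ren r (sub1 u t) = sub1 (ren r u) (ren (up_ren r) t)"
proof -
  have "up (\<lambda>i. TVar (r i)) = (\<lambda>i. TVar (up_ren r i))"
  proof
    show "up (\<lambda>i. TVar (r i)) i = TVar (up_ren r i)" for i by (cases i) auto
  qed
  then show ?thesis by (simp add: ren_as_sub sub_sub1)
qed

text \<open>This is the beta step inside an eta expanded abstraction: a weakened abstraction applied
  to the fresh variable gives back its body. It closes every overlap of beta with eta below.\<close>

lemma sub1_ren_up_Suc [simp]: "sub1 (TVar 0) (ren (up_ren Suc) t) = t"
proof -
  have "(\<lambda>i. case_nat (TVar 0) TVar (up_ren Suc i)) = TVar"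
  proof
    show "case_nat (TVar 0) TVar (up_ren Suc i) = TVar i" for i by (cases i) auto
  qed
  then show ?thesis by (simp add: sub_ren)
qed

section \<open>Free variables and the side condition of eta\<close>

primrec fv :: "trm \<Rightarrow> nat set" where
  "fv TSort = {}"
| "fv TBul = {}"
| "fv (TVar i) = {i}"
| "fv (TPi A B) = fv A \<union> {i. Suc i \<in> fv B}"
| "fv (TIPi A B) = fv A \<union> fv B"
| "fv (TLam t) = {i. Suc i \<in> fv t}"
| "fv (TILam t) = fv t"
| "fv (TApp t u) = fv t \<union> fv u"
| "fv (TIApp t) = fv t"

lemma up_ren_image: "{i. Suc i \<in> up_ren r ` X} = r ` {i. Suc i \<in> X}"
proof -
  have "Suc i \<in> up_ren r ` X \<longleftrightarrow> i \<in> r ` {i. Suc i \<in> X}" for i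
  proof
    assume "Suc i \<in> up_ren r ` X"
    then obtain j where "j \<in> X" "Suc i = up_ren r j" by auto
    then show "i \<in> r ` {i. Suc i \<in> X}" by (cases j) auto
  next
    assume "i \<in> r ` {i. Suc i \<in> X}"
    then obtain j where "Suc j \<in> X" "i = r j" by auto
    then show "Suc i \<in> up_ren r ` X" by (metis image_eqI up_ren.simps(2))
  qed
  then show ?thesis by auto
qed

lemma fv_ren: "fv (ren r t) = r ` fv t"
  by (induction t arbitrary: r) (simp_all add: up_ren_image image_Un)

lemma up_cong_fv:
  "(\<And>i. Suc i \<in> X \<Longrightarrow> \<sigma> i = \<tau> i) \<Longrightarrow> i \<in> X \<Longrightarrow> up \<sigma> i = up \<tau> i"
  by (cases i) auto

lemma sub_cong_fv: "(\<And>i. i \<in> fv t \<Longrightarrow> \<sigma> i = \<tau> i) \<Longrightarrow> sub \<sigma> t = sub \<tau> t"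
proof (induction t arbitrary: \<sigma> \<tau>)
  case (TPi A B)
  have "sub \<sigma> A = sub \<tau> A"
    by (rule TPi.IH) (simp add: TPi.prems)
  moreover have "sub (up \<sigma>) B = sub (up \<tau>) B"
    by (rule TPi.IH, rule up_cong_fv[of "fv B"]) (simp_all add: TPi.prems)
  ultimately show ?case by simp
next
  case (TIPi A B)
  have "sub \<sigma> A = sub \<tau> A" "sub \<sigma> B = sub \<tau> B"
    by (rule TIPi.IH, simp add: TIPi.prems)+
  then show ?case by simp
next
  case (TLam t)
  have "sub (up \<sigma>) t = sub (up \<tau>) t"
    by (rule TLam.IH, rule up_cong_fv[of "fv t"]) (simp_all add: TLam.prems)
  then show ?case by simp
next
  case (TILam t)
  have "sub \<sigma> t = sub \<tau> t"
    by (rule TILam.IH) (simp add: TILam.prems)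
  then show ?case by simp
next
  case (TApp t u)
  have "sub \<sigma> t = sub \<tau> t" "sub \<sigma> u = sub \<tau> u"
    by (rule TApp.IH, simp add: TApp.prems)+
  then show ?case by simp
next
  case (TIApp t)
  have "sub \<sigma> t = sub \<tau> t"
    by (rule TIApp.IH) (simp add: TIApp.prems)
  then show ?case by simp
qed simp_all

text \<open>The existential form is the pattern that occurs in eta redexes, the free variable form
  is the one that can be followed through renamings.\<close>

lemma shift_iff_fv: "(\<exists>u. t = shift u) \<longleftrightarrow> 0 \<notin> fv t"
proof
  assume "\<exists>u. t = shift u"
  then show "0 \<notin> fv t" by (auto simp: fv_ren)
next
  assume 0: "0 \<notin> fv t"
  \<comment> \<open>\<open>TBul\<close> is an arbitrary filler for index 0, which does not occur in
    \<open>t\<close>; the substitution merely lowers the other indices.\<close>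
  have "shift (sub1 TBul t) = sub (\<lambda>i. shift (case_nat TBul TVar i)) t"
    by (simp add: ren_sub)
  also have "\<dots> = sub TVar t"
  proof (rule sub_cong_fv)
    show "shift (case_nat TBul TVar i) = TVar i" if "i \<in> fv t" for i
      using that 0 by (cases i) auto
  qed
  finally show "\<exists>u. t = shift u" by (metis sub_TVar)
qed

text \<open>Renamings, injective or not, reflect the eta pattern: \<open>up_ren r\<close> fixes 0,
  so if index 0 is absent after renaming it was absent before. Injectivity of \<open>shift\<close>
  then identifies \<open>p\<close>.\<close>

lemma ren_eq_shiftD:
  assumes "ren (up_ren r) t = shift p"
  obtains q where "t = shift q" "p = ren r q"
proof -
  have "0 \<notin> up_ren r ` fv t"
    using assms shift_iff_fv by (metis fv_ren)
  then have "0 \<notin> fv t" by (metis image_eqI up_ren.simps(1))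
  then obtain q where q: "t = shift q" using shift_iff_fv by auto
  with assms have "p = ren r q" by (simp add: ren_shift)
  with q show thesis by (rule that)
qed

section \<open>Parallel beta-eta reduction and its diamond property\<close>

inductive par :: "trm \<Rightarrow> trm \<Rightarrow> bool" where
  par_sort: "par TSort TSort"
| par_bul: "par TBul TBul"
| par_var: "par (TVar i) (TVar i)"
| par_pi: "par A A' \<Longrightarrow> par B B' \<Longrightarrow> par (TPi A B) (TPi A' B')"
| par_ipi: "par A A' \<Longrightarrow> par B B' \<Longrightarrow> par (TIPi A B) (TIPi A' B')"
| par_lam: "par t t' \<Longrightarrow> par (TLam t) (TLam t')"
| par_ilam: "par t t' \<Longrightarrow> par (TILam t) (TILam t')"
| par_app: "par t t' \<Longrightarrow> par u u' \<Longrightarrow> par (TApp t u) (TApp t' u')"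
| par_iapp: "par t t' \<Longrightarrow> par (TIApp t) (TIApp t')"
| par_beta: "par t t' \<Longrightarrow> par u u' \<Longrightarrow> par (TApp (TLam t) u) (sub1 u' t')"
| par_eta: "par t t' \<Longrightarrow> par (TLam (TApp (shift t) (TVar 0))) t'"
| par_ibeta: "par t t' \<Longrightarrow> par (TIApp (TILam t)) t'"
| par_ieta: "par t t' \<Longrightarrow> par (TILam (TIApp t)) t'"

lemma par_refl [simp]: "par t t"
  by (induction t) (auto intro: par.intros)

lemma par_ren: "par t t' \<Longrightarrow> par (ren r t) (ren r t')"
proof (induction arbitrary: r rule: par.induct)
  case (par_beta t t' u u')
  then show ?case by (simp add: ren_sub1 par.par_beta)
next
  case (par_eta t t')
  then show ?case by (simp add: ren_shift par.par_eta)
qed (auto intro: par.intros)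

lemma par_up: "(\<And>i. par (\<sigma> i) (\<tau> i)) \<Longrightarrow> par (up \<sigma> i) (up \<tau> i)"
  by (cases i) (auto intro: par_ren)

lemma par_sub: "par t t' \<Longrightarrow> (\<And>i. par (\<sigma> i) (\<tau> i)) \<Longrightarrow> par (sub \<sigma> t) (sub \<tau> t')"
proof (induction arbitrary: \<sigma> \<tau> rule: par.induct)
  case (par_pi A A' B B')
  then show ?case by (simp add: par.par_pi par_up)
next
  case (par_lam t t')
  then show ?case by (simp add: par.par_lam par_up)
next
  case (par_beta t t' u u')
  then show ?case by (simp add: sub_sub1 par.par_beta par_up)
next
  case (par_eta t t')
  then show ?case by (simp add: sub_shift par.par_eta)
qed (auto intro: par.intros)

lemma par_sub1: "par t t' \<Longrightarrow> par u u' \<Longrightarrow> par (sub1 u t) (sub1 u' t')"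
  by (rule par_sub) (auto split: nat.split)

inductive_cases par_varE: "par (TVar i) t"
inductive_cases par_sortE: "par TSort t"
inductive_cases par_bulE: "par TBul t"

lemma par_pi_iff: "par (TPi A B) t \<longleftrightarrow> (\<exists>A' B'. t = TPi A' B' \<and> par A A' \<and> par B B')"
  by (subst par.simps) simp

lemma par_ipi_iff: "par (TIPi A B) t \<longleftrightarrow> (\<exists>A' B'. t = TIPi A' B' \<and> par A A' \<and> par B B')"
  by (subst par.simps) simp

inductive_cases par_lamE [consumes 1, case_names cong contr]: "par (TLam s) t"
inductive_cases par_ilamE [consumes 1, case_names cong contr]: "par (TILam s) t"
inductive_cases par_appE [consumes 1, case_names cong contr]: "par (TApp s u) t"
inductive_cases par_iappE [consumes 1, case_names cong contr]: "par (TIApp s) t"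

lemma ren_eq_simps:
  "TSort = ren r t \<longleftrightarrow> t = TSort"
  "TBul = ren r t \<longleftrightarrow> t = TBul"
  "TVar i = ren r t \<longleftrightarrow> (\<exists>j. t = TVar j \<and> i = r j)"
  "TPi A B = ren r t \<longleftrightarrow> (\<exists>A' B'. t = TPi A' B' \<and> A = ren r A' \<and> B = ren (up_ren r) B')"
  "TIPi A B = ren r t \<longleftrightarrow> (\<exists>A' B'. t = TIPi A' B' \<and> A = ren r A' \<and> B = ren r B')"
  "TLam s = ren r t \<longleftrightarrow> (\<exists>s'. t = TLam s' \<and> s = ren (up_ren r) s')"
  "TILam s = ren r t \<longleftrightarrow> (\<exists>s'. t = TILam s' \<and> s = ren r s')"
  "TApp s u = ren r t \<longleftrightarrow> (\<exists>s' u'. t = TApp s' u' \<and> s = ren r s' \<and> u = ren r u')"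
  "TIApp s = ren r t \<longleftrightarrow> (\<exists>s'. t = TIApp s' \<and> s = ren r s')"
  by (cases t; auto)+

lemma up_ren_eq_0 [simp]: "0 = up_ren r i \<longleftrightarrow> i = 0"
  by (cases i) auto

text \<open>For \<open>r = Suc\<close> this says that every reduct of \<open>shift p\<close> is
  again of the form \<open>shift p'\<close>, so an eta redex stays one while its body is reduced.
  The general \<open>r\<close> lets the induction pass under binders.\<close>

lemma par_ren_inv: "par t' s \<Longrightarrow> t' = ren r t \<Longrightarrow> \<exists>s'. s = ren r s' \<and> par t s'"
proof (induction arbitrary: r t rule: par.induct)
  case (par_pi A A' B B')
  obtain A1 B1 where t: "t = TPi A1 B1" "A = ren r A1" "B = ren (up_ren r) B1"
    using par_pi.prems unfolding ren_eq_simps by blast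
  obtain A2 where A2: "A' = ren r A2" "par A1 A2"
    using par_pi.IH(1)[OF t(2)] by blast
  obtain B2 where B2: "B' = ren (up_ren r) B2" "par B1 B2"
    using par_pi.IH(2)[OF t(3)] by blast
  have "TPi A' B' = ren r (TPi A2 B2)" "par t (TPi A2 B2)"
    using t A2 B2 by (simp_all add: par.par_pi)
  then show ?case by blast
next
  case (par_ipi A A' B B')
  obtain A1 B1 where t: "t = TIPi A1 B1" "A = ren r A1" "B = ren r B1"
    using par_ipi.prems unfolding ren_eq_simps by blast
  obtain A2 where A2: "A' = ren r A2" "par A1 A2"
    using par_ipi.IH(1)[OF t(2)] by blast
  obtain B2 where B2: "B' = ren r B2" "par B1 B2"
    using par_ipi.IH(2)[OF t(3)] by blast
  have "TIPi A' B' = ren r (TIPi A2 B2)" "par t (TIPi A2 B2)"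
    using t A2 B2 by (simp_all add: par.par_ipi)
  then show ?case by blast
next
  case (par_app A A' B B')
  obtain A1 B1 where t: "t = TApp A1 B1" "A = ren r A1" "B = ren r B1"
    using par_app.prems unfolding ren_eq_simps by blast
  obtain A2 where A2: "A' = ren r A2" "par A1 A2"
    using par_app.IH(1)[OF t(2)] by blast
  obtain B2 where B2: "B' = ren r B2" "par B1 B2"
    using par_app.IH(2)[OF t(3)] by blast
  have "TApp A' B' = ren r (TApp A2 B2)" "par t (TApp A2 B2)"
    using t A2 B2 by (simp_all add: par.par_app)
  then show ?case by blast
next
  case (par_beta t1 t1' u u')
  obtain t2 u2 where t: "t = TApp (TLam t2) u2" "t1 = ren (up_ren r) t2" "u = ren r u2"
    using par_beta.prems unfolding ren_eq_simps by blast
  obtain t3 where t3: "t1' = ren (up_ren r) t3" "par t2 t3"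
    using par_beta.IH(1)[OF t(2)] by blast
  obtain u3 where u3: "u' = ren r u3" "par u2 u3"
    using par_beta.IH(2)[OF t(3)] by blast
  have "sub1 u' t1' = ren r (sub1 u3 t3)" "par t (sub1 u3 t3)"
    using t t3 u3 by (simp_all add: par.par_beta ren_sub1)
  then show ?case by blast
next
  case (par_eta t1 t1')
  obtain t2 where t: "t = TLam (TApp t2 (TVar 0))" "shift t1 = ren (up_ren r) t2"
    using par_eta.prems unfolding ren_eq_simps up_ren_eq_0 by blast
  obtain t3 where t3: "t2 = shift t3" "t1 = ren r t3"
    using ren_eq_shiftD[OF t(2)[symmetric]] by blast
  obtain s' where "t1' = ren r s'" "par t3 s'" using par_eta.IH[OF t3(2)] by blast
  then show ?case unfolding t t3 by (blast intro: par.par_eta)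
next
  case (par_lam t1 t1')
  obtain t2 where t: "t = TLam t2" "t1 = ren (up_ren r) t2"
    using par_lam.prems unfolding ren_eq_simps by blast
  obtain t3 where t3: "t1' = ren (up_ren r) t3" "par t2 t3"
    using par_lam.IH[OF t(2)] by blast
  have "TLam t1' = ren r (TLam t3)" "par t (TLam t3)"
    using t t3 by (simp_all add: par.par_lam)
  then show ?case by blast
next
  case (par_ilam t1 t1')
  obtain t2 where t: "t = TILam t2" "t1 = ren r t2"
    using par_ilam.prems unfolding ren_eq_simps by blast
  obtain t3 where t3: "t1' = ren r t3" "par t2 t3"
    using par_ilam.IH[OF t(2)] by blast
  have "TILam t1' = ren r (TILam t3)" "par t (TILam t3)"
    using t t3 by (simp_all add: par.par_ilam)
  then show ?case by blast
next
  case (par_iapp t1 t1')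
  obtain t2 where t: "t = TIApp t2" "t1 = ren r t2"
    using par_iapp.prems unfolding ren_eq_simps by blast
  obtain t3 where t3: "t1' = ren r t3" "par t2 t3"
    using par_iapp.IH[OF t(2)] by blast
  have "TIApp t1' = ren r (TIApp t3)" "par t (TIApp t3)"
    using t t3 by (simp_all add: par.par_iapp)
  then show ?case by blast
next
  case (par_ibeta t1 t1')
  obtain t2 where t: "t = TIApp (TILam t2)" "t1 = ren r t2"
    using par_ibeta.prems unfolding ren_eq_simps by blast
  obtain t3 where t3: "t1' = ren r t3" "par t2 t3"
    using par_ibeta.IH[OF t(2)] by blast
  have "t1' = ren r (t3)" "par t (t3)"
    using t t3 by (simp_all add: par.par_ibeta)
  then show ?case by blast
next
  case (par_ieta t1 t1')
  obtain t2 where t: "t = TILam (TIApp t2)" "t1 = ren r t2"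
    using par_ieta.prems unfolding ren_eq_simps by blast
  obtain t3 where t3: "t1' = ren r t3" "par t2 t3"
    using par_ieta.IH[OF t(2)] by blast
  have "t1' = ren r (t3)" "par t (t3)"
    using t t3 by (simp_all add: par.par_ieta)
  then show ?case by blast
next
  case par_sort
  then show ?case by (intro exI[of _ t]) (simp add: ren_eq_simps)
next
  case par_bul
  then show ?case by (intro exI[of _ t]) (simp add: ren_eq_simps)
next
  case (par_var i)
  then show ?case by (intro exI[of _ t]) simp
qed

text \<open>The body of an eta redex can change in two ways: inside \<open>p\<close>, or by a beta
  contraction of the whole application when \<open>p\<close> is an abstraction. In the latter case
  substituting variable 0 undoes the weakening.\<close>

lemma par_eta_bodyD:
  assumes "par (TApp (shift p) (TVar 0)) q"
  shows "(\<exists>p'. par p p' \<and> q = TApp (shift p') (TVar 0)) \<or> (\<exists>p0. p = TLam p0 \<and> par p0 q)"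
  using assms
proof (rule par_appE)
  fix t' u' assume *: "q = TApp t' u'" "par (shift p) t'" "par (TVar 0) u'"
  then show ?thesis using par_ren_inv[OF *(2) refl] by (auto elim!: par_varE)
next
  fix t t' u' assume *: "shift p = TLam t" "q = sub1 u' t'" "par t t'" "par (TVar 0) u'"
  then obtain p0 where p0: "p = TLam p0" "t = ren (up_ren Suc) p0"
    by (metis ren_eq_simps(6))
  with par_ren_inv[OF *(3)] obtain t'' where "t' = ren (up_ren Suc) t''" "par p0 t''" by blast
  with * p0 show ?thesis by (auto elim!: par_varE)
qed

lemma par_eta_bodyE:
  assumes "par (TApp (shift p) (TVar 0)) q"
  obtains (app) p' where "par p p'" "q = TApp (shift p') (TVar 0)"
  | (lam) p0 where "p = TLam p0" "par p0 q"
  using par_eta_bodyD[OF assms] by blast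

lemma size_ren [simp]: "size (ren r t) = size t"
  by (induction t arbitrary: r) auto

text \<open>Induction is on size and not on derivations: an eta redex contains
  \<open>shift p\<close>, while the hypothesis is wanted for \<open>p\<close>, which has the same
  size. In two overlaps it is even applied to an application that is no subterm of
  \<open>M\<close>.\<close>

lemma par_diamond: "par M N1 \<Longrightarrow> par M N2 \<Longrightarrow> \<exists>P. par N1 P \<and> par N2 P"
proof (induction M arbitrary: N1 N2 rule: measure_induct_rule[of size])
  case (less M)
  show ?case
  proof (cases M)
    case TSort then show ?thesis using less.prems by (metis par_sortE par_refl)
  next
    case TBul then show ?thesis using less.prems by (metis par_bulE par_refl)
  next
    case TVar then show ?thesis using less.prems by (metis par_varE par_refl)
  next
    case (TPi A B)
    obtain A1 B1 A2 B2 where *: "N1 = TPi A1 B1" "N2 = TPi A2 B2" "par A A1" "par A A2" "par B B1" "par B B2"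
      using less.prems unfolding TPi par_pi_iff by blast
    obtain A3 where A3: "par A1 A3" "par A2 A3" using less.IH[of A A1 A2] * TPi by auto
    obtain B3 where B3: "par B1 B3" "par B2 B3" using less.IH[of B B1 B2] * TPi by auto
    show ?thesis using * A3 B3 by (blast intro: par.par_pi)
  next
    case (TIPi A B)
    obtain A1 B1 A2 B2 where *: "N1 = TIPi A1 B1" "N2 = TIPi A2 B2" "par A A1" "par A A2" "par B B1" "par B B2"
      using less.prems unfolding TIPi par_ipi_iff by blast
    obtain A3 where A3: "par A1 A3" "par A2 A3" using less.IH[of A A1 A2] * TIPi by auto
    obtain B3 where B3: "par B1 B3" "par B2 B3" using less.IH[of B B1 B2] * TIPi by auto
    show ?thesis using * A3 B3 by (blast intro: par.par_ipi)
  next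
    case (TLam m)
    \<comment> \<open>One side reduces the body of an eta redex, the other contracts the redex. If
      the body is contracted by beta, then \<open>TLam q\<close> is itself a reduct of
      \<open>p\<close>, and both sides are reducts of the smaller term \<open>p\<close>.\<close>
    have mixed: "\<exists>P. par (TLam q) P \<and> par p' P"
      if mq: "par m q" and m: "m = TApp (shift p) (TVar 0)" and p: "par p p'" for p p' q
      using mq unfolding m
    proof (cases rule: par_eta_bodyE)
      case (app p'')
      then obtain P where "par p'' P" "par p' P"
        using less.IH[of p] m p TLam by fastforce
      with app show ?thesis by (auto intro: par.par_eta)
    next
      case (lam p0)
      then show ?thesis using less.IH[of p "TLam q" p'] m p TLam by (auto intro: par.par_lam)
    qed
    show ?thesis
      using less.prems(1) unfolding TLam
    proof (cases rule: par_lamE)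
      case (cong m1)
      note l = this
      show ?thesis using less.prems(2) unfolding TLam
      proof (cases rule: par_lamE)
        case (cong m2)
        then obtain P where "par m1 P" "par m2 P" using less.IH[of m m1 m2] l TLam by auto
        with l cong show ?thesis by (auto intro: par.par_lam)
      next
        case (contr p)
        with l mixed show ?thesis by blast
      qed
    next
      case (contr p)
      note l = this
      show ?thesis using less.prems(2) unfolding TLam
      proof (cases rule: par_lamE)
        case (cong m2)
        with l mixed show ?thesis by blast
      next
        case (contr p2)
        with l have "p2 = p" by simp
        with l contr show ?thesis using less.IH[of p N1 N2] TLam by auto
      qed
    qed
  next
    case (TILam m)
    have mixed: "\<exists>P. par (TILam q) P \<and> par p' P"
      if mq: "par m q" and m: "m = TIApp p" and p: "par p p'" for p p' q
      using mq unfolding m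
    proof (cases rule: par_iappE)
      case (cong p'')
      then obtain P where "par p'' P" "par p' P"
        using less.IH[of p] m p TILam by fastforce
      with cong show ?thesis by (auto intro: par.par_ieta)
    next
      case (contr p0)
      then show ?thesis using less.IH[of p "TILam q" p'] m p TILam by (auto intro: par.par_ilam)
    qed
    show ?thesis
      using less.prems(1) unfolding TILam
    proof (cases rule: par_ilamE)
      case (cong m1)
      note l = this
      show ?thesis using less.prems(2) unfolding TILam
      proof (cases rule: par_ilamE)
        case (cong m2)
        then obtain P where "par m1 P" "par m2 P" using less.IH[of m m1 m2] l TILam by auto
        with l cong show ?thesis by (auto intro: par.par_ilam)
      next
        case (contr p)
        with l mixed show ?thesis by blast
      qed
    next
      case (contr p)
      note l = this
      show ?thesis using less.prems(2) unfolding TILam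
      proof (cases rule: par_ilamE)
        case (cong m2)
        with l mixed show ?thesis by blast
      next
        case (contr p2)
        with l have "p2 = p" by simp
        with l contr show ?thesis using less.IH[of p N1 N2] TILam by auto
      qed
    qed
  next
    case (TApp m u)
    have mixed: "\<exists>P. par (TApp s u1) P \<and> par (sub1 u2 m2) P"
      if m: "m = TLam m0" and s: "par m s" and u: "par u u1" "par u u2" and m2: "par m0 m2" for m0 s u1 u2 m2
    proof -
      obtain u3 where u3: "par u1 u3" "par u2 u3"
        using less.IH[of u] u TApp by fastforce
      show ?thesis using s unfolding m
      proof (cases rule: par_lamE)
        case (cong m1)
        then obtain m3 where m3: "par m1 m3" "par m2 m3"
          using less.IH[of m0] m2 TApp m by fastforce
        with cong u3 show ?thesis by (auto intro: par.par_beta par_sub1)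
      next
        case (contr p)
        show ?thesis using m2 unfolding contr(1)
        proof (cases rule: par_eta_bodyE)
          case (app p')
          then obtain p3 where "par s p3" "par p' p3"
            using less.IH[of p] contr TApp m by fastforce
          with app u3 show ?thesis by (auto intro: par.par_app)
        next
          case (lam p0)
          note p0 = this
          \<comment> \<open>The function part of a beta redex is at once an eta redex over the
            abstraction \<open>p\<close>. Both sides are then reducts of \<open>TApp p u\<close>,
            which is smaller than \<open>M\<close>.\<close>
          have "par (TApp p u) (TApp s u1)" using \<open>par p s\<close> u by (auto intro: par.par_app)
          moreover have "par (TApp p u) (sub1 u2 m2)" using p0 u by (auto intro: par.par_beta)
          moreover have "size (TApp p u) < size M"
            using TApp m \<open>m0 = _\<close> by simp
          ultimately show ?thesis using less.IH by blast
        qed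
      qed
    qed
    show ?thesis using less.prems(1) unfolding TApp
    proof (cases rule: par_appE)
      case (cong m1 u1)
      note l = this
      show ?thesis using less.prems(2) unfolding TApp
      proof (cases rule: par_appE)
        case (cong m2 u2)
        obtain P where P: "par m1 P" "par m2 P" using less.IH[of m m1 m2] l cong TApp by auto
        obtain Q where Q: "par u1 Q" "par u2 Q" using less.IH[of u u1 u2] l cong TApp by auto
        show ?thesis using l cong P Q by (auto intro: par.par_app)
      next
        case (contr m0 m2 u2)
        with mixed[OF contr(1) l(2,3) contr(4,3)] l show ?thesis by simp
      qed
    next
      case (contr m0 m1 u1)
      note l = this
      show ?thesis using less.prems(2) unfolding TApp
      proof (cases rule: par_appE)
        case (cong s u2)
        with mixed[OF l(1) cong(2,3) l(4,3)] l show ?thesis by auto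
      next
        case (contr m0' m2 u2)
        obtain P where P: "par m1 P" "par m2 P" using less.IH[of m0 m1 m2] l contr TApp by auto
        obtain Q where Q: "par u1 Q" "par u2 Q" using less.IH[of u u1 u2] l contr TApp by auto
        show ?thesis using l contr P Q by (auto intro: par_sub1)
      qed
    qed
  next
    case (TIApp m)
    have mixed: "\<exists>P. par (TIApp s) P \<and> par m2 P"
      if m: "m = TILam m0" and s: "par m s" and m2: "par m0 m2" for m0 s m2
      using s unfolding m
    proof (cases rule: par_ilamE)
      case (cong m1)
      then obtain m3 where m3: "par m1 m3" "par m2 m3"
        using less.IH[of m0] m2 TIApp m by fastforce
      with cong show ?thesis by (auto intro: par.par_ibeta)
    next
      case (contr p)
      then have "par (TIApp p) (TIApp s)" "par (TIApp p) m2" using m2 by (auto intro: par.par_iapp)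
      moreover have "size (TIApp p) < size M"
        using TIApp m \<open>m0 = _\<close> by simp
      ultimately show ?thesis using less.IH by blast
    qed
    show ?thesis using less.prems(1) unfolding TIApp
    proof (cases rule: par_iappE)
      case (cong m1)
      note l = this
      show ?thesis using less.prems(2) unfolding TIApp
      proof (cases rule: par_iappE)
        case (cong m2)
        obtain P where P: "par m1 P" "par m2 P" using less.IH[of m m1 m2] l cong TIApp by auto
        show ?thesis using l cong P by (auto intro: par.par_iapp)
      next
        case (contr m0)
        with mixed l show ?thesis by blast
      qed
    next
      case (contr m0)
      note l = this
      show ?thesis using less.prems(2) unfolding TIApp
      proof (cases rule: par_iappE)
        case (cong s)
        with mixed l show ?thesis by blast
      next
        case (contr m0')
        show ?thesis using less.IH[of m0 N1 N2] l contr TIApp by auto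
      qed
    qed
  qed
qed

section \<open>Convertibility\<close>

abbreviation pars :: "trm \<Rightarrow> trm \<Rightarrow> bool" where
  "pars \<equiv> par\<^sup>*\<^sup>*"

lemma par_strip: "pars t u \<Longrightarrow> par t t' \<Longrightarrow> \<exists>v. par u v \<and> pars t' v"
proof (induction rule: rtranclp_induct)
  case base
  then show ?case by blast
next
  case (step u u')
  then obtain v where "par u v" "pars t' v" by blast
  moreover from this step obtain w where "par u' w" "par v w" using par_diamond by blast
  ultimately show ?case by (meson rtranclp.rtrancl_into_rtrancl)
qed

lemma pars_confluent: "pars t u \<Longrightarrow> pars t t' \<Longrightarrow> \<exists>v. pars u v \<and> pars t' v"
proof (induction rule: rtranclp_induct)
  case base
  then show ?case by blast
next
  case (step u u')
  then obtain v where "pars u v" "pars t' v" by blast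
  moreover from this step obtain w where "pars u' w" "par v w" using par_strip by blast
  ultimately show ?case by (meson rtranclp.rtrancl_into_rtrancl)
qed

text \<open>Having a common reduct is chosen over the generated equivalence: the shape lemmas can
  inspect that reduct, and confluence enters only through transitivity.\<close>

definition conv :: "trm \<Rightarrow> trm \<Rightarrow> bool" where
  "conv t u \<longleftrightarrow> (\<exists>v. pars t v \<and> pars u v)"

lemma conv_refl [simp]: "conv t t"
  unfolding conv_def by blast

lemma conv_sym: "conv t u \<Longrightarrow> conv u t"
  unfolding conv_def by blast

lemma conv_trans [trans]: "conv t u \<Longrightarrow> conv u v \<Longrightarrow> conv t v"
  unfolding conv_def by (meson pars_confluent rtranclp_trans)

lemma pars_conv: "pars t u \<Longrightarrow> conv t u"
  unfolding conv_def by blast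

lemma par_conv: "par t u \<Longrightarrow> conv t u"
  by (simp add: pars_conv r_into_rtranclp)

lemma pars_map: "pars t u \<Longrightarrow> (\<And>x y. par x y \<Longrightarrow> par (f x) (f y)) \<Longrightarrow> pars (f t) (f u)"
  by (induction rule: rtranclp_induct) (auto intro: rtranclp.rtrancl_into_rtrancl)

lemma conv_map: "conv t u \<Longrightarrow> (\<And>x y. par x y \<Longrightarrow> par (f x) (f y)) \<Longrightarrow> conv (f t) (f u)"
  unfolding conv_def using pars_map[of _ _ f] by blast

lemma conv_sub: "conv t u \<Longrightarrow> conv (sub \<sigma> t) (sub \<sigma> u)"
  by (erule conv_map) (simp add: par_sub)

lemma conv_ren: "conv t u \<Longrightarrow> conv (ren r t) (ren r u)"
  by (erule conv_map) (simp add: par_ren)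

lemma conv_lam: "conv t u \<Longrightarrow> conv (TLam t) (TLam u)"
  by (erule conv_map) (simp add: par.par_lam)

lemma conv_ilam: "conv t u \<Longrightarrow> conv (TILam t) (TILam u)"
  by (erule conv_map) (simp add: par.par_ilam)

lemma conv_iapp: "conv t u \<Longrightarrow> conv (TIApp t) (TIApp u)"
  by (erule conv_map) (simp add: par.par_iapp)

lemma conv_app: "conv t t' \<Longrightarrow> conv u u' \<Longrightarrow> conv (TApp t u) (TApp t' u')"
  using conv_map[of t t' "\<lambda>x. TApp x u"] conv_map[of u u' "\<lambda>x. TApp t' x"]
  by (meson conv_trans par_app par_refl)

lemma conv_pi: "conv t t' \<Longrightarrow> conv u u' \<Longrightarrow> conv (TPi t u) (TPi t' u')"
  using conv_map[of t t' "\<lambda>x. TPi x u"] conv_map[of u u' "\<lambda>x. TPi t' x"]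
  by (meson conv_trans par_pi par_refl)

lemma conv_ipi: "conv t t' \<Longrightarrow> conv u u' \<Longrightarrow> conv (TIPi t u) (TIPi t' u')"
  using conv_map[of t t' "\<lambda>x. TIPi x u"] conv_map[of u u' "\<lambda>x. TIPi t' x"]
  by (meson conv_trans par_ipi par_refl)

lemma conv_up: "(\<And>i. conv (\<sigma> i) (\<tau> i)) \<Longrightarrow> conv (up \<sigma> i) (up \<tau> i)"
  by (cases i) (auto intro: conv_ren)

lemma conv_sub_pointwise: "(\<And>i. conv (\<sigma> i) (\<tau> i)) \<Longrightarrow> conv (sub \<sigma> t) (sub \<tau> t)"
  by (induction t arbitrary: \<sigma> \<tau>)
    (simp_all add: conv_lam conv_ilam conv_iapp conv_app conv_pi conv_ipi conv_up)

lemma conv_sub1: "conv t t' \<Longrightarrow> conv u u' \<Longrightarrow> conv (sub1 u t) (sub1 u' t')"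
  by (rule conv_trans[OF conv_sub conv_sub_pointwise]) (auto split: nat.split)

lemma conv_beta: "conv (TApp (TLam t) u) (sub1 u t)"
  by (simp add: par_conv par.par_beta)

lemma conv_ibeta: "conv (TIApp (TILam t)) t"
  by (simp add: par_conv par.par_ibeta)

lemma conv_eta: "conv (TLam (TApp (shift t) (TVar 0))) t"
  by (simp add: par_conv par.par_eta)

lemma conv_ieta: "conv (TILam (TIApp t)) t"
  by (simp add: par_conv par.par_ieta)

text \<open>Abstracting both sides gives two eta redexes, which contract to \<open>t\<close> and
  \<open>u\<close>. This is what makes the comparison at function types, by application to a fresh
  variable, sound.\<close>

lemma conv_ext:
  assumes "conv (TApp (shift t) (TVar 0)) (TApp (shift u) (TVar 0))"
  shows "conv t u"
  using conv_trans[OF conv_trans[OF conv_sym[OF conv_eta] conv_lam[OF assms]] conv_eta] .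

lemma conv_iext: "conv (TIApp t) (TIApp u) \<Longrightarrow> conv t u"
  using conv_ieta conv_ilam conv_sym conv_trans by meson

section \<open>Reducts of type formers and of neutral terms\<close>

lemma pars_sort: "pars TSort t \<Longrightarrow> t = TSort"
  by (induction rule: rtranclp_induct) (auto elim: par_sortE)

lemma pars_pi: "pars (TPi A B) t \<Longrightarrow> \<exists>A' B'. t = TPi A' B' \<and> pars A A' \<and> pars B B'"
proof (induction rule: rtranclp_induct)
  case base
  then show ?case by blast
next
  case (step t t')
  then show ?case using par_pi_iff by (metis rtranclp.rtrancl_into_rtrancl)
qed

lemma pars_ipi: "pars (TIPi A B) t \<Longrightarrow> \<exists>A' B'. t = TIPi A' B' \<and> pars A A' \<and> pars B B'"
proof (induction rule: rtranclp_induct)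
  case base
  then show ?case by blast
next
  case (step t t')
  then show ?case using par_ipi_iff by (metis rtranclp.rtrancl_into_rtrancl)
qed

text \<open>Reduction of a function type takes place inside its components only, so the common
  reduct is a function type whose components are common reducts.\<close>

lemma conv_pi_inject: "conv (TPi A B) (TPi A' B') \<Longrightarrow> conv A A' \<and> conv B B'"
  unfolding conv_def by (metis pars_pi trm.inject(2))

lemma conv_ipi_inject: "conv (TIPi A B) (TIPi A' B') \<Longrightarrow> conv A A' \<and> conv B B'"
  unfolding conv_def by (metis pars_ipi trm.inject(3))

text \<open>The head variable is recorded as an index so that it can be followed through
  substitution: below an eta expansion the head is \<open>Suc i\<close>, never the variable that the
  expansion binds.\<close>

inductive neu :: "nat \<Rightarrow> trm \<Rightarrow> bool" where
  neu_var: "neu i (TVar i)"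
| neu_app: "neu i t \<Longrightarrow> neu i (TApp t u)"
| neu_iapp: "neu i t \<Longrightarrow> neu i (TIApp t)"

inductive_cases neu_appE [elim!]: "neu i (TApp t u)"
inductive_cases neu_iappE [elim!]: "neu i (TIApp t)"
inductive_cases neu_varE [elim!]: "neu i (TVar j)"
inductive_cases neu_lamE [elim!]: "neu i (TLam t)"
inductive_cases neu_ilamE [elim!]: "neu i (TILam t)"
inductive_cases neu_piE [elim!]: "neu i (TPi t u)"
inductive_cases neu_ipiE [elim!]: "neu i (TIPi t u)"
inductive_cases neu_sortE [elim!]: "neu i TSort"
inductive_cases neu_bulE [elim!]: "neu i TBul"

lemma neu_par: "par t t' \<Longrightarrow> neu i t \<Longrightarrow> neu i t'"
  by (induction rule: par.induct) (auto intro: neu.intros)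

lemma neu_pars: "pars t t' \<Longrightarrow> neu i t \<Longrightarrow> neu i t'"
  by (induction rule: rtranclp_induct) (auto intro: neu_par)

lemma neu_sub: "neu i t \<Longrightarrow> \<sigma> i = TVar j \<Longrightarrow> neu j (sub \<sigma> t)"
  by (induction rule: neu.induct) (auto intro: neu.intros)

lemma neu_ren: "neu i t \<Longrightarrow> neu (r i) (ren r t)"
  by (induction rule: neu.induct) (auto intro: neu.intros)

lemma conv_sort_pi [simp]: "\<not> conv TSort (TPi A B)" "\<not> conv (TPi A B) TSort"
  unfolding conv_def using pars_sort pars_pi by blast+

lemma conv_sort_ipi [simp]: "\<not> conv TSort (TIPi A B)" "\<not> conv (TIPi A B) TSort"
  unfolding conv_def using pars_sort pars_ipi by blast+

lemma conv_pi_ipi [simp]: "\<not> conv (TPi A B) (TIPi A' B')" "\<not> conv (TIPi A' B') (TPi A B)"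
  unfolding conv_def using pars_pi pars_ipi by blast+

lemma conv_neu [simp]:
  assumes "neu i t"
  shows "\<not> conv TSort t" "\<not> conv t TSort" "\<not> conv (TPi A B) t" "\<not> conv t (TPi A B)"
    "\<not> conv (TIPi A B) t" "\<not> conv t (TIPi A B)"
  unfolding conv_def using pars_sort pars_pi pars_ipi neu_pars[OF _ assms] by blast+

text \<open>Single contractions complement \<open>par\<close>: confluence is proved in parallel
  form, whereas standardization absorbs a reduction sequence one contraction at a time.\<close>

inductive step :: "trm \<Rightarrow> trm \<Rightarrow> bool" where
  step_pi1: "step A A' \<Longrightarrow> step (TPi A B) (TPi A' B)"
| step_pi2: "step B B' \<Longrightarrow> step (TPi A B) (TPi A B')"
| step_ipi1: "step A A' \<Longrightarrow> step (TIPi A B) (TIPi A' B)"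
| step_ipi2: "step B B' \<Longrightarrow> step (TIPi A B) (TIPi A B')"
| step_lam: "step t t' \<Longrightarrow> step (TLam t) (TLam t')"
| step_ilam: "step t t' \<Longrightarrow> step (TILam t) (TILam t')"
| step_app1: "step t t' \<Longrightarrow> step (TApp t u) (TApp t' u)"
| step_app2: "step u u' \<Longrightarrow> step (TApp t u) (TApp t u')"
| step_iapp: "step t t' \<Longrightarrow> step (TIApp t) (TIApp t')"
| step_beta: "step (TApp (TLam t) u) (sub1 u t)"
| step_eta: "step (TLam (TApp (shift t) (TVar 0))) t"
| step_ibeta: "step (TIApp (TILam t)) t"
| step_ieta: "step (TILam (TIApp t)) t"

lemma step_ren: "step t t' \<Longrightarrow> step (ren r t) (ren r t')"
proof (induction arbitrary: r rule: step.induct)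
  case (step_beta t u)
  then show ?case by (simp add: ren_sub1 step.step_beta)
next
  case (step_eta t)
  then show ?case by (simp add: ren_shift step.step_eta)
qed (auto intro: step.intros)

lemma steps_map: "step\<^sup>*\<^sup>* t u \<Longrightarrow> (\<And>x y. step x y \<Longrightarrow> step (f x) (f y)) \<Longrightarrow> step\<^sup>*\<^sup>* (f t) (f u)"
  by (induction rule: rtranclp_induct) (auto intro: rtranclp.rtrancl_into_rtrancl)

lemma steps_lam: "step\<^sup>*\<^sup>* t u \<Longrightarrow> step\<^sup>*\<^sup>* (TLam t) (TLam u)"
  by (erule steps_map) (simp_all add: step.step_lam)

lemma steps_ilam: "step\<^sup>*\<^sup>* t u \<Longrightarrow> step\<^sup>*\<^sup>* (TILam t) (TILam u)"
  by (erule steps_map) (simp_all add: step.step_ilam)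

lemma steps_iapp: "step\<^sup>*\<^sup>* t u \<Longrightarrow> step\<^sup>*\<^sup>* (TIApp t) (TIApp u)"
  by (erule steps_map) (simp_all add: step.step_iapp)

lemma steps_app: "step\<^sup>*\<^sup>* t t' \<Longrightarrow> step\<^sup>*\<^sup>* u u' \<Longrightarrow> step\<^sup>*\<^sup>* (TApp t u) (TApp t' u')"
  using steps_map[of t t' "\<lambda>x. TApp x u"] steps_map[of u u' "\<lambda>x. TApp t' x"]
  by (meson rtranclp_trans step_app1 step_app2)

lemma steps_pi: "step\<^sup>*\<^sup>* t t' \<Longrightarrow> step\<^sup>*\<^sup>* u u' \<Longrightarrow> step\<^sup>*\<^sup>* (TPi t u) (TPi t' u')"
  using steps_map[of t t' "\<lambda>x. TPi x u"] steps_map[of u u' "\<lambda>x. TPi t' x"]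
  by (meson rtranclp_trans step_pi1 step_pi2)

lemma steps_ipi: "step\<^sup>*\<^sup>* t t' \<Longrightarrow> step\<^sup>*\<^sup>* u u' \<Longrightarrow> step\<^sup>*\<^sup>* (TIPi t u) (TIPi t' u')"
  using steps_map[of t t' "\<lambda>x. TIPi x u"] steps_map[of u u' "\<lambda>x. TIPi t' x"]
  by (meson rtranclp_trans step_ipi1 step_ipi2)

lemma par_steps: "par t t' \<Longrightarrow> step\<^sup>*\<^sup>* t t'"
proof (induction rule: par.induct)
  case (par_beta t t' u u')
  then have "step\<^sup>*\<^sup>* (TApp (TLam t) u) (TApp (TLam t') u')"
    by (simp add: steps_app steps_lam)
  then show ?case using step_beta by (meson rtranclp.rtrancl_into_rtrancl)
next
  case (par_eta t t')
  then show ?case by (meson converse_rtranclp_into_rtranclp step_eta)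
next
  case (par_ibeta t t')
  then show ?case by (meson converse_rtranclp_into_rtranclp step_ibeta)
next
  case (par_ieta t t')
  then show ?case by (meson converse_rtranclp_into_rtranclp step_ieta)
qed (simp_all add: steps_pi steps_ipi steps_lam steps_ilam steps_app steps_iapp)

lemma pars_steps: "pars t t' \<Longrightarrow> step\<^sup>*\<^sup>* t t'"
  by (induction rule: rtranclp_induct) (auto dest: par_steps)

section \<open>Typing of erased terms and standardization\<close>

definition look :: "trm list \<Rightarrow> nat \<Rightarrow> trm" where
  "look \<Gamma> i = ren (\<lambda>j. j + (i + 1)) (\<Gamma> ! i)"

lemma look_0 [simp]: "look (A # \<Gamma>) 0 = shift A"
  by (simp add: look_def)

lemma look_Suc [simp]: "look (A # \<Gamma>) (Suc i) = shift (look \<Gamma> i)"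
  by (simp add: look_def ren_ren)

text \<open>
  Typing of erased terms in the style of Curry, with all universes collapsed to \<open>TSort\<close> (subject
  reduction does not need a consistent hierarchy) and with untyped conversion, whose confluence
  makes the function type constructors injective without any normalization argument.
\<close>

inductive has_ty :: "trm list \<Rightarrow> trm \<Rightarrow> trm \<Rightarrow> bool" where
  t_sort: "has_ty \<Gamma> TSort TSort"
| t_var: "i < length \<Gamma> \<Longrightarrow> has_ty \<Gamma> (look \<Gamma> i) TSort \<Longrightarrow> has_ty \<Gamma> (TVar i) (look \<Gamma> i)"
| t_pi: "has_ty \<Gamma> A TSort \<Longrightarrow> has_ty (A # \<Gamma>) B TSort \<Longrightarrow> has_ty \<Gamma> (TPi A B) TSort"
| t_ipi: "has_ty \<Gamma> A TSort \<Longrightarrow> has_ty \<Gamma> B TSort \<Longrightarrow> has_ty \<Gamma> (TIPi A B) TSort"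
| t_lam: "has_ty \<Gamma> A TSort \<Longrightarrow> has_ty (A # \<Gamma>) B TSort \<Longrightarrow> has_ty (A # \<Gamma>) t B
    \<Longrightarrow> has_ty \<Gamma> (TLam t) (TPi A B)"
| t_ilam: "has_ty \<Gamma> A TSort \<Longrightarrow> has_ty \<Gamma> B TSort \<Longrightarrow> has_ty \<Gamma> t B
    \<Longrightarrow> has_ty \<Gamma> (TILam t) (TIPi A B)"
| t_app: "has_ty \<Gamma> A TSort \<Longrightarrow> has_ty (A # \<Gamma>) B TSort \<Longrightarrow> has_ty \<Gamma> t (TPi A B) \<Longrightarrow> has_ty \<Gamma> u A
    \<Longrightarrow> has_ty \<Gamma> (TApp t u) (sub1 u B)"
| t_iapp: "has_ty \<Gamma> A TSort \<Longrightarrow> has_ty \<Gamma> B TSort \<Longrightarrow> has_ty \<Gamma> t (TIPi A B)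
    \<Longrightarrow> has_ty \<Gamma> (TIApp t) B"
| t_conv: "has_ty \<Gamma> t A \<Longrightarrow> conv A B \<Longrightarrow> has_ty \<Gamma> B TSort \<Longrightarrow> has_ty \<Gamma> t B"

definition ren_ok :: "(nat \<Rightarrow> nat) \<Rightarrow> trm list \<Rightarrow> trm list \<Rightarrow> bool" where
  "ren_ok r \<Gamma> \<Delta> \<longleftrightarrow> (\<forall>i < length \<Gamma>. r i < length \<Delta> \<and> look \<Delta> (r i) = ren r (look \<Gamma> i))"

lemma ren_ok_up: "ren_ok r \<Gamma> \<Delta> \<Longrightarrow> ren_ok (up_ren r) (A # \<Gamma>) (ren r A # \<Delta>)"
  unfolding ren_ok_def
proof (intro allI impI)
  fix i assume *: "\<forall>i < length \<Gamma>. r i < length \<Delta> \<and> look \<Delta> (r i) = ren r (look \<Gamma> i)" "i < length (A # \<Gamma>)"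
  then show "up_ren r i < length (ren r A # \<Delta>)
    \<and> look (ren r A # \<Delta>) (up_ren r i) = ren (up_ren r) (look (A # \<Gamma>) i)"
    by (cases i) (auto simp: ren_shift)
qed

lemma ren_ok_Suc: "ren_ok Suc \<Gamma> (A # \<Gamma>)"
  by (simp add: ren_ok_def)

lemma has_ty_ren: "has_ty \<Gamma> t A \<Longrightarrow> ren_ok r \<Gamma> \<Delta> \<Longrightarrow> has_ty \<Delta> (ren r t) (ren r A)"
proof (induction arbitrary: r \<Delta> rule: has_ty.induct)
  case (t_sort \<Gamma>)
  show ?case by (simp add: has_ty.t_sort)
next
  case (t_var i \<Gamma>)
  have r: "r i < length \<Delta>" "look \<Delta> (r i) = ren r (look \<Gamma> i)"
    using t_var.hyps t_var.prems by (auto simp: ren_ok_def)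
  have "has_ty \<Delta> (ren r (look \<Gamma> i)) TSort" using t_var.IH[OF t_var.prems] by simp
  then show ?case using has_ty.t_var[of "r i" \<Delta>] r by simp
next
  case (t_pi \<Gamma> A B)
  then show ?case by (simp add: has_ty.t_pi ren_ok_up)
next
  case (t_ipi \<Gamma> A B)
  then show ?case by (simp add: has_ty.t_ipi)
next
  case (t_lam \<Gamma> A B t)
  then show ?case by (simp add: has_ty.t_lam ren_ok_up)
next
  case (t_ilam \<Gamma> A B t)
  then show ?case by (simp add: has_ty.t_ilam)
next
  case (t_app \<Gamma> A B t u)
  have "has_ty \<Delta> (TApp (ren r t) (ren r u)) (sub1 (ren r u) (ren (up_ren r) B))"
    using t_app by (intro has_ty.t_app[of _ "ren r A"]) (simp_all add: ren_ok_up)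
  then show ?case by (simp add: ren_sub1)
next
  case (t_iapp \<Gamma> A B t)
  have "has_ty \<Delta> (TIApp (ren r t)) (ren r B)"
    using t_iapp by (intro has_ty.t_iapp[of _ "ren r A"]) simp_all
  then show ?case by simp
next
  case (t_conv \<Gamma> t A B)
  then show ?case using has_ty.t_conv[OF t_conv.IH(1)[OF t_conv.prems] conv_ren[OF t_conv.hyps(2)]]
    by simp
qed

lemma has_ty_shift: "has_ty \<Gamma> t A \<Longrightarrow> has_ty (B # \<Gamma>) (shift t) (shift A)"
  using has_ty_ren ren_ok_Suc by blast

lemma has_ty_shift_sort: "has_ty \<Gamma> A TSort \<Longrightarrow> has_ty (B # \<Gamma>) (shift A) TSort"
  using has_ty_shift[of \<Gamma> A TSort] by simp

lemma has_ty_var0: "has_ty \<Gamma> A TSort \<Longrightarrow> has_ty (A # \<Gamma>) (TVar 0) (shift A)"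
  using has_ty.t_var[of 0 "A # \<Gamma>"] has_ty_shift_sort by simp

text \<open>
  Contexts are not assumed well formed here. The second alternative makes the relation stable under
  binders without strengthening: a variable may be sent to a variable whose type is not yet known to
  be a type.
\<close>

definition sub_ok :: "(nat \<Rightarrow> trm) \<Rightarrow> trm list \<Rightarrow> trm list \<Rightarrow> bool" where
  "sub_ok \<sigma> \<Gamma> \<Delta> \<longleftrightarrow> (\<forall>i < length \<Gamma>. has_ty \<Delta> (\<sigma> i) (sub \<sigma> (look \<Gamma> i))
     \<or> (\<exists>k < length \<Delta>. \<sigma> i = TVar k \<and> look \<Delta> k = sub \<sigma> (look \<Gamma> i)))"

lemma sub_ok_up:
  assumes "sub_ok \<sigma> \<Gamma> \<Delta>"
  shows "sub_ok (up \<sigma>) (A # \<Gamma>) (sub \<sigma> A # \<Delta>)"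
  unfolding sub_ok_def
proof (intro allI impI)
  fix i assume i: "i < length (A # \<Gamma>)"
  show "has_ty (sub \<sigma> A # \<Delta>) (up \<sigma> i) (sub (up \<sigma>) (look (A # \<Gamma>) i))
     \<or> (\<exists>k < length (sub \<sigma> A # \<Delta>). up \<sigma> i = TVar k
        \<and> look (sub \<sigma> A # \<Delta>) k = sub (up \<sigma>) (look (A # \<Gamma>) i))"
  proof (cases i)
    case 0
    then show ?thesis by (intro disjI2 exI[of _ 0]) (simp add: sub_shift)
  next
    case (Suc j)
    with i assms consider "has_ty \<Delta> (\<sigma> j) (sub \<sigma> (look \<Gamma> j))"
      | k where "k < length \<Delta>" "\<sigma> j = TVar k" "look \<Delta> k = sub \<sigma> (look \<Gamma> j)"
      unfolding sub_ok_def by auto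
    then show ?thesis
    proof cases
      case 1
      then show ?thesis using Suc by (simp add: sub_shift has_ty_shift)
    next
      case (2 k)
      then show ?thesis using Suc by (intro disjI2 exI[of _ "Suc k"]) (simp add: sub_shift)
    qed
  qed
qed

lemma has_ty_sub: "has_ty \<Gamma> t A \<Longrightarrow> sub_ok \<sigma> \<Gamma> \<Delta> \<Longrightarrow> has_ty \<Delta> (sub \<sigma> t) (sub \<sigma> A)"
proof (induction arbitrary: \<sigma> \<Delta> rule: has_ty.induct)
  case (t_sort \<Gamma>)
  show ?case by (simp add: has_ty.t_sort)
next
  case (t_var i \<Gamma>)
  \<comment> \<open>The formation premise of \<open>t_var\<close> yields, by induction, exactly what
    the second alternative of \<open>sub_ok\<close> leaves open.\<close>
  have s: "has_ty \<Delta> (sub \<sigma> (look \<Gamma> i)) TSort" using t_var.IH[OF t_var.prems] by simp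
  from t_var.hyps t_var.prems consider "has_ty \<Delta> (\<sigma> i) (sub \<sigma> (look \<Gamma> i))"
    | k where "k < length \<Delta>" "\<sigma> i = TVar k" "look \<Delta> k = sub \<sigma> (look \<Gamma> i)"
    unfolding sub_ok_def by blast
  then show ?case
  proof cases
    case (2 k)
    with s show ?thesis using has_ty.t_var[of k \<Delta>] by simp
  qed simp
next
  case (t_pi \<Gamma> A B)
  then show ?case by (simp add: has_ty.t_pi sub_ok_up)
next
  case (t_ipi \<Gamma> A B)
  then show ?case by (simp add: has_ty.t_ipi)
next
  case (t_lam \<Gamma> A B t)
  then show ?case by (simp add: has_ty.t_lam sub_ok_up)
next
  case (t_ilam \<Gamma> A B t)
  then show ?case by (simp add: has_ty.t_ilam)
next
  case (t_app \<Gamma> A B t u)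
  have "has_ty \<Delta> (TApp (sub \<sigma> t) (sub \<sigma> u)) (sub1 (sub \<sigma> u) (sub (up \<sigma>) B))"
    using t_app by (intro has_ty.t_app[of _ "sub \<sigma> A"]) (simp_all add: sub_ok_up)
  then show ?case by (simp add: sub_sub1)
next
  case (t_iapp \<Gamma> A B t)
  have "has_ty \<Delta> (TIApp (sub \<sigma> t)) (sub \<sigma> B)"
    using t_iapp by (intro has_ty.t_iapp[of _ "sub \<sigma> A"]) simp_all
  then show ?case by simp
next
  case (t_conv \<Gamma> t A B)
  then show ?case using has_ty.t_conv[OF t_conv.IH(1)[OF t_conv.prems] conv_sub[OF t_conv.hyps(2)]]
    by simp
qed

lemma has_ty_sub1:
  assumes "has_ty (A # \<Gamma>) t B" "has_ty \<Gamma> u A"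
  shows "has_ty \<Gamma> (sub1 u t) (sub1 u B)"
proof (rule has_ty_sub[OF assms(1)])
  show "sub_ok (case_nat u TVar) (A # \<Gamma>) \<Gamma>"
    unfolding sub_ok_def
  proof (intro allI impI)
    fix i assume "i < length (A # \<Gamma>)"
    then show "has_ty \<Gamma> (case_nat u TVar i) (sub1 u (look (A # \<Gamma>) i))
      \<or> (\<exists>k < length \<Gamma>. case_nat u TVar i = TVar k \<and> look \<Gamma> k = sub1 u (look (A # \<Gamma>) i))"
      using assms(2) by (cases i) auto
  qed
qed

lemma has_ty_sub1_sort: "has_ty (A # \<Gamma>) B TSort \<Longrightarrow> has_ty \<Gamma> u A \<Longrightarrow> has_ty \<Gamma> (sub1 u B) TSort"
  using has_ty_sub1[of A \<Gamma> B TSort u] by simp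

text \<open>The rules carry the formation of their types as premises, also for variables, so the
  context need not be well formed; only application needs the substitution lemma.\<close>

lemma has_ty_validity: "has_ty \<Gamma> t A \<Longrightarrow> has_ty \<Gamma> A TSort"
  by (induction rule: has_ty.induct) (auto intro: has_ty.intros has_ty_sub1_sort)

section \<open>Replacing a context by a convertible one\<close>

inductive ctx_conv :: "trm list \<Rightarrow> trm list \<Rightarrow> bool" where
  ctx_conv_nil: "ctx_conv [] []"
| ctx_conv_cons: "ctx_conv \<Gamma> \<Gamma>' \<Longrightarrow> has_ty \<Gamma> A TSort \<Longrightarrow> has_ty \<Gamma>' A' TSort \<Longrightarrow> conv A A'
    \<Longrightarrow> ctx_conv (A # \<Gamma>) (A' # \<Gamma>')"

lemma ctx_conv_look:
  "ctx_conv \<Gamma> \<Gamma>' \<Longrightarrow> i < length \<Gamma> \<Longrightarrow> i < length \<Gamma>' \<and> conv (look \<Gamma> i) (look \<Gamma>' i)"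
proof (induction arbitrary: i rule: ctx_conv.induct)
  case (ctx_conv_cons \<Gamma> \<Gamma>' A A')
  then show ?case by (cases i) (auto intro: conv_ren)
qed simp

text \<open>Changing the context is an instance of substitution: it suffices that the identity
  substitution leads from \<open>\<Gamma>\<close> to \<open>\<Gamma>'\<close>.\<close>

lemma has_ty_ctx_conv: "ctx_conv \<Gamma> \<Gamma>' \<Longrightarrow> has_ty \<Gamma> t B \<Longrightarrow> has_ty \<Gamma>' t B"
proof -
  have "has_ty \<Gamma>' (TVar i) (look \<Gamma> i)" if "ctx_conv \<Gamma> \<Gamma>'" "i < length \<Gamma>" for \<Gamma> \<Gamma>' i
    using that
  proof (induction arbitrary: i rule: ctx_conv.induct)
    case (ctx_conv_cons \<Gamma> \<Gamma>' A A')
    \<comment> \<open>Variable 0 has type \<open>A'\<close> in the new context and is converted back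
      to \<open>A\<close>. For that \<open>A\<close> must be a type over \<open>\<Gamma>'\<close>,
      which follows by applying the substitution lemma to the tail already treated.\<close>
    have "sub_ok TVar \<Gamma> \<Gamma>'" using ctx_conv_cons.IH by (simp add: sub_ok_def)
    then have "has_ty \<Gamma>' A TSort" using has_ty_sub ctx_conv_cons.hyps(2) by fastforce
    then have A: "has_ty (A' # \<Gamma>') (shift A) TSort" by (rule has_ty_shift_sort)
    show ?case
    proof (cases i)
      case 0
      have "has_ty (A' # \<Gamma>') (TVar 0) (shift A')" using ctx_conv_cons.hyps(3) by (rule has_ty_var0)
      then have "has_ty (A' # \<Gamma>') (TVar 0) (shift A)"
        using A ctx_conv_cons.hyps(4) by (blast intro: t_conv conv_ren conv_sym)
      with 0 show ?thesis by simp
    next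
      case (Suc j)
      then have "has_ty \<Gamma>' (TVar j) (look \<Gamma> j)" using ctx_conv_cons by simp
      then have "has_ty (A' # \<Gamma>') (shift (TVar j)) (shift (look \<Gamma> j))" by (rule has_ty_shift)
      with Suc show ?thesis by simp
    qed
  qed simp
  then have "sub_ok TVar \<Gamma> \<Gamma>'" if "ctx_conv \<Gamma> \<Gamma>'" for \<Gamma> \<Gamma>' using that by (simp add: sub_ok_def)
  then show "ctx_conv \<Gamma> \<Gamma>' \<Longrightarrow> has_ty \<Gamma> t B \<Longrightarrow> has_ty \<Gamma>' t B" using has_ty_sub by fastforce
qed

lemma ctx_conv_wf_look: "ctx_conv \<Gamma> \<Gamma> \<Longrightarrow> i < length \<Gamma> \<Longrightarrow> has_ty \<Gamma> (look \<Gamma> i) TSort"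
proof (induction \<Gamma> arbitrary: i)
  case (Cons A \<Gamma>)
  from Cons.prems(1) have "ctx_conv \<Gamma> \<Gamma>" "has_ty \<Gamma> A TSort" by (auto elim: ctx_conv.cases)
  with Cons show ?case by (cases i) (auto intro: has_ty_shift_sort)
qed simp

section \<open>Inversion of typing up to convertibility\<close>

lemma inv_var: "has_ty \<Gamma> s T \<Longrightarrow> s = TVar i \<Longrightarrow> i < length \<Gamma> \<and> conv (look \<Gamma> i) T"
  by (induction rule: has_ty.induct) (auto intro: conv_trans)

lemma inv_pi: "has_ty \<Gamma> s T \<Longrightarrow> s = TPi A B
  \<Longrightarrow> has_ty \<Gamma> A TSort \<and> has_ty (A # \<Gamma>) B TSort \<and> conv TSort T"
  by (induction rule: has_ty.induct) (auto intro: conv_trans)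

lemma inv_ipi: "has_ty \<Gamma> s T \<Longrightarrow> s = TIPi A B
  \<Longrightarrow> has_ty \<Gamma> A TSort \<and> has_ty \<Gamma> B TSort \<and> conv TSort T"
  by (induction rule: has_ty.induct) (auto intro: conv_trans)

lemma inv_lam: "has_ty \<Gamma> s T \<Longrightarrow> s = TLam t
  \<Longrightarrow> \<exists>A B. has_ty \<Gamma> A TSort \<and> has_ty (A # \<Gamma>) B TSort \<and> has_ty (A # \<Gamma>) t B \<and> conv (TPi A B) T"
  by (induction rule: has_ty.induct) (auto intro: conv_trans conv_refl)

lemma inv_ilam: "has_ty \<Gamma> s T \<Longrightarrow> s = TILam t
  \<Longrightarrow> \<exists>A B. has_ty \<Gamma> A TSort \<and> has_ty \<Gamma> B TSort \<and> has_ty \<Gamma> t B \<and> conv (TIPi A B) T"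
  by (induction rule: has_ty.induct) (auto intro: conv_trans conv_refl)

lemma inv_app: "has_ty \<Gamma> s T \<Longrightarrow> s = TApp t u
  \<Longrightarrow> \<exists>A B. has_ty \<Gamma> A TSort \<and> has_ty (A # \<Gamma>) B TSort \<and> has_ty \<Gamma> t (TPi A B) \<and> has_ty \<Gamma> u A
    \<and> conv (sub1 u B) T"
  by (induction rule: has_ty.induct) (auto intro: conv_trans conv_refl)

lemma inv_iapp: "has_ty \<Gamma> s T \<Longrightarrow> s = TIApp t
  \<Longrightarrow> \<exists>A B. has_ty \<Gamma> A TSort \<and> has_ty \<Gamma> B TSort \<and> has_ty \<Gamma> t (TIPi A B) \<and> conv B T"
  by (induction rule: has_ty.induct) (auto intro: conv_trans conv_refl)

section \<open>Weak head reduction and subject reduction\<close>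

inductive wh :: "trm \<Rightarrow> trm \<Rightarrow> bool" where
  wh_beta: "wh (TApp (TLam t) u) (sub1 u t)"
| wh_ibeta: "wh (TIApp (TILam t)) t"
| wh_app: "wh t t' \<Longrightarrow> wh (TApp t u) (TApp t' u)"
| wh_iapp: "wh t t' \<Longrightarrow> wh (TIApp t) (TIApp t')"

inductive_cases wh_appE [consumes 1, case_names beta app]: "wh (TApp t u) v"
inductive_cases wh_iappE [consumes 1, case_names beta app]: "wh (TIApp t) v"

abbreviation whs :: "trm \<Rightarrow> trm \<Rightarrow> bool" where
  "whs \<equiv> wh\<^sup>*\<^sup>*"

lemma wh_conv: "wh t t' \<Longrightarrow> conv t t'"
  by (induction rule: wh.induct) (auto intro: conv_beta conv_ibeta conv_app conv_iapp)

lemma whs_conv: "whs t t' \<Longrightarrow> conv t t'"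
  by (induction rule: rtranclp_induct) (auto intro: wh_conv conv_trans)

lemma wh_sub: "wh t t' \<Longrightarrow> wh (sub \<sigma> t) (sub \<sigma> t')"
  by (induction rule: wh.induct) (auto simp: sub_sub1 intro: wh.intros)

lemma whs_sub: "whs t t' \<Longrightarrow> whs (sub \<sigma> t) (sub \<sigma> t')"
  by (induction rule: rtranclp_induct) (auto dest: wh_sub[of _ _ \<sigma>])

lemma whs_ren: "whs t t' \<Longrightarrow> whs (ren r t) (ren r t')"
  by (simp add: ren_as_sub whs_sub)

lemma whs_app: "whs t t' \<Longrightarrow> whs (TApp t u) (TApp t' u)"
  by (induction rule: rtranclp_induct) (auto intro: wh_app rtranclp.rtrancl_into_rtrancl)

lemma whs_iapp: "whs t t' \<Longrightarrow> whs (TIApp t) (TIApp t')"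
  by (induction rule: rtranclp_induct) (auto intro: wh_iapp rtranclp.rtrancl_into_rtrancl)

lemma whs_app_beta: "whs t (TLam s) \<Longrightarrow> whs (TApp t u) (sub1 u s)"
  by (meson whs_app wh_beta rtranclp.rtrancl_into_rtrancl)

lemma whs_iapp_beta: "whs t (TILam s) \<Longrightarrow> whs (TIApp t) s"
  by (meson whs_iapp wh_ibeta rtranclp.rtrancl_into_rtrancl)

text \<open>In a beta redex the abstraction is typed at some \<open>TPi A' B'\<close> convertible to
  the \<open>TPi A B\<close> used by the application; injectivity moves the argument to
  \<open>A'\<close> and the result back to \<open>T\<close>. Restricting to weak head steps keeps
  out eta contraction, whose typing would call for strengthening.\<close>

lemma subject_reduction: "wh t t' \<Longrightarrow> has_ty \<Gamma> t T \<Longrightarrow> has_ty \<Gamma> t' T"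
proof (induction arbitrary: T rule: wh.induct)
  case (wh_beta t u)
  have T: "has_ty \<Gamma> T TSort" using wh_beta has_ty_validity by blast
  obtain A B where 1: "has_ty \<Gamma> (TLam t) (TPi A B)" "has_ty \<Gamma> u A" "conv (sub1 u B) T"
    using inv_app[OF wh_beta refl] by blast
  obtain A' B' where 2: "has_ty \<Gamma> A' TSort" "has_ty (A' # \<Gamma>) t B'" "conv (TPi A' B') (TPi A B)"
    using inv_lam[OF 1(1) refl] by blast
  have "conv A A'" "conv B' B" using conv_pi_inject[OF 2(3)] conv_sym by blast+
  then have "has_ty \<Gamma> u A'" using 1 2 t_conv by blast
  then have "has_ty \<Gamma> (sub1 u t) (sub1 u B')" using 2 has_ty_sub1 by blast
  moreover have "conv (sub1 u B') T" using \<open>conv B' B\<close> 1(3) conv_sub conv_trans by blast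
  ultimately show ?case using T t_conv by blast
next
  case (wh_ibeta t)
  have T: "has_ty \<Gamma> T TSort" using wh_ibeta has_ty_validity by blast
  obtain A B where 1: "has_ty \<Gamma> (TILam t) (TIPi A B)" "conv B T"
    using inv_iapp[OF wh_ibeta refl] by blast
  obtain A' B' where 2: "has_ty \<Gamma> t B'" "conv (TIPi A' B') (TIPi A B)"
    using inv_ilam[OF 1(1) refl] by blast
  then have "conv B' T" using conv_ipi_inject[OF 2(2)] 1(2) conv_trans by blast
  then show ?case using 2 T t_conv by blast
next
  case (wh_app t t' u)
  have T: "has_ty \<Gamma> T TSort" using wh_app.prems has_ty_validity by blast
  obtain A B where 1: "has_ty \<Gamma> A TSort" "has_ty (A # \<Gamma>) B TSort" "has_ty \<Gamma> t (TPi A B)"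
    "has_ty \<Gamma> u A" "conv (sub1 u B) T"
    using inv_app[OF wh_app.prems refl] by blast
  then have "has_ty \<Gamma> (TApp t' u) (sub1 u B)" using wh_app.IH t_app by blast
  then show ?case using T 1 t_conv by blast
next
  case (wh_iapp t t')
  have T: "has_ty \<Gamma> T TSort" using wh_iapp.prems has_ty_validity by blast
  obtain A B where 1: "has_ty \<Gamma> A TSort" "has_ty \<Gamma> B TSort" "has_ty \<Gamma> t (TIPi A B)" "conv B T"
    using inv_iapp[OF wh_iapp.prems refl] by blast
  then have "has_ty \<Gamma> (TIApp t') B" using wh_iapp.IH t_iapp by blast
  then show ?case using T 1 t_conv by blast
qed

lemma whs_has_ty: "whs t t' \<Longrightarrow> has_ty \<Gamma> t T \<Longrightarrow> has_ty \<Gamma> t' T"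
  by (induction rule: rtranclp_induct) (auto intro: subject_reduction)

text \<open>An abstraction has only types convertible to a function type, and none of these is
  convertible to \<open>TSort\<close>. This is what later discards the eta clauses for
  types.\<close>

lemma sort_not_lam: "\<not> has_ty \<Gamma> (TLam t) TSort" "\<not> has_ty \<Gamma> (TILam t) TSort"
  using inv_lam[OF _ refl] inv_ilam[OF _ refl] by fastforce+

lemma sort_not_whs_lam:
  "has_ty \<Gamma> A TSort \<Longrightarrow> \<not> whs A (TLam t)" "has_ty \<Gamma> A TSort \<Longrightarrow> \<not> whs A (TILam t)"
  using whs_has_ty sort_not_lam by blast+

text \<open>An abstraction without domain can have many types, but a neutral term inherits its type
  from the head variable, with injectivity of function types at each application. This ties the type
  inferred by the algorithm to the type given by a typing derivation.\<close>

lemma neu_unique: "neu i n \<Longrightarrow> has_ty \<Gamma> n A \<Longrightarrow> has_ty \<Gamma> n B \<Longrightarrow> conv A B"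
proof (induction arbitrary: A B rule: neu.induct)
  case (neu_var i)
  then show ?case using inv_var[OF _ refl] conv_sym conv_trans by meson
next
  case (neu_app i t u)
  obtain A1 B1 where 1: "has_ty \<Gamma> t (TPi A1 B1)" "conv (sub1 u B1) A"
    using inv_app[OF neu_app.prems(1) refl] by blast
  obtain A2 B2 where 2: "has_ty \<Gamma> t (TPi A2 B2)" "conv (sub1 u B2) B"
    using inv_app[OF neu_app.prems(2) refl] by blast
  have "conv B1 B2" using neu_app.IH[OF 1(1) 2(1)] conv_pi_inject by blast
  then show ?case using 1(2) 2(2) conv_sub conv_sym conv_trans by meson
next
  case (neu_iapp i t)
  obtain A1 B1 where 1: "has_ty \<Gamma> t (TIPi A1 B1)" "conv B1 A"
    using inv_iapp[OF neu_iapp.prems(1) refl] by blast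
  obtain A2 B2 where 2: "has_ty \<Gamma> t (TIPi A2 B2)" "conv B2 B"
    using inv_iapp[OF neu_iapp.prems(2) refl] by blast
  have "conv B1 B2" using neu_iapp.IH[OF 1(1) 2(1)] conv_ipi_inject by blast
  then show ?case using 1(2) 2(2) conv_sym conv_trans by meson
qed

section \<open>Standard reduction\<close>

text \<open>
  Standard reduction. The two eta clauses put off every eta contraction until after the weak head
  reduction of its redex; without them the relation would not be closed under \<open>step\<close>.
\<close>

inductive std :: "trm \<Rightarrow> trm \<Rightarrow> bool" where
  std_sort: "whs M TSort \<Longrightarrow> std M TSort"
| std_bul: "whs M TBul \<Longrightarrow> std M TBul"
| std_var: "whs M (TVar i) \<Longrightarrow> std M (TVar i)"
| std_pi: "whs M (TPi P Q) \<Longrightarrow> std P P' \<Longrightarrow> std Q Q' \<Longrightarrow> std M (TPi P' Q')"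
| std_ipi: "whs M (TIPi P Q) \<Longrightarrow> std P P' \<Longrightarrow> std Q Q' \<Longrightarrow> std M (TIPi P' Q')"
| std_lam: "whs M (TLam P) \<Longrightarrow> std P P' \<Longrightarrow> std M (TLam P')"
| std_ilam: "whs M (TILam P) \<Longrightarrow> std P P' \<Longrightarrow> std M (TILam P')"
| std_app: "whs M (TApp P Q) \<Longrightarrow> std P P' \<Longrightarrow> std Q Q' \<Longrightarrow> std M (TApp P' Q')"
| std_iapp: "whs M (TIApp P) \<Longrightarrow> std P P' \<Longrightarrow> std M (TIApp P')"
| std_eta: "whs M (TLam P) \<Longrightarrow> std P (TApp (shift N) (TVar 0)) \<Longrightarrow> std M N"
| std_ieta: "whs M (TILam P) \<Longrightarrow> std P (TIApp N) \<Longrightarrow> std M N"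

lemma std_refl: "std M M"
  by (induction M) (blast intro: std.intros)+

lemma whs_st: "std M' N \<Longrightarrow> whs M M' \<Longrightarrow> std M N"
  by (induction rule: std.cases) (metis rtranclp_trans std.intros)+

lemma std_ren: "std M N \<Longrightarrow> std (ren r M) (ren r N)"
proof (induction arbitrary: r rule: std.induct)
  case (std_eta M P N)
  have "whs (ren r M) (TLam (ren (up_ren r) P))" using whs_ren[OF std_eta.hyps(1)] by simp
  moreover have "std (ren (up_ren r) P) (TApp (shift (ren r N)) (TVar 0))"
    using std_eta.IH[of "up_ren r"] by (simp add: ren_shift)
  ultimately show ?case by (rule std.std_eta)
next
  case (std_ieta M P N)
  have "whs (ren r M) (TILam (ren r P))" using whs_ren[OF std_ieta.hyps(1)] by simp
  moreover have "std (ren r P) (TIApp (ren r N))" using std_ieta.IH[of r] by simp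
  ultimately show ?case by (rule std.std_ieta)
next
  case (std_sort M)
  then show ?case using whs_ren[of M TSort r] by (auto intro: std.std_sort)
next
  case (std_bul M)
  then show ?case using whs_ren[of M TBul r] by (auto intro: std.std_bul)
next
  case (std_var M i)
  then show ?case using whs_ren[of M "TVar i" r] by (auto intro: std.std_var)
next
  case (std_pi M P Q P' Q')
  then show ?case using whs_ren[OF std_pi.hyps(1), of r] by (auto intro: std.std_pi)
next
  case (std_ipi M P Q P' Q')
  then show ?case using whs_ren[OF std_ipi.hyps(1), of r] by (auto intro: std.std_ipi)
next
  case (std_lam M P P')
  then show ?case using whs_ren[OF std_lam.hyps(1), of r] by (auto intro: std.std_lam)
next
  case (std_ilam M P P')
  then show ?case using whs_ren[OF std_ilam.hyps(1), of r] by (auto intro: std.std_ilam)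
next
  case (std_app M P Q P' Q')
  then show ?case using whs_ren[OF std_app.hyps(1), of r] by (auto intro: std.std_app)
next
  case (std_iapp M P P')
  then show ?case using whs_ren[OF std_iapp.hyps(1), of r] by (auto intro: std.std_iapp)
qed

lemma std_up: "(\<And>i. std (\<sigma> i) (\<tau> i)) \<Longrightarrow> std (up \<sigma> i) (up \<tau> i)"
  by (cases i) (auto intro: std_ren std_refl)

lemma std_sub: "std M N \<Longrightarrow> (\<And>i. std (\<sigma> i) (\<tau> i)) \<Longrightarrow> std (sub \<sigma> M) (sub \<tau> N)"
proof (induction arbitrary: \<sigma> \<tau> rule: std.induct)
  case (std_sort M)
  then show ?case using whs_sub[of M TSort \<sigma>] by (auto intro: std.intros)
next
  case (std_bul M)
  then show ?case using whs_sub[of M TBul \<sigma>] by (auto intro: std.intros)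
next
  case (std_var M i)
  then show ?case using whs_sub[of M "TVar i" \<sigma>] by (auto intro: whs_st)
next
  case (std_pi M P Q P' Q')
  have "std (sub (up \<sigma>) Q) (sub (up \<tau>) Q')"
    by (rule std_pi.IH(2), rule std_up, rule std_pi.prems)
  then show ?case using whs_sub[OF std_pi.hyps(1), of \<sigma>] std_pi.IH(1)[OF std_pi.prems]
    by (auto intro: std.std_pi)
next
  case (std_ipi M P Q P' Q')
  show ?case using whs_sub[OF std_ipi.hyps(1), of \<sigma>] std_ipi.IH(1)[OF std_ipi.prems]
      std_ipi.IH(2)[OF std_ipi.prems] by (auto intro: std.std_ipi)
next
  case (std_lam M P P')
  have "std (sub (up \<sigma>) P) (sub (up \<tau>) P')"
    by (rule std_lam.IH, rule std_up, rule std_lam.prems)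
  then show ?case using whs_sub[OF std_lam.hyps(1), of \<sigma>] by (auto intro: std.std_lam)
next
  case (std_ilam M P P')
  show ?case using whs_sub[OF std_ilam.hyps(1), of \<sigma>] std_ilam.IH[OF std_ilam.prems]
    by (auto intro: std.std_ilam)
next
  case (std_app M P Q P' Q')
  show ?case using whs_sub[OF std_app.hyps(1), of \<sigma>] std_app.IH(1)[OF std_app.prems]
      std_app.IH(2)[OF std_app.prems] by (auto intro: std.std_app)
next
  case (std_iapp M P P')
  show ?case using whs_sub[OF std_iapp.hyps(1), of \<sigma>] std_iapp.IH[OF std_iapp.prems]
    by (auto intro: std.std_iapp)
next
  case (std_eta M P N)
  have "std (sub (up \<sigma>) P) (sub (up \<tau>) (TApp (shift N) (TVar 0)))"
    by (rule std_eta.IH, rule std_up, rule std_eta.prems)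
  then show ?case using whs_sub[OF std_eta.hyps(1), of \<sigma>] by (auto simp: sub_shift intro: std.std_eta)
next
  case (std_ieta M P N)
  show ?case using whs_sub[OF std_ieta.hyps(1), of \<sigma>] std_ieta.IH[OF std_ieta.prems]
    by (auto intro: std.std_ieta)
qed

lemma std_sub1: "std M M' \<Longrightarrow> std N N' \<Longrightarrow> std (sub1 N M) (sub1 N' M')"
  by (rule std_sub) (auto split: nat.split intro: std_refl)

section \<open>Standardization of typable terms\<close>

definition typable :: "trm \<Rightarrow> bool" where
  "typable t \<longleftrightarrow> (\<exists>\<Gamma> T. has_ty \<Gamma> t T)"

lemma typable_whs: "whs t t' \<Longrightarrow> typable t \<Longrightarrow> typable t'"
  unfolding typable_def using whs_has_ty by blast

lemma typable_sub:
  "typable (TPi A B) \<Longrightarrow> typable A \<and> typable B"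
  "typable (TIPi A B) \<Longrightarrow> typable A \<and> typable B"
  "typable (TLam t) \<Longrightarrow> typable t"
  "typable (TILam t) \<Longrightarrow> typable t"
  "typable (TApp t u) \<Longrightarrow> typable t \<and> typable u"
  "typable (TIApp t) \<Longrightarrow> typable t"
  unfolding typable_def
  using inv_pi[OF _ refl] inv_ipi[OF _ refl] inv_lam[OF _ refl] inv_ilam[OF _ refl]
    inv_app[OF _ refl] inv_iapp[OF _ refl] by meson+

lemma untypable_clash: "\<not> typable (TApp (TILam t) u)" "\<not> typable (TIApp (TLam t))"
proof -
  show "\<not> typable (TApp (TILam t) u)"
  proof
    assume "typable (TApp (TILam t) u)"
    then obtain \<Gamma> A B where "has_ty \<Gamma> (TILam t) (TPi A B)"
      unfolding typable_def using inv_app[OF _ refl] by blast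
    then show False using inv_ilam[OF _ refl] conv_pi_ipi by blast
  qed
  show "\<not> typable (TIApp (TLam t))"
  proof
    assume "typable (TIApp (TLam t))"
    then obtain \<Gamma> A B where "has_ty \<Gamma> (TLam t) (TIPi A B)"
      unfolding typable_def using inv_iapp[OF _ refl] by blast
    then show False using inv_lam[OF _ refl] conv_pi_ipi by blast
  qed
qed

text \<open>
  \<open>TIApp (TLam (TApp (shift (TILam t)) (TVar 0)))\<close> is stuck for weak head reduction, but its eta
  contractum \<open>TIApp (TILam t)\<close> is a redex. Typing excludes such clashes, so standardization is
  proved for typable terms only.
\<close>

inductive clash :: "trm \<Rightarrow> bool" where
  clash_app_ilam: "clash (TApp (TILam t) u)"
| clash_iapp_lam: "clash (TIApp (TLam t))"
| clash_app: "clash t \<Longrightarrow> clash (TApp t u)"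
| clash_iapp: "clash t \<Longrightarrow> clash (TIApp t)"

inductive_cases clash_appE [consumes 1, case_names ilam app]: "clash (TApp t u)"
inductive_cases clash_iappE [consumes 1, case_names lam iapp]: "clash (TIApp t)"
inductive_cases clash_noneE [elim!]: "clash TSort" "clash TBul" "clash (TVar i)" "clash (TPi A B)"
  "clash (TIPi A B)" "clash (TLam t)" "clash (TILam t)"

lemma clash_ren: "clash t \<Longrightarrow> clash (ren r t)"
  by (induction rule: clash.induct) (auto intro: clash.intros)

inductive_cases step_noneE [elim!]: "step TSort t" "step TBul t" "step (TVar i) t"
inductive_cases step_piE [consumes 1]: "step (TPi A B) t"
inductive_cases step_ipiE [consumes 1]: "step (TIPi A B) t"
inductive_cases step_lamE [consumes 1]: "step (TLam s) t"
inductive_cases step_ilamE [consumes 1]: "step (TILam s) t"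
inductive_cases step_appE [consumes 1]: "step (TApp s u) t"
inductive_cases step_iappE [consumes 1]: "step (TIApp s) t"

text \<open>A strengthened induction hypothesis. A beta step at the root of \<open>N\<close> must be
  matched by weak head reduction of \<open>M\<close>, so an abstraction in \<open>N\<close> has to
  be reached by weak head steps already; absence of clashes excludes an abstraction of the wrong
  annotation hidden behind an eta clause.\<close>

definition std_good :: "trm \<Rightarrow> trm \<Rightarrow> bool" where
  "std_good M N \<longleftrightarrow> (\<forall>N'. step N N' \<longrightarrow> std M N')
    \<and> (\<forall>a. N = TLam a \<longrightarrow> (\<exists>P. whs M (TLam P) \<and> std P a))
    \<and> (\<forall>a. N = TILam a \<longrightarrow> (\<exists>P. whs M (TILam P) \<and> std P a))
    \<and> \<not> clash N"

lemma std_goodI: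
  assumes "\<And>N'. step N N' \<Longrightarrow> std M N'"
    "\<And>a. N = TLam a \<Longrightarrow> \<exists>P. whs M (TLam P) \<and> std P a"
    "\<And>a. N = TILam a \<Longrightarrow> \<exists>P. whs M (TILam P) \<and> std P a"
    "\<not> clash N"
  shows "std_good M N"
  using assms unfolding std_good_def by blast

text \<open>In the eta clauses everything is obtained from the hypothesis for the applied term: a
  step of \<open>N\<close> is a step of \<open>TApp (shift N) (TVar 0)\<close>, and if
  \<open>N\<close> is an abstraction, that application is a redex which contracts to its
  body.\<close>

lemma std_closed: "std M N \<Longrightarrow> typable M \<Longrightarrow> std_good M N"
proof (induction rule: std.induct)
  case (std_pi M P Q P' Q')
  have "std_good P P'" "std_good Q Q'" using std_pi typable_whs typable_sub(1) by blast+
  then show ?case using std_pi.hyps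
    by (intro std_goodI) (auto simp: std_good_def elim!: step_piE intro: std.std_pi)
next
  case (std_ipi M P Q P' Q')
  have "std_good P P'" "std_good Q Q'" using std_ipi typable_whs typable_sub(2) by blast+
  then show ?case using std_ipi.hyps
    by (intro std_goodI) (auto simp: std_good_def elim!: step_ipiE intro: std.std_ipi)
next
  case (std_lam M P P')
  have "std_good P P'" using std_lam typable_whs typable_sub(3) by blast
  then show ?case using std_lam.hyps
    by (intro std_goodI) (auto simp: std_good_def elim!: step_lamE intro: std.std_lam std.std_eta)
next
  case (std_ilam M P P')
  have "std_good P P'" using std_ilam typable_whs typable_sub(4) by blast
  then show ?case using std_ilam.hyps
    by (intro std_goodI) (auto simp: std_good_def elim!: step_ilamE intro: std.std_ilam std.std_ieta)
next
  case (std_app M P Q P' Q')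
  have ty: "typable (TApp P Q)" using std_app.hyps(1) std_app.prems typable_whs by blast
  then have P: "std_good P P'" and Q: "std_good Q Q'" using std_app.IH typable_sub(5) by blast+
  show ?case
  proof (rule std_goodI)
    fix N' assume "step (TApp P' Q') N'"
    then show "std M N'"
    proof (cases rule: step_appE)
      \<comment> \<open>A beta step at the root: \<open>P\<close> already weak head reduces to an
        abstraction, so the redex is contracted on the side of \<open>M\<close>, and substitutivity
        of \<open>std\<close> finishes.\<close>
      case (3 a)
      then obtain P1 where "whs P (TLam P1)" "std P1 a" using P unfolding std_good_def by blast
      moreover from this have "whs M (sub1 Q P1)"
        using whs_app_beta std_app.hyps(1) by (meson rtranclp_trans)
      ultimately show ?thesis using 3 std_sub1 std_app.hyps(3) whs_st by blast
    qed (use P Q std_app.hyps in \<open>auto simp: std_good_def intro: std.std_app\<close>)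
  next
    show "\<not> clash (TApp P' Q')"
    proof
      assume "clash (TApp P' Q')"
      then show False
      proof (cases rule: clash_appE)
        case (ilam a)
        then obtain P1 where "whs P (TILam P1)" using P unfolding std_good_def by blast
        then have "typable (TApp (TILam P1) Q)" using ty whs_app typable_whs by blast
        then show False using untypable_clash by blast
      qed (use P in \<open>simp add: std_good_def\<close>)
    qed
  qed auto
next
  case (std_iapp M P P')
  have ty: "typable (TIApp P)" using std_iapp.hyps(1) std_iapp.prems typable_whs by blast
  then have P: "std_good P P'" using std_iapp.IH typable_sub(6) by blast
  show ?case
  proof (rule std_goodI)
    fix N' assume "step (TIApp P') N'"
    then show "std M N'"
    proof (cases rule: step_iappE)
      case 2
      then obtain P1 where "whs P (TILam P1)" "std P1 N'" using P unfolding std_good_def by blast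
      moreover from this have "whs M P1"
        using whs_iapp_beta std_iapp.hyps(1) by (meson rtranclp_trans)
      ultimately show ?thesis using whs_st by blast
    qed (use P std_iapp.hyps in \<open>auto simp: std_good_def intro: std.std_iapp\<close>)
  next
    show "\<not> clash (TIApp P')"
    proof
      assume "clash (TIApp P')"
      then show False
      proof (cases rule: clash_iappE)
        case (lam a)
        then obtain P1 where "whs P (TLam P1)" using P unfolding std_good_def by blast
        then have "typable (TIApp (TLam P1))" using ty whs_iapp typable_whs by blast
        then show False using untypable_clash by blast
      qed (use P in \<open>simp add: std_good_def\<close>)
    qed
  qed auto
next
  case (std_eta M P N)
  have P: "std_good P (TApp (shift N) (TVar 0))" using std_eta typable_whs typable_sub(3) by blast
  show ?case
  proof (rule std_goodI)
    fix N' assume "step N N'"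
    then have "step (TApp (shift N) (TVar 0)) (TApp (shift N') (TVar 0))"
      by (simp add: step_ren step_app1)
    then show "std M N'" using P std_eta.hyps(1) std.std_eta unfolding std_good_def by blast
  next
    fix a assume "N = TLam a"
    then have "step (TApp (shift N) (TVar 0)) a"
      using step_beta[of "ren (up_ren Suc) a" "TVar 0"] by simp
    then show "\<exists>P. whs M (TLam P) \<and> std P a" using P std_eta.hyps(1) unfolding std_good_def by blast
  next
    \<comment> \<open>An irrelevant abstraction under a relevant eta expansion would be a clash,
      which the hypothesis for \<open>P\<close> forbids.\<close>
    fix a assume "N = TILam a"
    then have "clash (TApp (shift N) (TVar 0))" by (simp add: clash_app_ilam)
    then show "\<exists>P. whs M (TILam P) \<and> std P a" using P unfolding std_good_def by blast
  next
    show "\<not> clash N" using P clash_ren clash_app unfolding std_good_def by blast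
  qed
next
  case (std_ieta M P N)
  have P: "std_good P (TIApp N)" using std_ieta typable_whs typable_sub(4) by blast
  show ?case
  proof (rule std_goodI)
    fix N' assume "step N N'"
    then show "std M N'" using P std_ieta.hyps(1) std.std_ieta step_iapp unfolding std_good_def by blast
  next
    fix a assume "N = TILam a"
    then show "\<exists>P. whs M (TILam P) \<and> std P a"
      using P std_ieta.hyps(1) step_ibeta unfolding std_good_def by blast
  next
    fix a assume "N = TLam a"
    then have "clash (TIApp N)" by (simp add: clash_iapp_lam)
    then show "\<exists>P. whs M (TLam P) \<and> std P a" using P unfolding std_good_def by blast
  next
    show "\<not> clash N" using P clash_iapp unfolding std_good_def by blast
  qed
qed (auto intro!: std_goodI)

lemma standardization:
  assumes "typable M" "pars M N"
  shows "std M N"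
  using pars_steps[OF assms(2)]
  by (induction rule: rtranclp_induct) (use std_refl std_closed[OF _ assms(1)] in \<open>auto simp: std_good_def\<close>)

text \<open>Neutral up to eta expansions that weak head reduction cannot remove: this is what
  remains of a term that reduces to a neutral one. Each relevant expansion raises the head index by
  one, each irrelevant one binds nothing.\<close>

inductive eta_neu :: "nat \<Rightarrow> trm \<Rightarrow> bool" where
  eta_neu_whs: "whs M M' \<Longrightarrow> neu i M' \<Longrightarrow> eta_neu i M"
| eta_neu_lam: "whs M (TLam P) \<Longrightarrow> eta_neu (Suc i) P \<Longrightarrow> eta_neu i M"
| eta_neu_ilam: "whs M (TILam P) \<Longrightarrow> eta_neu i P \<Longrightarrow> eta_neu i M"

lemma whs_eta_neu: "eta_neu i M' \<Longrightarrow> whs M M' \<Longrightarrow> eta_neu i M"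
  by (induction rule: eta_neu.cases) (meson rtranclp_trans eta_neu.intros)+

lemma eta_neu_sub: "eta_neu i M \<Longrightarrow> \<sigma> i = TVar j \<Longrightarrow> eta_neu j (sub \<sigma> M)"
proof (induction arbitrary: \<sigma> j rule: eta_neu.induct)
  case (eta_neu_whs M M' i)
  then show ?case using whs_sub neu_sub eta_neu.eta_neu_whs by blast
next
  case (eta_neu_lam M P i)
  have "eta_neu (Suc j) (sub (up \<sigma>) P)" using eta_neu_lam.IH eta_neu_lam.prems by simp
  then show ?case using whs_sub[OF eta_neu_lam.hyps(1), of \<sigma>] eta_neu.eta_neu_lam by simp
next
  case (eta_neu_ilam M P i)
  then show ?case using whs_sub[OF eta_neu_ilam.hyps(1), of \<sigma>] eta_neu.eta_neu_ilam by simp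
qed

text \<open>An argument consumes one layer of expansion: the redex substitutes for variable 0 while
  the head is \<open>Suc i\<close>, so the head survives as \<open>i\<close>. A layer of the other
  annotation is untypable.\<close>

lemma eta_neu_app:
  assumes "eta_neu i P" "typable (TApp P Q)"
  shows "eta_neu i (TApp P Q)"
  using assms(1)
proof (cases rule: eta_neu.cases)
  case (eta_neu_whs M')
  then show ?thesis by (meson eta_neu.eta_neu_whs neu_app whs_app)
next
  case (eta_neu_lam P')
  then show ?thesis using whs_app_beta whs_eta_neu eta_neu_sub[of "Suc i" P' "case_nat Q TVar" i]
    by auto
next
  case (eta_neu_ilam P')
  then show ?thesis using assms(2) by (metis typable_whs untypable_clash(1) whs_app)
qed

lemma eta_neu_iapp:
  assumes "eta_neu i P" "typable (TIApp P)"
  shows "eta_neu i (TIApp P)"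
  using assms(1)
proof (cases rule: eta_neu.cases)
  case (eta_neu_whs M')
  then show ?thesis by (meson eta_neu.eta_neu_whs neu_iapp whs_iapp)
next
  case (eta_neu_lam P')
  then show ?thesis using assms(2) by (metis typable_whs untypable_clash(2) whs_iapp)
next
  case (eta_neu_ilam P')
  then show ?thesis using whs_iapp_beta whs_eta_neu by blast
qed

lemma std_neu: "std M N \<Longrightarrow> typable M \<Longrightarrow> neu i N \<Longrightarrow> eta_neu i M"
proof (induction arbitrary: i rule: std.induct)
  case (std_var M j)
  then have "i = j" by auto
  then show ?case using eta_neu_whs[OF std_var.hyps neu_var] by simp
next
  case (std_app M P Q P' Q')
  have ty: "typable (TApp P Q)" by (rule typable_whs[OF std_app.hyps(1) std_app.prems(1)])
  have "neu i P'" using std_app.prems(2) by auto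
  then have "eta_neu i P" using std_app.IH(1) typable_sub(5)[OF ty] by simp
  then show ?case using eta_neu_app[OF _ ty] whs_eta_neu[OF _ std_app.hyps(1)] by simp
next
  case (std_iapp M P P')
  have ty: "typable (TIApp P)" by (rule typable_whs[OF std_iapp.hyps(1) std_iapp.prems(1)])
  have "neu i P'" using std_iapp.prems(2) by auto
  then have "eta_neu i P" using std_iapp.IH typable_sub(6)[OF ty] by simp
  then show ?case using eta_neu_iapp[OF _ ty] whs_eta_neu[OF _ std_iapp.hyps(1)] by simp
next
  case (std_eta M P N)
  have "typable P" by (rule typable_sub(3)[OF typable_whs[OF std_eta.hyps(1) std_eta.prems(1)]])
  moreover have "neu (Suc i) (TApp (shift N) (TVar 0))" using std_eta.prems(2) by (simp add: neu_ren neu_app)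
  ultimately have "eta_neu (Suc i) P" by (rule std_eta.IH)
  then show ?case by (rule eta_neu_lam[OF std_eta.hyps(1)])
next
  case (std_ieta M P N)
  have "typable P" by (rule typable_sub(4)[OF typable_whs[OF std_ieta.hyps(1) std_ieta.prems(1)]])
  moreover have "neu i (TIApp N)" using std_ieta.prems(2) by (simp add: neu_iapp)
  ultimately have "eta_neu i P" by (rule std_ieta.IH)
  then show ?case by (rule eta_neu_ilam[OF std_ieta.hyps(1)])
qed auto

text \<open>\<open>TSort\<close> is normal, so convertibility gives a reduction to it, and
  standardization puts the weak head steps in front. The eta clauses of \<open>std\<close> would
  make \<open>A\<close> weak head reduce to an abstraction, impossible for a type. Function types
  are treated in the same way below.\<close>

lemma conv_sort_whs:
  assumes "has_ty \<Gamma> A TSort" "conv A TSort"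
  shows "whs A TSort"
proof -
  have "pars A TSort" using assms(2) unfolding conv_def by (metis pars_sort)
  then have "std A TSort" using standardization assms(1) typable_def by blast
  then show ?thesis by (cases rule: std.cases) (use sort_not_whs_lam[OF assms(1)] in auto)
qed

lemma conv_pi_whs:
  assumes "has_ty \<Gamma> A TSort" "conv A (TPi B C)"
  shows "\<exists>B' C'. whs A (TPi B' C')"
proof -
  obtain B1 C1 where "pars A (TPi B1 C1)" using assms(2) unfolding conv_def by (metis pars_pi)
  then have "std A (TPi B1 C1)" using standardization assms(1) typable_def by blast
  then show ?thesis by (cases rule: std.cases) (use sort_not_whs_lam[OF assms(1)] in auto)
qed

lemma conv_ipi_whs:
  assumes "has_ty \<Gamma> A TSort" "conv A (TIPi B C)"
  shows "\<exists>B' C'. whs A (TIPi B' C')"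
proof -
  obtain B1 C1 where "pars A (TIPi B1 C1)" using assms(2) unfolding conv_def by (metis pars_ipi)
  then have "std A (TIPi B1 C1)" using standardization assms(1) typable_def by blast
  then show ?thesis by (cases rule: std.cases) (use sort_not_whs_lam[OF assms(1)] in auto)
qed

text \<open>Here the expansions to be excluded sit in \<open>eta_neu\<close>: an outermost one would
  be an abstraction reached from a type.\<close>

lemma conv_neu_whs:
  assumes "has_ty \<Gamma> A TSort" "conv A N" "neu i N"
  shows "\<exists>N'. whs A N' \<and> neu i N'"
proof -
  obtain M where "pars A M" "neu i M" using assms(2,3) unfolding conv_def by (metis neu_pars)
  then have "std A M" using standardization assms(1) typable_def by blast
  then have "eta_neu i A" using std_neu assms(1) \<open>neu i M\<close> typable_def by blast
  then show ?thesis by (cases rule: eta_neu.cases) (use sort_not_whs_lam[OF assms(1)] in auto)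
qed

section \<open>Erasure\<close>

fun mk_pi :: "ann \<Rightarrow> trm \<Rightarrow> trm \<Rightarrow> trm" where
  "mk_pi Rel A B = TPi A B"
| "mk_pi Irr A B = TIPi A B"

fun mk_lam :: "ann \<Rightarrow> trm \<Rightarrow> trm" where
  "mk_lam Rel t = TLam t"
| "mk_lam Irr t = TILam t"

fun mk_app :: "ann \<Rightarrow> trm \<Rightarrow> trm \<Rightarrow> trm" where
  "mk_app Rel t u = TApp t u"
| "mk_app Irr t u = TIApp t"

text \<open>An irrelevant binder takes up a de Bruijn index in expressions but none in erased terms.
  The environment absorbs the difference: the index goes to \<open>TBul\<close> and the images of
  the others stay unshifted.\<close>

fun bind :: "ann \<Rightarrow> (nat \<Rightarrow> trm) \<Rightarrow> nat \<Rightarrow> trm" where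
  "bind Rel \<rho> = up \<rho>"
| "bind Irr \<rho> = case_nat TBul \<rho>"

fun bind_ctx :: "ann \<Rightarrow> trm \<Rightarrow> trm list \<Rightarrow> trm list" where
  "bind_ctx Rel A \<Gamma> = A # \<Gamma>"
| "bind_ctx Irr A \<Gamma> = \<Gamma>"

fun mk_inst :: "ann \<Rightarrow> trm \<Rightarrow> trm \<Rightarrow> trm" where
  "mk_inst Rel u t = sub1 u t"
| "mk_inst Irr u t = t"

fun mk_shift :: "ann \<Rightarrow> trm \<Rightarrow> trm" where
  "mk_shift Rel t = shift t"
| "mk_shift Irr t = t"

text \<open>
  \<open>TILam\<close> and \<open>TIPi\<close> do not bind, since an irrelevant variable of a well-typed expression occurs
  only in erased positions; a misplaced one becomes the untypable constant \<open>TBul\<close>.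
\<close>

primrec er :: "(nat \<Rightarrow> trm) \<Rightarrow> exp \<Rightarrow> trm" where
  "er \<rho> (Sort s) = TSort"
| "er \<rho> (Pi st U s s' T) = mk_pi st (er \<rho> U) (er (bind st \<rho>) T)"
| "er \<rho> (Var i) = \<rho> i"
| "er \<rho> (Lam st U t) = mk_lam st (er (bind st \<rho>) t)"
| "er \<rho> (App st t u) = mk_app st (er \<rho> t) (er \<rho> u)"

lemma bind_0_Suc [simp]:
  "bind st \<rho> (Suc i) = mk_shift st (\<rho> i)"
  "bind Rel \<rho> 0 = TVar 0"
  by (cases st; simp)+

lemma bind_up_ren: "bind st \<rho> (up_ren r i) = bind st (\<lambda>i. \<rho> (r i)) i"
  by (cases i; cases st) simp_all

lemma er_rename: "er \<rho> (rename r t) = er (\<lambda>i. \<rho> (r i)) t"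
  by (induction t arbitrary: \<rho> r) (simp_all add: bind_up_ren)

lemma sub_mk_pi: "sub \<sigma> (mk_pi st A B) = mk_pi st (sub \<sigma> A) (sub (if st = Rel then up \<sigma> else \<sigma>) B)"
  by (cases st) auto

lemma sub_mk_lam: "sub \<sigma> (mk_lam st t) = mk_lam st (sub (if st = Rel then up \<sigma> else \<sigma>) t)"
  by (cases st) auto

lemma sub_mk_app: "sub \<sigma> (mk_app st t u) = mk_app st (sub \<sigma> t) (sub \<sigma> u)"
  by (cases st) auto

lemma sub_bind:
  "(\<lambda>i. sub (if st = Rel then up \<sigma> else \<sigma>) (bind st \<rho> i)) = bind st (\<lambda>i. sub \<sigma> (\<rho> i))"
proof
  show "sub (if st = Rel then up \<sigma> else \<sigma>) (bind st \<rho> i) = bind st (\<lambda>i. sub \<sigma> (\<rho> i)) i" for i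
    by (cases i; cases st) (simp_all add: sub_shift)
qed

lemma sub_er: "sub \<sigma> (er \<rho> t) = er (\<lambda>i. sub \<sigma> (\<rho> i)) t"
  by (induction t arbitrary: \<rho> \<sigma>)
    (simp_all only: er.simps sub.simps sub_mk_pi sub_mk_lam sub_mk_app sub_bind)

lemma ren_er: "ren r (er \<rho> t) = er (\<lambda>i. ren r (\<rho> i)) t"
  by (simp add: ren_as_sub sub_er)

lemma er_lift: "er (bind st \<rho>) (lift t) = mk_shift st (er \<rho> t)"
  by (cases st) (simp_all add: er_rename ren_er)

lemma er_up_subst: "(\<lambda>i. er (bind st \<rho>) (up_subst \<sigma> i)) = bind st (\<lambda>i. er \<rho> (\<sigma> i))"
proof
  show "er (bind st \<rho>) (up_subst \<sigma> i) = bind st (\<lambda>i. er \<rho> (\<sigma> i)) i" for i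
    by (cases i; cases st) (simp_all add: er_rename ren_er)
qed

lemma er_subst: "er \<rho> (subst \<sigma> t) = er (\<lambda>i. er \<rho> (\<sigma> i)) t"
  by (induction t arbitrary: \<rho> \<sigma>) (simp_all add: er_up_subst)

lemma er_inst: "er \<rho> (inst u t) = er (case_nat (er \<rho> u) \<rho>) t"
proof -
  have "(\<lambda>i. er \<rho> (single u i)) = case_nat (er \<rho> u) \<rho>"
  proof
    show "er \<rho> (single u i) = case_nat (er \<rho> u) \<rho> i" for i by (cases i) auto
  qed
  then show ?thesis by (simp add: inst_def er_subst)
qed

text \<open>The absence of irrelevant variables from relevant positions. Typability guarantees it,
  since \<open>TBul\<close> has no typing rule.\<close>

primrec bul_free :: "trm \<Rightarrow> bool" where
  "bul_free TSort = True"
| "bul_free TBul = False"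
| "bul_free (TVar i) = True"
| "bul_free (TPi A B) = (bul_free A \<and> bul_free B)"
| "bul_free (TIPi A B) = (bul_free A \<and> bul_free B)"
| "bul_free (TLam t) = bul_free t"
| "bul_free (TILam t) = bul_free t"
| "bul_free (TApp t u) = (bul_free t \<and> bul_free u)"
| "bul_free (TIApp t) = bul_free t"

lemma has_ty_bul_free: "has_ty \<Gamma> t T \<Longrightarrow> bul_free t"
  by (induction rule: has_ty.induct) auto

lemma typable_bul_free: "typable t \<Longrightarrow> bul_free t"
  using has_ty_bul_free unfolding typable_def by blast

lemma bul_eq_shift [simp]: "TBul = shift t \<longleftrightarrow> TBul = t" "shift t = TBul \<longleftrightarrow> t = TBul"
  by (cases t; simp)+

text \<open>An index sent to \<open>TBul\<close> leaves a trace in the erasure wherever it occurs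
  outside erased positions. If there is no trace, its image can be changed freely.\<close>

lemma er_agree:
  "bul_free (er \<rho> t) \<Longrightarrow> (\<And>i. \<rho> i \<noteq> TBul \<Longrightarrow> \<rho>' i = \<rho> i) \<Longrightarrow> er \<rho>' t = er \<rho> t"
proof (induction t arbitrary: \<rho> \<rho>')
  have bind: "bind st \<rho>' i = bind st \<rho> i"
    if "\<And>i. \<rho> i \<noteq> TBul \<Longrightarrow> \<rho>' i = \<rho> i" "bind st \<rho> i \<noteq> TBul" for \<rho> \<rho>' st i
    using that by (cases i; cases st) auto
  {
    case (Pi st U s s' T)
    have "er \<rho>' U = er \<rho> U" using Pi.IH(1)[of \<rho> \<rho>'] Pi.prems by (cases st) auto
    moreover have "er (bind st \<rho>') T = er (bind st \<rho>) T"
      by (rule Pi.IH(2), use Pi.prems(1) in \<open>cases st; simp\<close>, rule bind[OF Pi.prems(2)])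
    ultimately show ?case by simp
  next
    case (Lam st U t)
    have "er (bind st \<rho>') t = er (bind st \<rho>) t"
      by (rule Lam.IH(2), use Lam.prems(1) in \<open>cases st; simp\<close>, rule bind[OF Lam.prems(2)])
    then show ?case by simp
  next
    case (App st t u)
    show ?case using App.IH[of \<rho> \<rho>'] App.prems by (cases st) auto
  }
next
  case (Var i)
  then show ?case by (metis bul_free.simps(2) er.simps(3))
qed auto

text \<open>In the irrelevant case the environments of the two sides differ only at index 0, which
  one of them sends to \<open>TBul\<close>; freeness from \<open>TBul\<close> prevents the argument
  from surfacing.\<close>

lemma er_inst_bind:
  assumes "bul_free (er (bind st \<rho>) t)"
  shows "er \<rho> (inst u t) = mk_inst st (er \<rho> u) (er (bind st \<rho>) t)"
proof (cases st)
  case Rel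
  have "(\<lambda>i. sub1 (er \<rho> u) (up \<rho> i)) = case_nat (er \<rho> u) \<rho>"
  proof
    show "sub1 (er \<rho> u) (up \<rho> i) = case_nat (er \<rho> u) \<rho> i" for i by (cases i) auto
  qed
  then show ?thesis using Rel by (simp add: er_inst sub_er)
next
  case Irr
  have "er (case_nat (er \<rho> u) \<rho>) t = er (case_nat TBul \<rho>) t"
    by (rule er_agree) (use assms Irr in \<open>auto split: nat.splits\<close>)
  then show ?thesis using Irr by (simp add: er_inst)
qed

lemma t_mk_pi: "has_ty \<Gamma> A TSort \<Longrightarrow> has_ty (bind_ctx st A \<Gamma>) B TSort \<Longrightarrow> has_ty \<Gamma> (mk_pi st A B) TSort"
  by (cases st) (auto intro: t_pi t_ipi)

lemma t_mk_lam: "has_ty \<Gamma> A TSort \<Longrightarrow> has_ty (bind_ctx st A \<Gamma>) B TSort \<Longrightarrow> has_ty (bind_ctx st A \<Gamma>) t B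
  \<Longrightarrow> has_ty \<Gamma> (mk_lam st t) (mk_pi st A B)"
  by (cases st) (auto intro: t_lam t_ilam)

lemma inv_mk_pi: "has_ty \<Gamma> (mk_pi st A B) T \<Longrightarrow> has_ty \<Gamma> A TSort \<and> has_ty (bind_ctx st A \<Gamma>) B TSort"
  by (cases st) (auto dest: inv_pi[OF _ refl] inv_ipi[OF _ refl])

lemma t_mk_app:
  assumes "has_ty \<Gamma> t (mk_pi st A B)" "st = Rel \<Longrightarrow> has_ty \<Gamma> u A"
  shows "has_ty \<Gamma> (mk_app st t u) (mk_inst st u B)"
  using inv_mk_pi[OF has_ty_validity[OF assms(1)]] assms by (cases st) (auto intro: t_app t_iapp)

lemma inv_mk_app: "has_ty \<Gamma> (mk_app st t u) T \<Longrightarrow>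
  \<exists>A B. has_ty \<Gamma> t (mk_pi st A B) \<and> (st = Rel \<longrightarrow> has_ty \<Gamma> u A) \<and> conv (mk_inst st u B) T"
  by (cases st) (use inv_app[OF _ refl] inv_iapp[OF _ refl] in \<open>fastforce+\<close>)

lemma conv_mk_pi: "conv A A' \<Longrightarrow> conv B B' \<Longrightarrow> conv (mk_pi st A B) (mk_pi st A' B')"
  by (cases st) (auto intro: conv_pi conv_ipi)

lemma conv_mk_lam: "conv t t' \<Longrightarrow> conv (mk_lam st t) (mk_lam st t')"
  by (cases st) (auto intro: conv_lam conv_ilam)

lemma conv_mk_app: "conv t t' \<Longrightarrow> (st = Rel \<Longrightarrow> conv u u') \<Longrightarrow> conv (mk_app st t u) (mk_app st t' u')"
  by (cases st) (auto intro: conv_app conv_iapp)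

lemma conv_mk_inst: "conv t t' \<Longrightarrow> (st = Rel \<Longrightarrow> conv u u') \<Longrightarrow> conv (mk_inst st u t) (mk_inst st u' t')"
  by (cases st) (auto intro: conv_sub1)

lemma conv_mk_pi_inject: "conv (mk_pi st A B) (mk_pi st A' B') \<Longrightarrow> conv A A' \<and> conv B B'"
  by (cases st) (auto dest: conv_pi_inject conv_ipi_inject)

lemma conv_mk_beta: "conv (mk_app st (mk_lam st t) u) (mk_inst st u t)"
  by (cases st) (auto intro: conv_beta conv_ibeta)

lemma conv_mk_eta: "conv (mk_lam st (mk_app st (mk_shift st t) (bind st \<rho> 0))) t"
  by (cases st) (auto intro: conv_eta conv_ieta)

lemma conv_mk_ext:
  "conv (mk_app st (mk_shift st t) (bind st \<rho> 0)) (mk_app st (mk_shift st u) (bind st \<rho> 0)) \<Longrightarrow> conv t u"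
  by (cases st) (auto intro: conv_ext conv_iext)

lemma t_mk_app_shift:
  assumes "has_ty \<Gamma> t (mk_pi st A B)"
  shows "has_ty (bind_ctx st A \<Gamma>) (mk_app st (mk_shift st t) (bind st \<rho> 0)) B"
proof (cases st)
  case Rel
  have A: "has_ty \<Gamma> A TSort" using inv_mk_pi[OF has_ty_validity[OF assms]] by blast
  have "has_ty (A # \<Gamma>) (shift t) (mk_pi Rel (shift A) (ren (up_ren Suc) B))"
    using has_ty_shift[of \<Gamma> t "TPi A B" A] assms Rel by simp
  from t_mk_app[OF this, of "TVar 0"] has_ty_var0[OF A] have "has_ty (A # \<Gamma>) (TApp (shift t) (TVar 0)) B" by simp
  with Rel show ?thesis by simp
next
  case Irr
  then show ?thesis using t_mk_app[of \<Gamma> t Irr A B] assms by simp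
qed

section \<open>Erasure of contexts and related contexts\<close>

fun env :: "ctx \<Rightarrow> nat \<Rightarrow> trm" where
  "env [] = TVar"
| "env ((st, U) # \<Delta>) = bind st (env \<Delta>)"

abbreviation erase :: "ctx \<Rightarrow> exp \<Rightarrow> trm" where
  "erase \<Delta> \<equiv> er (env \<Delta>)"

fun erase_ctx :: "ctx \<Rightarrow> trm list" where
  "erase_ctx [] = []"
| "erase_ctx ((st, U) # \<Delta>) = bind_ctx st (erase \<Delta> U) (erase_ctx \<Delta>)"

lemma in_ctx_erase: "in_ctx i T \<Delta> \<Longrightarrow>
  \<exists>k < length (erase_ctx \<Delta>). env \<Delta> i = TVar k \<and> look (erase_ctx \<Delta>) k = erase \<Delta> T"
proof (induction \<Delta> arbitrary: i T)
  case (Cons x \<Delta>)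
  obtain st U where x: "x = (st, U)" by (cases x)
  show ?case
  proof (cases i)
    case 0
    then have "st = Rel" "T = rename Suc U" using Cons.prems x by (auto simp: in_ctx_def)
    then show ?thesis using x 0 er_lift[of Rel "env \<Delta>" U] by (intro exI[of _ 0]) simp
  next
    case (Suc j)
    then obtain V where V: "j < length \<Delta>" "\<Delta> ! j = (Rel, V)" "T = rename (\<lambda>k. k + (Suc j + 1)) V"
      using Cons.prems by (auto simp: in_ctx_def)
    define T' where "T' = rename (\<lambda>k. k + (j + 1)) V"
    have "in_ctx j T' \<Delta>" using V by (auto simp: in_ctx_def T'_def)
    then obtain k where k: "k < length (erase_ctx \<Delta>)" "env \<Delta> j = TVar k" "look (erase_ctx \<Delta>) k = erase \<Delta> T'"
      using Cons.IH by blast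
    have T: "erase (x # \<Delta>) T = mk_shift st (erase \<Delta> T')"
      unfolding x V(3) T'_def by (cases st) (simp_all add: er_rename ren_er)
    show ?thesis
    proof (cases st)
      case Rel
      then show ?thesis using x Suc k T by (intro exI[of _ "Suc k"]) simp
    next
      case Irr
      then show ?thesis using x Suc k T by (intro exI[of _ k]) simp
    qed
  qed
qed (simp add: in_ctx_def)

text \<open>The diagonal \<open>ctx_rel \<Delta> \<Delta>\<close> serves as well-formedness of the
  erased context. Off the diagonal it relates the contexts met by the two sides of a comparison
  after passing under binders with different domains.\<close>

inductive ctx_rel :: "ctx \<Rightarrow> ctx \<Rightarrow> bool" where
  ctx_rel_nil: "ctx_rel [] []"
| ctx_rel_cons: "ctx_rel \<Delta> \<Delta>' \<Longrightarrow> has_ty (erase_ctx \<Delta>) (erase \<Delta> U) TSort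
    \<Longrightarrow> has_ty (erase_ctx \<Delta>') (erase \<Delta>' U') TSort \<Longrightarrow> conv (erase \<Delta> U) (erase \<Delta>' U')
    \<Longrightarrow> ctx_rel ((st, U) # \<Delta>) ((st, U') # \<Delta>')"

text \<open>The environment depends on the annotations alone, which related contexts share. Hence an
  expression has the same erasure over both, and only the recorded types change.\<close>

lemma ctx_rel_env: "ctx_rel \<Delta> \<Delta>' \<Longrightarrow> env \<Delta> = env \<Delta>'"
  by (induction rule: ctx_rel.induct) auto

lemma ctx_rel_fst: "ctx_rel \<Delta> \<Delta>' \<Longrightarrow> map fst \<Delta> = map fst \<Delta>'"
  by (induction rule: ctx_rel.induct) auto

lemma ctx_rel_sym: "ctx_rel \<Delta> \<Delta>' \<Longrightarrow> ctx_rel \<Delta>' \<Delta>"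
  by (induction rule: ctx_rel.induct) (auto intro: ctx_rel.intros conv_sym)

lemma ctx_rel_refl: "ctx_rel \<Delta> \<Delta>' \<Longrightarrow> ctx_rel \<Delta> \<Delta>"
  by (induction rule: ctx_rel.induct) (auto intro: ctx_rel.intros)

lemma ctx_rel_erase: "ctx_rel \<Delta> \<Delta>' \<Longrightarrow> ctx_conv (erase_ctx \<Delta>) (erase_ctx \<Delta>')"
proof (induction rule: ctx_rel.induct)
  case (ctx_rel_cons \<Delta> \<Delta>' U U' st)
  then show ?case by (cases st) (auto intro: ctx_conv.intros)
qed (simp add: ctx_conv.intros)

lemma ctx_rel_has_ty: "ctx_rel \<Delta> \<Delta>' \<Longrightarrow> has_ty (erase_ctx \<Delta>) t T \<longleftrightarrow> has_ty (erase_ctx \<Delta>') t T"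
  using has_ty_ctx_conv ctx_rel_erase ctx_rel_sym by blast

lemma ctx_rel_consD:
  "ctx_rel ((st, U) # \<Delta>) ((st, U) # \<Delta>) \<Longrightarrow> ctx_rel \<Delta> \<Delta> \<and> has_ty (erase_ctx \<Delta>) (erase \<Delta> U) TSort"
  by (auto elim: ctx_rel.cases)

lemma ctx_rel_in_ctx:
  assumes "ctx_rel \<Delta> \<Delta>'" "in_ctx i T \<Delta>"
  shows "\<exists>T'. in_ctx i T' \<Delta>' \<and> conv (erase \<Delta> T) (erase \<Delta> T')"
proof -
  obtain U where U: "i < length \<Delta>" "\<Delta> ! i = (Rel, U)" using assms(2) by (auto simp: in_ctx_def)
  have len: "length \<Delta> = length \<Delta>'" using ctx_rel_fst[OF assms(1)] by (metis length_map)
  then have "fst (\<Delta>' ! i) = Rel"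
    using ctx_rel_fst[OF assms(1)] U by (metis fst_conv nth_map)
  then have "\<exists>T'. in_ctx i T' \<Delta>'" using U len unfolding in_ctx_def by (metis prod.collapse)
  then obtain T' where T': "in_ctx i T' \<Delta>'" by blast
  obtain k where k: "k < length (erase_ctx \<Delta>)" "env \<Delta> i = TVar k" "look (erase_ctx \<Delta>) k = erase \<Delta> T"
    using in_ctx_erase[OF assms(2)] by blast
  obtain k' where "env \<Delta>' i = TVar k'" "look (erase_ctx \<Delta>') k' = erase \<Delta>' T'"
    using in_ctx_erase[OF T'] by blast
  then have "look (erase_ctx \<Delta>') k = erase \<Delta> T'" using k(2) ctx_rel_env[OF assms(1)] by simp
  then show ?thesis using ctx_conv_look[OF ctx_rel_erase[OF assms(1)] k(1)] k(3) T' by auto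
qed

lemma in_ctx_unique: "in_ctx i T \<Delta> \<Longrightarrow> in_ctx i T' \<Delta> \<Longrightarrow> T = T'"
  by (auto simp: in_ctx_def)

section \<open>Soundness of erasure for the declarative judgements\<close>

lemma has_ty_in_ctx:
  assumes "ctx_rel \<Delta> \<Delta>" "in_ctx i T \<Delta>"
  shows "has_ty (erase_ctx \<Delta>) (env \<Delta> i) (erase \<Delta> T)"
proof -
  obtain k where k: "k < length (erase_ctx \<Delta>)" "env \<Delta> i = TVar k" "look (erase_ctx \<Delta>) k = erase \<Delta> T"
    using in_ctx_erase[OF assms(2)] by blast
  show ?thesis using t_var[OF k(1) ctx_conv_wf_look[OF ctx_rel_erase[OF assms(1)] k(1)]] k by simp
qed

text \<open>Equality is strengthened to include typing of both sides, so that conversions and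
  congruences go through by induction. Arguments checked in a resurrected context sit in erased
  positions, which is why any two of them become convertible.\<close>

lemma erase_sound:
  "\<turnstile> \<Gamma> \<Longrightarrow> ctx_rel \<Gamma> \<Gamma>"
  "\<Gamma> \<turnstile> t \<Colon> T \<Longrightarrow> ctx_rel \<Gamma> \<Gamma> \<and> has_ty (erase_ctx \<Gamma>) (erase \<Gamma> t) (erase \<Gamma> T)"
  "\<Gamma> \<turnstile> t \<doteq> t' \<Colon> T \<Longrightarrow> ctx_rel \<Gamma> \<Gamma> \<and> has_ty (erase_ctx \<Gamma>) (erase \<Gamma> t) (erase \<Gamma> T)
    \<and> has_ty (erase_ctx \<Gamma>) (erase \<Gamma> t') (erase \<Gamma> T) \<and> conv (erase \<Gamma> t) (erase \<Gamma> t')"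
proof (induction rule: wf_ctx_typing_equality.inducts)
  case (wf_ext \<Gamma> T s st)
  then show ?case by (auto intro: ctx_rel_cons)
next
  case (ty_pi \<Gamma> U s1 st T s2 s3)
  then show ?case by (auto intro: t_mk_pi)
next
  case (ty_var \<Gamma> i U)
  then show ?case by (auto intro: has_ty_in_ctx)
next
  case (ty_lam st U \<Gamma> t T s s' s3)
  then show ?case by (auto intro!: t_mk_lam dest: inv_mk_pi)
next
  case (ty_app \<Gamma> t st U s s' T u)
  have t: "has_ty (erase_ctx \<Gamma>) (erase \<Gamma> t) (mk_pi st (erase \<Gamma> U) (er (bind st (env \<Gamma>)) T))"
    using ty_app by simp
  have "bul_free (er (bind st (env \<Gamma>)) T)"
    using inv_mk_pi[OF has_ty_validity[OF t]] has_ty_bul_free by blast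
  moreover have "st = Rel \<Longrightarrow> has_ty (erase_ctx \<Gamma>) (erase \<Gamma> u) (erase \<Gamma> U)" using ty_app by simp
  ultimately show ?case using t_mk_app[OF t] ty_app by (simp add: er_inst_bind)
next
  case (ty_conv \<Gamma> t T T' s)
  then show ?case using t_conv by fastforce
next
  case (eq_beta st U \<Gamma> t T u)
  \<comment> \<open>The beta rule has no formation premise: that \<open>U\<close> is a type is read
    off the well-formed extended context, and that \<open>T\<close> is one follows from
    validity.\<close>
  then have c: "ctx_rel \<Gamma> \<Gamma>" and U: "has_ty (erase_ctx \<Gamma>) (erase \<Gamma> U) TSort"
    and t: "has_ty (bind_ctx st (erase \<Gamma> U) (erase_ctx \<Gamma>)) (er (bind st (env \<Gamma>)) t) (er (bind st (env \<Gamma>)) T)"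
    using ctx_rel_consD by auto
  note T = has_ty_validity[OF t]
  have u: "st = Rel \<Longrightarrow> has_ty (erase_ctx \<Gamma>) (erase \<Gamma> u) (erase \<Gamma> U)" using eq_beta by simp
  note lam = t_mk_lam[OF U T t]
  have "has_ty (erase_ctx \<Gamma>) (mk_inst st (erase \<Gamma> u) (er (bind st (env \<Gamma>)) t))
      (mk_inst st (erase \<Gamma> u) (er (bind st (env \<Gamma>)) T))"
    using t u by (cases st) (auto intro: has_ty_sub1)
  then show ?case
    using c t_mk_app[OF lam u] conv_mk_beta has_ty_bul_free[OF t] has_ty_bul_free[OF T]
    by (simp add: er_inst_bind)
next
  case (eq_eta \<Gamma> t st U s s' T)
  then have t: "has_ty (erase_ctx \<Gamma>) (erase \<Gamma> t) (mk_pi st (erase \<Gamma> U) (er (bind st (env \<Gamma>)) T))"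
    by simp
  have "has_ty (erase_ctx \<Gamma>) (erase \<Gamma> (Lam st U (App st (lift t) (Var 0))))
    (mk_pi st (erase \<Gamma> U) (er (bind st (env \<Gamma>)) T))"
    using inv_mk_pi[OF has_ty_validity[OF t]] t_mk_app_shift[OF t] by (auto simp: er_lift intro: t_mk_lam)
  then show ?case using t eq_eta conv_mk_eta conv_sym by (simp add: er_lift)
next
  case (eq_sym \<Gamma> t t' T)
  then show ?case using conv_sym by blast
next
  case (eq_trans \<Gamma> t1 t2 T t3)
  then show ?case using conv_trans by blast
next
  case (eq_pi \<Gamma> U U' s1 st T T' s2 s3)
  \<comment> \<open>By induction \<open>T'\<close> is a type over \<open>U\<close>, but the
    right-hand function type needs it over \<open>U'\<close>.\<close>
  then have c: "ctx_rel ((st, U) # \<Gamma>) ((st, U') # \<Gamma>)" by (auto intro: ctx_rel_cons)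
  have "has_ty (erase_ctx ((st, U') # \<Gamma>)) (erase ((st, U') # \<Gamma>) T') TSort"
    using ctx_rel_has_ty[OF c] eq_pi by simp
  then show ?case using eq_pi by (auto intro: t_mk_pi conv_mk_pi)
next
  case (eq_lam \<Gamma> U U' s1 st T s2 t t')
  then show ?case by (auto intro: t_mk_lam conv_mk_lam)
next
  case (eq_app_rel \<Gamma> t t' U s s' T u u')
  have t: "has_ty (erase_ctx \<Gamma>) (erase \<Gamma> t) (mk_pi Rel (erase \<Gamma> U) (er (bind Rel (env \<Gamma>)) T))"
    "has_ty (erase_ctx \<Gamma>) (erase \<Gamma> t') (mk_pi Rel (erase \<Gamma> U) (er (bind Rel (env \<Gamma>)) T))"
    using eq_app_rel by simp_all
  have "bul_free (er (bind Rel (env \<Gamma>)) T)"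
    using inv_mk_pi[OF has_ty_validity[OF t(1)]] has_ty_bul_free by blast
  note [simp] = er_inst_bind[OF this]
  have a: "has_ty (erase_ctx \<Gamma>) (erase \<Gamma> (App Rel t u)) (erase \<Gamma> (inst u T))"
    using t_mk_app[OF t(1)] eq_app_rel by simp
  have "has_ty (erase_ctx \<Gamma>) (erase \<Gamma> (App Rel t' u')) (erase \<Gamma> (inst u' T))"
    using t_mk_app[OF t(2)] eq_app_rel by simp
  \<comment> \<open>Application types the right-hand side at \<open>inst u' T\<close>;
    convertibility of the arguments moves it to \<open>inst u T\<close>.\<close>
  moreover have "conv (erase \<Gamma> (inst u' T)) (erase \<Gamma> (inst u T))"
    using conv_mk_inst[OF conv_refl, of Rel] conv_sym eq_app_rel by simp
  ultimately have "has_ty (erase_ctx \<Gamma>) (erase \<Gamma> (App Rel t' u')) (erase \<Gamma> (inst u T))"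
    using has_ty_validity[OF a] t_conv by blast
  then show ?case using a eq_app_rel conv_mk_app[of _ _ Rel] by simp
next
  case (eq_app_irr \<Gamma> t t' U s s' T u u')
  have t: "has_ty (erase_ctx \<Gamma>) (erase \<Gamma> t) (mk_pi Irr (erase \<Gamma> U) (er (bind Irr (env \<Gamma>)) T))"
    "has_ty (erase_ctx \<Gamma>) (erase \<Gamma> t') (mk_pi Irr (erase \<Gamma> U) (er (bind Irr (env \<Gamma>)) T))"
    using eq_app_irr by simp_all
  have "bul_free (er (bind Irr (env \<Gamma>)) T)"
    using inv_mk_pi[OF has_ty_validity[OF t(1)]] has_ty_bul_free by blast
  note [simp] = er_inst_bind[OF this]
  show ?case using t_mk_app[OF t(1)] t_mk_app[OF t(2)] eq_app_irr conv_iapp by simp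
next
  case (eq_conv \<Gamma> t t' T T' s)
  then show ?case using t_conv by fastforce
qed (auto intro: ctx_rel_nil t_sort)

section \<open>Evaluation of expressions and weak head reduction of erasures\<close>

lemma neutral_not_lam: "\<not> neutral (Lam st U t)" "\<not> neutral (Sort s)" "\<not> neutral (Pi st U s s' T)"
  by (auto elim: neutral.cases)

inductive_cases eval_appE: "App st t u \<searrow> a"
inductive_cases app_eval_lamE: "app_eval st (Lam st' U t) u a"

lemma app_eval_neutral: "neutral n \<Longrightarrow> app_eval st n u a \<Longrightarrow> a = App st n u"
  by (auto elim: app_eval.cases simp: neutral_not_lam)

lemma eval_neutral: "neutral n \<Longrightarrow> n \<searrow> a \<Longrightarrow> a = n"
proof (induction arbitrary: a rule: neutral.induct)
  case (1 i)
  then show ?case by (auto elim: eval.cases)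
next
  case (2 n st u)
  from \<open>App st n u \<searrow> a\<close> show ?case
    by (rule eval_appE) (use 2 app_eval_neutral in blast)+
qed

lemma eval_whnf: "whnf a \<Longrightarrow> a \<searrow> b \<Longrightarrow> b = a"
  by (auto elim!: whnf.cases dest: eval_neutral elim: eval.cases)

text \<open>The rules overlap only at neutral applications, which evaluate to themselves both by
  \<open>ev_whnf\<close> and through \<open>app_ne\<close>.\<close>

lemma eval_deterministic:
  "t \<searrow> a \<Longrightarrow> t \<searrow> b \<Longrightarrow> b = a"
  "app_eval st f u a \<Longrightarrow> app_eval st f u b \<Longrightarrow> b = a"
proof (induction arbitrary: b and b rule: eval_app_eval.inducts)
  case (ev_whnf a)
  then show ?case using eval_whnf by blast
next
  case (ev_app t f st u a)
  from \<open>App st t u \<searrow> b\<close> show ?case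
  proof (rule eval_appE)
    assume b: "b = App st t u" "whnf (App st t u)"
    then have "neutral t" by (auto elim: whnf.cases neutral.cases)
    then have "f = t" using ev_app.hyps(1) eval_neutral by blast
    then show ?thesis using \<open>neutral t\<close> ev_app.hyps(2) app_eval_neutral b by blast
  next
    fix f' assume "t \<searrow> f'" "app_eval st f' u b"
    then show ?thesis using ev_app.IH by blast
  qed
next
  case (app_lam u t a st U)
  from \<open>app_eval st (Lam st U t) u b\<close> show ?case
    by (rule app_eval_lamE) (use app_lam.IH neutral_not_lam in blast)+
next
  case (app_ne n st u)
  then show ?case using app_eval_neutral by blast
qed

definition var_env :: "(nat \<Rightarrow> trm) \<Rightarrow> bool" where
  "var_env \<rho> \<longleftrightarrow> (\<forall>i. \<rho> i = TBul \<or> (\<exists>k. \<rho> i = TVar k))"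

lemma var_env_env: "var_env (env \<Delta>)"
proof (induction \<Delta>)
  case (Cons x \<Delta>)
  obtain st U where x: "x = (st, U)" by (cases x)
  have "bind st (env \<Delta>) i = TBul \<or> (\<exists>k. bind st (env \<Delta>) i = TVar k)" for i
    using Cons unfolding var_env_def by (cases i; cases st) (simp, simp, force+)
  then show ?case using x by (simp add: var_env_def)
qed (simp add: var_env_def)

lemma neutral_neu: "neutral n \<Longrightarrow> var_env \<rho> \<Longrightarrow> bul_free (er \<rho> n) \<Longrightarrow> \<exists>i. neu i (er \<rho> n)"
proof (induction rule: neutral.induct)
  case (1 i)
  then show ?case unfolding var_env_def by (metis bul_free.simps(2) er.simps(3) neu_var)
next
  case (2 n st u)
  then show ?case by (cases st) (auto intro: neu.intros)
qed

text \<open>Only a variable could hide an arbitrary erased term, and a \<open>var_env\<close> lets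
  it be nothing but a variable or \<open>TBul\<close>. So the head constructor of the erasure
  reveals that of the expression.\<close>

lemma er_cases:
  assumes "var_env \<rho>"
  shows "er \<rho> t = TSort \<Longrightarrow> \<exists>s. t = Sort s"
    "er \<rho> t = mk_pi st A B \<Longrightarrow> \<exists>U s s' T. t = Pi st U s s' T \<and> A = er \<rho> U \<and> B = er (bind st \<rho>) T"
    "er \<rho> t = mk_lam st a \<Longrightarrow> \<exists>U b. t = Lam st U b \<and> a = er (bind st \<rho>) b"
    "neu i (er \<rho> t) \<Longrightarrow> neutral t"
proof -
  note v = assms[unfolded var_env_def]
  have mk: "mk_pi st A B \<noteq> TSort" "mk_lam st a \<noteq> TSort" "mk_app st' a b \<noteq> TSort"
    "TSort \<noteq> mk_pi st A B" "TSort \<noteq> mk_lam st a"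
    "mk_pi st A B \<noteq> TBul" "mk_lam st a \<noteq> TBul" "mk_pi st A B \<noteq> TVar k" "mk_lam st a \<noteq> TVar k"
    "mk_pi st A B \<noteq> mk_lam st' a" "mk_lam st' a \<noteq> mk_pi st A B"
    "mk_app st' t u \<noteq> mk_pi st A B" "mk_app st' t u \<noteq> mk_lam st a"
    "mk_pi st A B = mk_pi st' A' B' \<longleftrightarrow> st = st' \<and> A = A' \<and> B = B'"
    "mk_lam st a = mk_lam st' b \<longleftrightarrow> st = st' \<and> a = b"
    for st st' A B A' B' a b t u k
    by (cases st; cases st'; simp)+
  show "er \<rho> t = TSort \<Longrightarrow> \<exists>s. t = Sort s"
    using v by (cases t) (auto simp: mk, metis trm.distinct(1,3))
  show "er \<rho> t = mk_pi st A B \<Longrightarrow> \<exists>U s s' T. t = Pi st U s s' T \<and> A = er \<rho> U \<and> B = er (bind st \<rho>) T"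
    using v by (cases t) (auto simp: mk, metis mk(6,8))
  show "er \<rho> t = mk_lam st a \<Longrightarrow> \<exists>U b. t = Lam st U b \<and> a = er (bind st \<rho>) b"
    using v by (cases t) (auto simp: mk, metis mk(7,9))
  show "neu i (er \<rho> t) \<Longrightarrow> neutral t"
  proof (induction t)
    case (App st t u)
    then show ?case by (cases st) (auto intro: neutral.intros)
  next
    case (Pi st U s s' T)
    then show ?case by (cases st) auto
  next
    case (Lam st U t)
    then show ?case by (cases st) auto
  qed (auto intro: neutral.intros)
qed

lemma typable_mk_app: "typable (mk_app st t u) \<Longrightarrow> typable t"
  by (cases st) (auto dest: typable_sub)

lemma whs_mk_app: "whs t t' \<Longrightarrow> whs (mk_app st t u) (mk_app st t' u)"
  by (cases st) (auto intro: whs_app whs_iapp)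

lemma wh_mk_beta: "wh (mk_app st (mk_lam st t) u) (mk_inst st u t)"
  by (cases st) (auto intro: wh.intros)

lemma bul_free_mk_lam_app: "bul_free (mk_app st (mk_lam st t) u) \<Longrightarrow> bul_free t"
  by (cases st) auto

text \<open>Typability enters through beta: it makes the body free of \<open>TBul\<close>, so that
  instantiation commutes with erasure.\<close>

lemma eval_whs:
  "t \<searrow> a \<Longrightarrow> typable (er \<rho> t) \<Longrightarrow> whs (er \<rho> t) (er \<rho> a)"
  "app_eval st f u a \<Longrightarrow> typable (mk_app st (er \<rho> f) (er \<rho> u)) \<Longrightarrow> whs (mk_app st (er \<rho> f) (er \<rho> u)) (er \<rho> a)"
proof (induction rule: eval_app_eval.inducts)
  case (ev_app t f st u a)
  then have "typable (er \<rho> t)" using typable_mk_app by simp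
  then have *: "whs (mk_app st (er \<rho> t) (er \<rho> u)) (mk_app st (er \<rho> f) (er \<rho> u))"
    using ev_app.IH(1) whs_mk_app by blast
  then have "typable (mk_app st (er \<rho> f) (er \<rho> u))" using ev_app.prems typable_whs by simp
  then show ?case using * ev_app.IH(2) by (simp add: rtranclp_trans)
next
  case (app_lam u t a st U)
  have b: "bul_free (er (bind st \<rho>) t)" using app_lam.prems typable_bul_free bul_free_mk_lam_app by fastforce
  have w: "wh (mk_app st (er \<rho> (Lam st U t)) (er \<rho> u)) (er \<rho> (inst u t))"
    using wh_mk_beta er_inst_bind[OF b] by simp
  then have "typable (er \<rho> (inst u t))" using typable_whs app_lam.prems by blast
  then show ?case using w app_lam.IH by (meson converse_rtranclp_into_rtranclp)
qed auto

text \<open>If \<open>App st t' u\<close> is already weak head normal, then \<open>t'\<close> is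
  neutral, hence a value of \<open>t\<close> as well, and \<open>app_ne\<close> rebuilds the
  application.\<close>

lemma eval_app_head:
  assumes "\<And>a. t' \<searrow> a \<Longrightarrow> t \<searrow> a" "App st t' u \<searrow> a"
  shows "App st t u \<searrow> a"
  using assms(2)
proof (rule eval_appE)
  assume a: "a = App st t' u" "whnf (App st t' u)"
  then have "neutral t'" by (auto elim: whnf.cases neutral.cases)
  then show ?thesis using assms(1) a by (auto intro: ev_app app_ne ev_whnf whnf.intros)
next
  fix f assume "t' \<searrow> f" "app_eval st f u a"
  then show ?thesis using assms(1) ev_app by blast
qed

lemma wh_mk_appE:
  assumes "wh (mk_app st t u) v"
  obtains (beta) a where "t = mk_lam st a" "v = mk_inst st u a"
  | (head) t' where "wh t t'" "v = mk_app st t' u"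
proof (cases st)
  case Rel
  with assms have "wh (TApp t u) v" by simp
  then show thesis using that Rel by (cases rule: wh_appE) auto
next
  case Irr
  with assms have "wh (TIApp t) v" by simp
  then show thesis using that Irr by (cases rule: wh_iappE) auto
qed

lemma wh_no_cases: "\<not> wh TSort v" "\<not> wh TBul v" "\<not> wh (TVar i) v" "\<not> wh (mk_pi st A B) v"
  "\<not> wh (mk_lam st t) v"
  by (auto elim: wh.cases; cases st; auto elim: wh.cases)+

text \<open>The converse simulation. Expressions come with big-step evaluation only, so a lifted
  step is described by its effect on values: whatever the lifted reduct evaluates to is also a value
  of \<open>t\<close>.\<close>

lemma wh_eval:
  "wh (er \<rho> t) v \<Longrightarrow> typable (er \<rho> t) \<Longrightarrow> var_env \<rho> \<Longrightarrow> \<exists>t'. er \<rho> t' = v \<and> (\<forall>a. t' \<searrow> a \<longrightarrow> t \<searrow> a)"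
proof (induction t arbitrary: v)
  case (App st t u)
  from App.prems(1) have "wh (mk_app st (er \<rho> t) (er \<rho> u)) v" by simp
  then show ?case
  proof (cases rule: wh_mk_appE)
    case (beta a)
    obtain U b where t: "t = Lam st U b" "a = er (bind st \<rho>) b"
      using er_cases(3)[OF App.prems(3) beta(1)] by blast
    have "bul_free (er (bind st \<rho>) b)"
      using App.prems(2) typable_bul_free bul_free_mk_lam_app t by fastforce
    then have "er \<rho> (inst u b) = v" using beta t by (simp add: er_inst_bind)
    moreover have "App st t u \<searrow> a'" if "inst u b \<searrow> a'" for a'
      using that unfolding t by (blast intro: ev_app ev_whnf app_lam whnf.intros)
    ultimately show ?thesis by blast
  next
    case (head w)
    obtain t' where t': "er \<rho> t' = w" "\<And>a. t' \<searrow> a \<Longrightarrow> t \<searrow> a"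
      using App.IH(1)[OF head(1)] App.prems typable_mk_app by auto
    have "App st t u \<searrow> a" if "App st t' u \<searrow> a" for a
      by (rule eval_app_head[OF t'(2) that])
    then show ?thesis using head t'(1) by (intro exI[of _ "App st t' u"]) auto
  qed
next
  case (Var i)
  then show ?case using wh_no_cases unfolding var_env_def by (metis er.simps(3))
qed (auto simp: wh_no_cases)

lemma whs_eval:
  assumes "whs (er \<rho> t) v" "typable (er \<rho> t)" "var_env \<rho>"
  shows "\<exists>t'. er \<rho> t' = v \<and> (\<forall>a. t' \<searrow> a \<longrightarrow> t \<searrow> a)"
  using assms(1)
proof (induction rule: rtranclp_induct)
  case base
  then show ?case by blast
next
  case (step v w)
  then obtain t' where t': "er \<rho> t' = v" "\<forall>a. t' \<searrow> a \<longrightarrow> t \<searrow> a" by blast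
  then have "typable (er \<rho> t')" using step.hyps(1) assms(2) typable_whs by blast
  then show ?case using wh_eval[of \<rho> t' w] t' step.hyps(2) assms(3) by blast
qed

section \<open>Evaluation of types known up to convertibility\<close>

lemma conv_mk_pi_eval:
  assumes "has_ty (erase_ctx \<Delta>) (erase \<Delta> T) TSort" "conv (erase \<Delta> T) (mk_pi st A B)"
  obtains U s s' T' where "T \<searrow> Pi st U s s' T'"
    "conv (erase \<Delta> U) A" "conv (er (bind st (env \<Delta>)) T') B"
    "has_ty (erase_ctx \<Delta>) (mk_pi st (erase \<Delta> U) (er (bind st (env \<Delta>)) T')) TSort"
proof -
  obtain A' B' where w: "whs (erase \<Delta> T) (mk_pi st A' B')"
    using conv_pi_whs[OF assms(1)] conv_ipi_whs[OF assms(1)] assms(2) by (cases st) fastforce+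
  then obtain T1 where T1: "erase \<Delta> T1 = mk_pi st A' B'" "\<forall>a. T1 \<searrow> a \<longrightarrow> T \<searrow> a"
    using whs_eval var_env_env assms(1) typable_def by blast
  obtain U s s' T' where T': "T1 = Pi st U s s' T'" "A' = erase \<Delta> U" "B' = er (bind st (env \<Delta>)) T'"
    using er_cases(2)[OF var_env_env T1(1)] by blast
  have "conv (mk_pi st A' B') (mk_pi st A B)" using whs_conv[OF w] assms(2) conv_sym conv_trans by blast
  moreover have "T \<searrow> T1" using T1(2) T' by (simp add: ev_whnf whnf.intros)
  ultimately show thesis using T' that conv_mk_pi_inject whs_has_ty[OF w assms(1)] by blast
qed

lemma conv_sort_eval:
  assumes "has_ty (erase_ctx \<Delta>) (erase \<Delta> T) TSort" "conv (erase \<Delta> T) TSort"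
  shows "\<exists>s. T \<searrow> Sort s"
proof -
  obtain T1 where T1: "erase \<Delta> T1 = TSort" "\<forall>a. T1 \<searrow> a \<longrightarrow> T \<searrow> a"
    using whs_eval[OF conv_sort_whs[OF assms]] var_env_env assms(1) typable_def by blast
  then show ?thesis using er_cases(1)[OF var_env_env T1(1)] by (auto intro: ev_whnf whnf.intros)
qed

lemma conv_neutral_eval:
  assumes "has_ty (erase_ctx \<Delta>) (erase \<Delta> T) TSort" "conv (erase \<Delta> T) (erase \<Delta> N)" "neutral N"
    "has_ty (erase_ctx \<Delta>) (erase \<Delta> N) TSort"
  obtains N' where "T \<searrow> N'" "neutral N'"
proof -
  obtain i where "neu i (erase \<Delta> N)"
    using neutral_neu[OF assms(3) var_env_env] has_ty_bul_free[OF assms(4)] by blast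
  then obtain v where w: "whs (erase \<Delta> T) v" "neu i v" using conv_neu_whs[OF assms(1,2)] by blast
  obtain T1 where T1: "erase \<Delta> T1 = v" "\<forall>a. T1 \<searrow> a \<longrightarrow> T \<searrow> a"
    using whs_eval[OF w(1)] var_env_env assms(1) typable_def by blast
  then have "neutral T1" using er_cases(4)[OF var_env_env] w(2) by blast
  then show thesis using T1(2) that by (auto intro: ev_whnf whnf.intros)
qed

section \<open>Algorithmic equality\<close>

abbreviation etype :: "ctx \<Rightarrow> exp \<Rightarrow> bool" where
  "etype \<Delta> T \<equiv> has_ty (erase_ctx \<Delta>) (erase \<Delta> T) TSort"

abbreviation ety :: "ctx \<Rightarrow> exp \<Rightarrow> exp \<Rightarrow> bool" where
  "ety \<Delta> t T \<equiv> has_ty (erase_ctx \<Delta>) (erase \<Delta> t) (erase \<Delta> T)"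

abbreviation econv :: "ctx \<Rightarrow> exp \<Rightarrow> exp \<Rightarrow> bool" where
  "econv \<Delta> t u \<equiv> conv (erase \<Delta> t) (erase \<Delta> u)"

definition etypable :: "ctx \<Rightarrow> exp \<Rightarrow> bool" where
  "etypable \<Delta> t \<longleftrightarrow> (\<exists>A. has_ty (erase_ctx \<Delta>) (erase \<Delta> t) A)"

lemma etypableI: "has_ty (erase_ctx \<Delta>) (erase \<Delta> t) A \<Longrightarrow> etypable \<Delta> t"
  unfolding etypable_def by blast

lemma etypable_head: "etypable \<Delta> (App st n u) \<Longrightarrow> etypable \<Delta> n"
  unfolding etypable_def using inv_mk_app by fastforce

lemma eval_has_ty:
  assumes "t \<searrow> a" "has_ty (erase_ctx \<Delta>) (erase \<Delta> t) A"
  shows "has_ty (erase_ctx \<Delta>) (erase \<Delta> a) A" "econv \<Delta> t a"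
proof -
  have "whs (erase \<Delta> t) (erase \<Delta> a)"
    using eval_whs(1)[OF assms(1)] assms(2) unfolding typable_def by blast
  then show "has_ty (erase_ctx \<Delta>) (erase \<Delta> a) A" "econv \<Delta> t a"
    using whs_has_ty assms(2) whs_conv by blast+
qed

lemma eval_etypable: "t \<searrow> a \<Longrightarrow> etypable \<Delta> t \<Longrightarrow> etypable \<Delta> a"
  unfolding etypable_def using eval_has_ty(1) by blast

lemma ctx_rel_consI: "ctx_rel \<Delta> \<Delta>' \<Longrightarrow> etype \<Delta> U \<Longrightarrow> etype \<Delta> U' \<Longrightarrow> econv \<Delta> U U'
  \<Longrightarrow> ctx_rel ((st, U) # \<Delta>) ((st, U') # \<Delta>')"
  using ctx_rel_has_ty ctx_rel_env ctx_rel_cons by metis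

lemma etypable_ctx_rel: "ctx_rel \<Delta> \<Delta>' \<Longrightarrow> etypable \<Delta>' t \<longleftrightarrow> etypable \<Delta> t"
  unfolding etypable_def using ctx_rel_has_ty ctx_rel_env by metis

lemma etype_ctx_rel: "ctx_rel \<Delta> \<Delta>' \<Longrightarrow> etype \<Delta>' T \<Longrightarrow> etype \<Delta> T"
  using ctx_rel_has_ty ctx_rel_env by metis

lemma etype_pi: "etype \<Delta> (Pi st U s s' T) \<Longrightarrow> etype \<Delta> U \<and> etype ((st, U) # \<Delta>) T"
  using inv_mk_pi by simp

lemma ety_app_var:
  assumes "ety \<Delta> t (Pi st U s s' T)"
  shows "ety ((st, U) # \<Delta>) (App st (lift t) (Var 0)) T"
  using t_mk_app_shift[of "erase_ctx \<Delta>" "erase \<Delta> t" st] assms by (simp add: er_lift)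

lemma erase_inst:
  assumes "etype \<Delta> (Pi st U s s' T)"
  shows "erase \<Delta> (inst u T) = mk_inst st (erase \<Delta> u) (er (bind st (env \<Delta>)) T)"
  by (rule er_inst_bind) (use etype_pi[OF assms] has_ty_bul_free in auto)

text \<open>Typability of the application gives the head some function type; uniqueness of types for
  neutral terms identifies it with the inferred one, so the argument has the domain on which the
  algorithm compares it.\<close>

lemma ne_app_ety:
  assumes "neutral n" "ety \<Delta> n (Pi st U s s' T)" "etypable \<Delta> (App st n u)"
  shows "st = Rel \<Longrightarrow> ety \<Delta> u U" "ety \<Delta> (App st n u) (inst u T)"
proof -
  have pi: "etype \<Delta> (Pi st U s s' T)" using has_ty_validity[OF assms(2)] .
  obtain A B where AB: "has_ty (erase_ctx \<Delta>) (erase \<Delta> n) (mk_pi st A B)"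
    "st = Rel \<longrightarrow> has_ty (erase_ctx \<Delta>) (erase \<Delta> u) A"
    using assms(3) inv_mk_app unfolding etypable_def by fastforce
  obtain i where i: "neu i (erase \<Delta> n)"
    using neutral_neu[OF assms(1) var_env_env has_ty_bul_free[OF AB(1)]] by blast
  have "conv (mk_pi st A B) (mk_pi st (erase \<Delta> U) (er (bind st (env \<Delta>)) T))"
    using neu_unique[OF i AB(1) assms(2)] by simp
  then have "conv A (erase \<Delta> U)" by (blast dest: conv_mk_pi_inject)
  then show u: "ety \<Delta> u U" if "st = Rel" using that AB(2) etype_pi[OF pi] t_conv by blast
  show "ety \<Delta> (App st n u) (inst u T)"
    using t_mk_app[of "erase_ctx \<Delta>" "erase \<Delta> n" st] assms(2) u erase_inst[OF pi] by simp
qed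

lemmas alg_inducts = ty_eq_ty_eq_w_ne_eq_ne_eq_w_tm_eq_tm_eq_w.inducts

lemma ne_eq_neutral:
  "ne_eq \<Delta> n n' T \<Longrightarrow> neutral n \<and> neutral n'"
proof -
  have "(ty_eq \<Delta>1 T1 T1' \<longrightarrow> True) \<and> (ty_eq_w \<Delta>2 T2 T2' \<longrightarrow> True)
    \<and> (ne_eq \<Delta> n n' T \<longrightarrow> neutral n \<and> neutral n') \<and> (ne_eq_w \<Delta>3 n3 n3' T3 \<longrightarrow> neutral n3 \<and> neutral n3')
    \<and> (tm_eq \<Delta>4 t4 t4' T4 \<longrightarrow> True) \<and> (tm_eq_w \<Delta>5 t5 t5' T5 \<longrightarrow> True)"
    for \<Delta>1 T1 T1' \<Delta>2 T2 T2' \<Delta>3 n3 n3' T3 \<Delta>4 t4 t4' T4 \<Delta>5 t5 t5' T5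
    by (rule ty_eq_ty_eq_w_ne_eq_ne_eq_w_tm_eq_tm_eq_w.induct) (auto intro: neutral.intros)
  then show "ne_eq \<Delta> n n' T \<Longrightarrow> neutral n \<and> neutral n'" by blast
qed

text \<open>Symmetry and transitivity need this at every binder and every argument: convertible
  domains give related contexts, and convertible arguments give convertible instances of a codomain.
  Neutral comparison starts from mere typability and returns its inferred type as a type of both
  sides.\<close>

lemma alg_sound:
  "ty_eq \<Delta> T T' \<Longrightarrow> ctx_rel \<Delta> \<Delta> \<Longrightarrow> etype \<Delta> T \<Longrightarrow> etype \<Delta> T' \<Longrightarrow> econv \<Delta> T T'"
  "ty_eq_w \<Delta> T T' \<Longrightarrow> ctx_rel \<Delta> \<Delta> \<Longrightarrow> etype \<Delta> T \<Longrightarrow> etype \<Delta> T' \<Longrightarrow> econv \<Delta> T T'"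
  "ne_eq \<Delta> n n' T \<Longrightarrow> ctx_rel \<Delta> \<Delta> \<Longrightarrow> etypable \<Delta> n \<Longrightarrow> etypable \<Delta> n'
    \<Longrightarrow> econv \<Delta> n n' \<and> ety \<Delta> n T \<and> ety \<Delta> n' T"
  "ne_eq_w \<Delta> n n' T \<Longrightarrow> ctx_rel \<Delta> \<Delta> \<Longrightarrow> etypable \<Delta> n \<Longrightarrow> etypable \<Delta> n'
    \<Longrightarrow> econv \<Delta> n n' \<and> ety \<Delta> n T \<and> ety \<Delta> n' T \<and> neutral n \<and> neutral n'"
  "tm_eq \<Delta> t t' T \<Longrightarrow> ctx_rel \<Delta> \<Delta> \<Longrightarrow> ety \<Delta> t T \<Longrightarrow> ety \<Delta> t' T \<Longrightarrow> econv \<Delta> t t'"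
  "tm_eq_w \<Delta> t t' T \<Longrightarrow> ctx_rel \<Delta> \<Delta> \<Longrightarrow> ety \<Delta> t T \<Longrightarrow> ety \<Delta> t' T \<Longrightarrow> econv \<Delta> t t'"
proof (induction rule: alg_inducts)
  case (alg_ty T A T' A' \<Delta>)
  have "econv \<Delta> T A" "econv \<Delta> T' A'" "econv \<Delta> A A'"
    using alg_ty eval_has_ty by blast+
  then show ?case using conv_sym conv_trans by blast
next
  case (alg_ty_pi \<Delta> U U' st T T' s s')
  have U: "etype \<Delta> U" "etype \<Delta> U'" using alg_ty_pi.prems etype_pi by blast+
  have eU: "econv \<Delta> U U'" using alg_ty_pi.IH(1) alg_ty_pi.prems(1) U by blast
  have "ctx_rel ((st, U) # \<Delta>) ((st, U') # \<Delta>)" using ctx_rel_consI alg_ty_pi.prems(1) U eU by blast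
  then have "etype ((st, U) # \<Delta>) T'"
    using etype_pi[OF alg_ty_pi.prems(3)] etype_ctx_rel by blast
  moreover have "ctx_rel ((st, U) # \<Delta>) ((st, U) # \<Delta>)" using ctx_rel_consI alg_ty_pi.prems(1) U by simp
  ultimately have "econv ((st, U) # \<Delta>) T T'"
    using alg_ty_pi.IH(2) etype_pi[OF alg_ty_pi.prems(2)] by blast
  with eU show ?case by (simp add: conv_mk_pi)
next
  case (alg_ty_ne N N' \<Delta> T)
  then show ?case using etypableI by blast
next
  case (alg_ne_var i T \<Delta>)
  then show ?case using has_ty_in_ctx by simp
next
  case (alg_ne_app_rel \<Delta> n n' U s s' T u u')
  have n: "econv \<Delta> n n'" "ety \<Delta> n (Pi Rel U s s' T)" "ety \<Delta> n' (Pi Rel U s s' T)" "neutral n" "neutral n'"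
    using alg_ne_app_rel.IH(1) alg_ne_app_rel.prems etypable_head by blast+
  have "ety \<Delta> u U" "ety \<Delta> u' U"
    and a: "ety \<Delta> (App Rel n u) (inst u T)" and a': "ety \<Delta> (App Rel n' u') (inst u' T)"
    using ne_app_ety n alg_ne_app_rel.prems(2,3) by blast+
  then have eu: "econv \<Delta> u u'" using alg_ne_app_rel.IH(2) alg_ne_app_rel.prems(1) by blast
  \<comment> \<open>The algorithm reports the left instance, so the right-hand application must be
    converted to it.\<close>
  have "econv \<Delta> (inst u' T) (inst u T)"
    using eu erase_inst[OF has_ty_validity[OF n(2)]] by (simp add: conv_sub1 conv_sym)
  then have "ety \<Delta> (App Rel n' u') (inst u T)" using a a' has_ty_validity t_conv by blast
  then show ?case using a n(1) eu by (simp add: conv_app)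
next
  case (alg_ne_app_irr \<Delta> n n' U s s' T u u')
  have n: "econv \<Delta> n n'" "ety \<Delta> n (Pi Irr U s s' T)" "ety \<Delta> n' (Pi Irr U s s' T)" "neutral n" "neutral n'"
    using alg_ne_app_irr.IH alg_ne_app_irr.prems etypable_head by blast+
  have "ety \<Delta> (App Irr n u) (inst u T)" "ety \<Delta> (App Irr n' u') (inst u' T)"
    using ne_app_ety n alg_ne_app_irr.prems(2,3) by blast+
  then show ?case using n(1) erase_inst[OF has_ty_validity[OF n(2)]] by (simp add: conv_iapp)
next
  case (alg_ne_w \<Delta> n n' T A)
  then have n: "econv \<Delta> n n'" "ety \<Delta> n T" "ety \<Delta> n' T" by blast+
  have A: "etype \<Delta> A" "econv \<Delta> T A" using eval_has_ty[OF alg_ne_w.hyps(2)] has_ty_validity[OF n(2)] by blast+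
  then show ?case using n t_conv ne_eq_neutral[OF alg_ne_w.hyps(1)] by blast
next
  case (alg_tm T A \<Delta> t t')
  have A: "etype \<Delta> A" "econv \<Delta> T A"
    using eval_has_ty[OF alg_tm.hyps(1)] has_ty_validity[OF alg_tm.prems(2)] by blast+
  then show ?case using alg_tm t_conv by blast
next
  case (alg_tm_pi st U \<Delta> t t' T s s')
  have "ctx_rel ((st, U) # \<Delta>) ((st, U) # \<Delta>)"
    using ctx_rel_consI alg_tm_pi.prems(1) etype_pi[OF has_ty_validity[OF alg_tm_pi.prems(2)]] by simp
  then have "econv ((st, U) # \<Delta>) (App st (lift t) (Var 0)) (App st (lift t') (Var 0))"
    using alg_tm_pi.IH ety_app_var alg_tm_pi.prems(2,3) by blast
  then show ?case using conv_mk_ext[of st] by (simp add: er_lift)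
next
  case (alg_tm_sort \<Delta> T T' s)
  then show ?case by simp
next
  case (alg_tm_ne N t n t' n' \<Delta> T)
  have "econv \<Delta> t n" "econv \<Delta> t' n'" "etypable \<Delta> n" "etypable \<Delta> n'"
    using eval_has_ty alg_tm_ne.hyps alg_tm_ne.prems etypableI by blast+
  then show ?case using alg_tm_ne.IH alg_tm_ne.prems(1) conv_sym conv_trans by blast
qed simp

section \<open>Symmetry up to change of context and type\<close>

lemma ne_eq_etype:
  assumes "ne_eq \<Delta>' n n' T" "ctx_rel \<Delta> \<Delta>'" "etypable \<Delta> n" "etypable \<Delta> n'"
  shows "ety \<Delta> n T" "ety \<Delta> n' T" "etype \<Delta> T"
proof -
  have "ctx_rel \<Delta>' \<Delta>'" using assms(2) ctx_rel_sym ctx_rel_refl by blast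
  then have "ety \<Delta>' n T \<and> ety \<Delta>' n' T"
    using alg_sound(3)[OF assms(1)] assms(2-4) etypable_ctx_rel by blast
  then show "ety \<Delta> n T" "ety \<Delta> n' T"
    using ctx_rel_has_ty[OF assms(2)] ctx_rel_env[OF assms(2)] by simp_all
  then show "etype \<Delta> T" using has_ty_validity by blast
qed

text \<open>The sort annotations \<open>r\<close> and \<open>r'\<close> are unrelated to
  \<open>s\<close> and \<open>s'\<close>, since erasure forgets them. This does no harm:
  type-directed and structural comparison never inspect them, and type equality compares them
  directly.\<close>

lemma econv_pi_eval:
  assumes "etype \<Delta> T" "econv \<Delta> (Pi st U s s' V) T"
  obtains U' r r' V' where "T \<searrow> Pi st U' r r' V'" "etype \<Delta> U'" "econv \<Delta> U U'"
    "etype ((st, U) # \<Delta>) V \<Longrightarrow> etype ((st, U') # \<Delta>) V'" "econv ((st, U) # \<Delta>) V V'"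
proof -
  have "conv (erase \<Delta> T) (mk_pi st (erase \<Delta> U) (er (bind st (env \<Delta>)) V))"
    using conv_sym[OF assms(2)] by simp
  then obtain U' r r' V' where *: "T \<searrow> Pi st U' r r' V'" "econv \<Delta> U' U"
    "conv (er (bind st (env \<Delta>)) V') (er (bind st (env \<Delta>)) V)"
    "has_ty (erase_ctx \<Delta>) (mk_pi st (erase \<Delta> U') (er (bind st (env \<Delta>)) V')) TSort"
    using conv_mk_pi_eval[OF assms(1)] by metis
  then show thesis using that[of U' r r' V'] inv_mk_pi[OF *(4)] conv_sym by simp
qed

text \<open>The target context \<open>\<Delta>'\<close> and, for terms, the target type
  \<open>V\<close> are generalized because reversal replaces the left domain by the right one. For
  neutral expressions the inferred type itself changes and is known only up to convertibility. The
  clauses for weak head normal types therefore conclude the judgement for arbitrary types, leaving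
  the evaluation of the new type to the rule that needs it.\<close>

lemma alg_sym:
  "ty_eq \<Delta> T T' \<Longrightarrow> ctx_rel \<Delta> \<Delta>' \<Longrightarrow> etype \<Delta> T \<Longrightarrow> etype \<Delta> T' \<Longrightarrow> ty_eq \<Delta>' T' T"
  "ty_eq_w \<Delta> T T' \<Longrightarrow> ctx_rel \<Delta> \<Delta>' \<Longrightarrow> etype \<Delta> T \<Longrightarrow> etype \<Delta> T' \<Longrightarrow> ty_eq_w \<Delta>' T' T"
  "ne_eq \<Delta> n n' T \<Longrightarrow> ctx_rel \<Delta> \<Delta>' \<Longrightarrow> etypable \<Delta> n \<Longrightarrow> etypable \<Delta> n'
    \<Longrightarrow> \<exists>T'. ne_eq \<Delta>' n' n T' \<and> econv \<Delta> T T'"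
  "ne_eq_w \<Delta> n n' T \<Longrightarrow> ctx_rel \<Delta> \<Delta>' \<Longrightarrow> etypable \<Delta> n \<Longrightarrow> etypable \<Delta> n'
    \<Longrightarrow> \<exists>T'. ne_eq \<Delta>' n' n T' \<and> econv \<Delta> T T'"
  "tm_eq \<Delta> t t' T \<Longrightarrow> ctx_rel \<Delta> \<Delta>' \<Longrightarrow> ety \<Delta> t T \<Longrightarrow> ety \<Delta> t' T \<Longrightarrow> etype \<Delta> V \<Longrightarrow> econv \<Delta> T V
    \<Longrightarrow> tm_eq \<Delta>' t' t V"
  "tm_eq_w \<Delta> t t' T \<Longrightarrow> ctx_rel \<Delta> \<Delta>' \<Longrightarrow> ety \<Delta> t T \<Longrightarrow> ety \<Delta> t' T \<Longrightarrow> etype \<Delta> V \<Longrightarrow> econv \<Delta> T V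
    \<Longrightarrow> tm_eq \<Delta>' t' t V"
proof (induction arbitrary: \<Delta>' and \<Delta>' and \<Delta>' and \<Delta>' and \<Delta>' V and \<Delta>' V rule: alg_inducts)
  case (alg_ty T A T' A' \<Delta>)
  have "etype \<Delta> A" "etype \<Delta> A'" using alg_ty eval_has_ty by blast+
  then show ?case using alg_ty ty_eq_ty_eq_w_ne_eq_ne_eq_w_tm_eq_tm_eq_w.alg_ty by blast
next
  case (alg_ty_sort \<Delta> s)
  show ?case by (rule ty_eq_ty_eq_w_ne_eq_ne_eq_w_tm_eq_tm_eq_w.alg_ty_sort)
next
  case (alg_ty_pi \<Delta> U U' st T T' s s')
  have U: "etype \<Delta> U" "etype \<Delta> U'" using alg_ty_pi.prems etype_pi by blast+
  have c: "ctx_rel \<Delta> \<Delta>" using alg_ty_pi.prems(1) ctx_rel_refl by blast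
  have eU: "econv \<Delta> U U'" using alg_sound(1) alg_ty_pi.hyps(1) c U by blast
  have "ctx_rel ((st, U) # \<Delta>) ((st, U') # \<Delta>)" using ctx_rel_consI c U eU by blast
  then have "etype ((st, U) # \<Delta>) T'"
    using etype_pi[OF alg_ty_pi.prems(3)] etype_ctx_rel by blast
  moreover have "ctx_rel ((st, U) # \<Delta>) ((st, U') # \<Delta>')" using ctx_rel_consI alg_ty_pi.prems(1) U eU by blast
  ultimately have "ty_eq ((st, U') # \<Delta>') T' T"
    using alg_ty_pi.IH(2) etype_pi[OF alg_ty_pi.prems(2)] by blast
  then show ?case using alg_ty_pi.IH(1)[OF alg_ty_pi.prems(1) U]
    by (rule ty_eq_ty_eq_w_ne_eq_ne_eq_w_tm_eq_tm_eq_w.alg_ty_pi[rotated])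
next
  case (alg_ty_ne N N' \<Delta> T)
  then obtain T' where "ne_eq \<Delta>' N' N T'" using etypableI by blast
  then show ?case using alg_ty_ne.hyps ty_eq_ty_eq_w_ne_eq_ne_eq_w_tm_eq_tm_eq_w.alg_ty_ne by blast
next
  case (alg_ne_var i T \<Delta>)
  then show ?case using ctx_rel_in_ctx ty_eq_ty_eq_w_ne_eq_ne_eq_w_tm_eq_tm_eq_w.alg_ne_var by blast
next
  case (alg_ne_app_rel \<Delta> n n' U s s' T u u')
  have c: "ctx_rel \<Delta> \<Delta>" using alg_ne_app_rel.prems(1) ctx_rel_refl by blast
  have ty: "etypable \<Delta> n" "etypable \<Delta> n'" using alg_ne_app_rel.prems etypable_head by blast+
  have n: "ety \<Delta> n (Pi Rel U s s' T)" "ety \<Delta> n' (Pi Rel U s s' T)" "neutral n" "neutral n'"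
    using alg_sound(4)[OF alg_ne_app_rel.hyps(1) c ty] by blast+
  have u: "ety \<Delta> u U" "ety \<Delta> u' U" using ne_app_ety(1) n alg_ne_app_rel.prems(2,3) by blast+
  have pi: "etype \<Delta> (Pi Rel U s s' T)" using has_ty_validity[OF n(1)] .
  obtain X where X: "ne_eq \<Delta>' n' n X" "econv \<Delta> (Pi Rel U s s' T) X"
    using alg_ne_app_rel.IH(1)[OF alg_ne_app_rel.prems(1) ty] by blast
  have "etype \<Delta> X" using ne_eq_etype X(1) alg_ne_app_rel.prems(1) ty by blast
  then obtain U' r r' V' where V: "X \<searrow> Pi Rel U' r r' V'" "etype \<Delta> U'" "econv \<Delta> U U'"
    "econv ((Rel, U) # \<Delta>) T V'" by (rule econv_pi_eval[OF _ X(2)])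
  \<comment> \<open>The arguments are reversed at \<open>U'\<close>, the domain obtained by
    evaluating the type inferred for the reversed heads.\<close>
  have "tm_eq \<Delta>' u' u U'" using alg_ne_app_rel.IH(2)[OF alg_ne_app_rel.prems(1) u V(2,3)] .
  moreover have "ne_eq_w \<Delta>' n' n (Pi Rel U' r r' V')" using X(1) V(1) by (rule alg_ne_w)
  ultimately have "ne_eq \<Delta>' (App Rel n' u') (App Rel n u) (inst u' V')"
    using ty_eq_ty_eq_w_ne_eq_ne_eq_w_tm_eq_tm_eq_w.alg_ne_app_rel by blast
  moreover have "econv \<Delta> (inst u T) (inst u' V')"
  proof -
    have X': "etype \<Delta> (Pi Rel U' r r' V')" using eval_has_ty(1)[OF V(1)] \<open>etype \<Delta> X\<close> .
    have "econv \<Delta> u u'" using alg_sound(5)[OF alg_ne_app_rel.hyps(2) c u] .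
    then show ?thesis unfolding erase_inst[OF pi] erase_inst[OF X']
      using V(4) by (simp add: conv_sub1)
  qed
  ultimately show ?case by blast
next
  case (alg_ne_app_irr \<Delta> n n' U s s' T u u')
  have c: "ctx_rel \<Delta> \<Delta>" using alg_ne_app_irr.prems(1) ctx_rel_refl by blast
  have ty: "etypable \<Delta> n" "etypable \<Delta> n'" using alg_ne_app_irr.prems etypable_head by blast+
  have n: "ety \<Delta> n (Pi Irr U s s' T)"
    using alg_sound(4)[OF alg_ne_app_irr.hyps(1) c ty] by blast
  have pi: "etype \<Delta> (Pi Irr U s s' T)" using has_ty_validity[OF n(1)] .
  obtain X where X: "ne_eq \<Delta>' n' n X" "econv \<Delta> (Pi Irr U s s' T) X"
    using alg_ne_app_irr.IH(1)[OF alg_ne_app_irr.prems(1) ty] by blast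
  have "etype \<Delta> X" using ne_eq_etype X(1) alg_ne_app_irr.prems(1) ty by blast
  then obtain U' r r' V' where V: "X \<searrow> Pi Irr U' r r' V'" "econv ((Irr, U) # \<Delta>) T V'"
    by (rule econv_pi_eval[OF _ X(2)])
  have "ne_eq_w \<Delta>' n' n (Pi Irr U' r r' V')" using X(1) V(1) by (rule alg_ne_w)
  then have "ne_eq \<Delta>' (App Irr n' u') (App Irr n u) (inst u' V')"
    using ty_eq_ty_eq_w_ne_eq_ne_eq_w_tm_eq_tm_eq_w.alg_ne_app_irr by blast
  moreover have "econv \<Delta> (inst u T) (inst u' V')"
  proof -
    have X': "etype \<Delta> (Pi Irr U' r r' V')" using eval_has_ty(1)[OF V(1)] \<open>etype \<Delta> X\<close> .
    show ?thesis unfolding erase_inst[OF pi] erase_inst[OF X'] using V(2) by simp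
  qed
  ultimately show ?case by blast
next
  case (alg_ne_w \<Delta> n n' T A)
  then obtain T' where T': "ne_eq \<Delta>' n' n T'" "econv \<Delta> T T'" by blast
  have "etype \<Delta> T" using ne_eq_etype(3) alg_ne_w.hyps(1) alg_ne_w.prems ctx_rel_refl by blast
  then have "econv \<Delta> T A" using eval_has_ty(2) alg_ne_w.hyps(2) by blast
  then show ?case using T' conv_sym conv_trans by blast
next
  case (alg_tm T A \<Delta> t t')
  have A: "etype \<Delta> A" "econv \<Delta> T A"
    using eval_has_ty[OF alg_tm.hyps(1)] has_ty_validity[OF alg_tm.prems(2)] by blast+
  have "ety \<Delta> t A" "ety \<Delta> t' A" using A alg_tm.prems t_conv by blast+
  moreover have "econv \<Delta> A V" using A(2) alg_tm.prems(5) conv_sym conv_trans by blast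
  ultimately show ?case using alg_tm.IH alg_tm.prems by blast
next
  case (alg_tm_pi st U \<Delta> t t' T s s')
  have pi: "etype \<Delta> U" "etype ((st, U) # \<Delta>) T"
    using etype_pi[OF has_ty_validity[OF alg_tm_pi.prems(2)]] by blast+
  obtain U' r r' V' where V: "V \<searrow> Pi st U' r r' V'" "etype \<Delta> U'" "econv \<Delta> U U'"
    "etype ((st, U') # \<Delta>) V'" "econv ((st, U) # \<Delta>) T V'"
    using econv_pi_eval[OF alg_tm_pi.prems(4,5)] pi(2) by metis
  have "ctx_rel ((st, U) # \<Delta>) ((st, U') # \<Delta>)"
    using ctx_rel_consI ctx_rel_refl[OF alg_tm_pi.prems(1)] pi(1) V(2,3) by blast
  then have "etype ((st, U) # \<Delta>) V'" using V(4) etype_ctx_rel by blast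
  moreover have "ctx_rel ((st, U) # \<Delta>) ((st, U') # \<Delta>')"
    using ctx_rel_consI alg_tm_pi.prems(1) pi(1) V(2,3) by blast
  ultimately have "tm_eq ((st, U') # \<Delta>') (App st (lift t') (Var 0)) (App st (lift t) (Var 0)) V'"
    using alg_tm_pi.IH ety_app_var alg_tm_pi.prems(2,3) V(5) by blast
  then show ?case using V(1) ty_eq_ty_eq_w_ne_eq_ne_eq_w_tm_eq_tm_eq_w.alg_tm_pi
      ty_eq_ty_eq_w_ne_eq_ne_eq_w_tm_eq_tm_eq_w.alg_tm by blast
next
  case (alg_tm_sort \<Delta> T T' s)
  then obtain s1 where "V \<searrow> Sort s1" using conv_sort_eval conv_sym by (metis er.simps(1))
  moreover have "ty_eq \<Delta>' T' T" using alg_tm_sort by simp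
  ultimately show ?case using ty_eq_ty_eq_w_ne_eq_ne_eq_w_tm_eq_tm_eq_w.alg_tm_sort
      ty_eq_ty_eq_w_ne_eq_ne_eq_w_tm_eq_tm_eq_w.alg_tm by blast
next
  case (alg_tm_ne N t n t' n' \<Delta> T)
  have "etypable \<Delta> n" "etypable \<Delta> n'"
    using eval_etypable alg_tm_ne.hyps alg_tm_ne.prems etypableI by blast+
  then obtain T' where "ne_eq \<Delta>' n' n T'" using alg_tm_ne.IH alg_tm_ne.prems(1) by blast
  moreover obtain N' where "V \<searrow> N'" "neutral N'"
    using conv_neutral_eval[OF alg_tm_ne.prems(4) conv_sym[OF alg_tm_ne.prems(5)] alg_tm_ne.hyps(1)
        has_ty_validity[OF alg_tm_ne.prems(2)]] .
  ultimately show ?case using alg_tm_ne.hyps ty_eq_ty_eq_w_ne_eq_ne_eq_w_tm_eq_tm_eq_w.alg_tm_ne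
      ty_eq_ty_eq_w_ne_eq_ne_eq_w_tm_eq_tm_eq_w.alg_tm by blast
qed

section \<open>Transitivity up to change of context and type\<close>

inductive_cases ty_eqE: "ty_eq \<Delta> T T'"
inductive_cases ty_eq_w_sortE: "ty_eq_w \<Delta> (Sort s) T"
inductive_cases ty_eq_w_piE: "ty_eq_w \<Delta> (Pi st U s s' V) T"
inductive_cases ne_eq_varE: "ne_eq \<Delta> (Var i) n T"
inductive_cases ne_eq_relE: "ne_eq \<Delta> (App Rel m u) n T"
inductive_cases ne_eq_irrE: "ne_eq \<Delta> (App Irr m u) n T"
inductive_cases ne_eq_wE: "ne_eq_w \<Delta> m n T"
inductive_cases tm_eqE: "tm_eq \<Delta> t t' T"
inductive_cases tm_eq_w_piE: "tm_eq_w \<Delta> t t' (Pi st U s s' T)"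
inductive_cases tm_eq_w_sortE: "tm_eq_w \<Delta> t t' (Sort s)"

lemma ty_eq_w_neutralD: "ty_eq_w \<Delta> N T \<Longrightarrow> neutral N \<Longrightarrow> neutral T \<and> (\<exists>A. ne_eq \<Delta> N T A)"
  by (auto elim: ty_eq_w.cases simp: neutral_not_lam)

lemma tm_eq_w_neutralD: "tm_eq_w \<Delta> t t' N \<Longrightarrow> neutral N \<Longrightarrow> \<exists>n n' A. t \<searrow> n \<and> t' \<searrow> n' \<and> ne_eq \<Delta> n n' A"
  by (erule tm_eq_w.cases) (auto simp: neutral_not_lam)

text \<open>Induction on the first derivation, with the second one inverted. The result keeps the
  context and type of the first; the second may live in a related context at a convertible type. For
  neutral expressions \<open>econv \<Delta> T V\<close> is proved along, since it makes the domains
  inferred on the two sides convertible.\<close>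

lemma alg_trans:
  "ty_eq \<Delta> T T' \<Longrightarrow> ctx_rel \<Delta> \<Delta>' \<Longrightarrow> ty_eq \<Delta>' T' T'' \<Longrightarrow> etype \<Delta> T \<Longrightarrow> etype \<Delta> T' \<Longrightarrow> etype \<Delta> T''
    \<Longrightarrow> ty_eq \<Delta> T T''"
  "ty_eq_w \<Delta> T T' \<Longrightarrow> ctx_rel \<Delta> \<Delta>' \<Longrightarrow> ty_eq_w \<Delta>' T' T'' \<Longrightarrow> etype \<Delta> T \<Longrightarrow> etype \<Delta> T' \<Longrightarrow> etype \<Delta> T''
    \<Longrightarrow> ty_eq_w \<Delta> T T''"
  "ne_eq \<Delta> n n' T \<Longrightarrow> ctx_rel \<Delta> \<Delta>' \<Longrightarrow> ne_eq \<Delta>' n' n'' V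
    \<Longrightarrow> etypable \<Delta> n \<Longrightarrow> etypable \<Delta> n' \<Longrightarrow> etypable \<Delta> n'' \<Longrightarrow> ne_eq \<Delta> n n'' T \<and> econv \<Delta> T V"
  "ne_eq_w \<Delta> n n' T \<Longrightarrow> ctx_rel \<Delta> \<Delta>' \<Longrightarrow> ne_eq \<Delta>' n' n'' V
    \<Longrightarrow> etypable \<Delta> n \<Longrightarrow> etypable \<Delta> n' \<Longrightarrow> etypable \<Delta> n'' \<Longrightarrow> ne_eq_w \<Delta> n n'' T \<and> econv \<Delta> T V"
  "tm_eq \<Delta> t t' T \<Longrightarrow> ctx_rel \<Delta> \<Delta>' \<Longrightarrow> tm_eq \<Delta>' t' t'' V \<Longrightarrow> etype \<Delta> V \<Longrightarrow> econv \<Delta> T V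
    \<Longrightarrow> ety \<Delta> t T \<Longrightarrow> ety \<Delta> t' T \<Longrightarrow> ety \<Delta> t'' T \<Longrightarrow> tm_eq \<Delta> t t'' T"
  "tm_eq_w \<Delta> t t' T \<Longrightarrow> ctx_rel \<Delta> \<Delta>' \<Longrightarrow> tm_eq \<Delta>' t' t'' V \<Longrightarrow> etype \<Delta> V \<Longrightarrow> econv \<Delta> T V
    \<Longrightarrow> ety \<Delta> t T \<Longrightarrow> ety \<Delta> t' T \<Longrightarrow> ety \<Delta> t'' T \<Longrightarrow> tm_eq_w \<Delta> t t'' T"
proof (induction arbitrary: \<Delta>' T'' and \<Delta>' T'' and \<Delta>' n'' V and \<Delta>' n'' V and \<Delta>' t'' V and \<Delta>' t'' V
    rule: alg_inducts)
  case (alg_ty T A T' A' \<Delta>)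
  from alg_ty.prems(2) obtain B A'' where B: "T' \<searrow> B" "T'' \<searrow> A''" "ty_eq_w \<Delta>' B A''" by (rule ty_eqE)
  \<comment> \<open>Both derivations evaluate the middle type, and determinism lets them meet in the
    same weak head normal form.\<close>
  have "B = A'" using B(1) alg_ty.hyps(2) eval_deterministic(1) by blast
  moreover have "etype \<Delta> A" "etype \<Delta> A'" "etype \<Delta> A''" using alg_ty B eval_has_ty by blast+
  ultimately have "ty_eq_w \<Delta> A A''" using alg_ty.IH alg_ty.prems(1) B(3) by blast
  then show ?case using alg_ty.hyps(1) B(2) ty_eq_ty_eq_w_ne_eq_ne_eq_w_tm_eq_tm_eq_w.alg_ty by blast
next
  case (alg_ty_sort \<Delta> s)
  from alg_ty_sort.prems(2) have "T'' = Sort s"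
    by (rule ty_eq_w_sortE) (simp_all add: neutral_not_lam)
  then show ?case by (simp add: ty_eq_ty_eq_w_ne_eq_ne_eq_w_tm_eq_tm_eq_w.alg_ty_sort)
next
  case (alg_ty_pi \<Delta> U U' st T T' s s')
  from alg_ty_pi.prems(2) obtain U'' V where
    V: "T'' = Pi st U'' s s' V" "ty_eq \<Delta>' U' U''" "ty_eq ((st, U') # \<Delta>') T' V"
    by (rule ty_eq_w_piE) (simp_all add: neutral_not_lam)
  have U: "etype \<Delta> U" "etype \<Delta> U'" "etype \<Delta> U''" using alg_ty_pi.prems(3-5) V(1) etype_pi by blast+
  have c: "ctx_rel \<Delta> \<Delta>" using alg_ty_pi.prems(1) ctx_rel_refl by blast
  have eU: "econv \<Delta> U U'" using alg_sound(1) alg_ty_pi.hyps(1) c U by blast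
  \<comment> \<open>The domains are composed before the codomains: soundness of the composite gives
    \<open>econv \<Delta> U U''\<close>, which moves \<open>V\<close> from over \<open>U''\<close>
    to over \<open>U\<close>.\<close>
  have U2: "ty_eq \<Delta> U U''" using alg_ty_pi.IH(1) alg_ty_pi.prems(1) V(2) U by blast
  have eU2: "econv \<Delta> U U''" using alg_sound(1)[OF U2 c] U by blast
  have "ctx_rel ((st, U) # \<Delta>) ((st, U') # \<Delta>)" "ctx_rel ((st, U) # \<Delta>) ((st, U'') # \<Delta>)"
    using ctx_rel_consI c U eU eU2 by blast+
  then have "etype ((st, U) # \<Delta>) T'" "etype ((st, U) # \<Delta>) V"
    using etype_pi[OF alg_ty_pi.prems(4)] etype_pi[OF alg_ty_pi.prems(5)[unfolded V(1)]]
      etype_ctx_rel by blast+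
  moreover have "ctx_rel ((st, U) # \<Delta>) ((st, U') # \<Delta>')" using ctx_rel_consI alg_ty_pi.prems(1) U eU by blast
  ultimately have "ty_eq ((st, U) # \<Delta>) T V"
    using alg_ty_pi.IH(2) V(3) etype_pi[OF alg_ty_pi.prems(3)] by blast
  then show ?case unfolding V(1) by (rule ty_eq_ty_eq_w_ne_eq_ne_eq_w_tm_eq_tm_eq_w.alg_ty_pi[OF U2])
next
  case (alg_ty_ne N N' \<Delta> T)
  then obtain A where A: "neutral T''" "ne_eq \<Delta>' N' T'' A" using ty_eq_w_neutralD by blast
  then have "ne_eq \<Delta> N T'' T" using alg_ty_ne etypableI by blast
  then show ?case using alg_ty_ne.hyps(1) A(1) ty_eq_ty_eq_w_ne_eq_ne_eq_w_tm_eq_tm_eq_w.alg_ty_ne by blast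
next
  case (alg_ne_var i T \<Delta>)
  from alg_ne_var.prems(2) have V: "n'' = Var i" "in_ctx i V \<Delta>'" by (auto elim: ne_eq_varE)
  obtain T' where "in_ctx i T' \<Delta>'" "econv \<Delta> T T'"
    using ctx_rel_in_ctx[OF alg_ne_var.prems(1) alg_ne_var.hyps] by blast
  then have "econv \<Delta> T V" using V(2) in_ctx_unique by blast
  then show ?case using V(1) alg_ne_var.hyps by (simp add: ty_eq_ty_eq_w_ne_eq_ne_eq_w_tm_eq_tm_eq_w.alg_ne_var)
next
  case (alg_ne_app_rel \<Delta> n n' U s s' T u u')
  from alg_ne_app_rel.prems(2) obtain m w U' r r' V' where
    m: "n'' = App Rel m w" "V = inst u' V'" "ne_eq_w \<Delta>' n' m (Pi Rel U' r r' V')" "tm_eq \<Delta>' u' w U'"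
    by (rule ne_eq_relE)
  from m(3) obtain X where X: "ne_eq \<Delta>' n' m X" "X \<searrow> Pi Rel U' r r' V'" by (rule ne_eq_wE)
  have c: "ctx_rel \<Delta> \<Delta>" using alg_ne_app_rel.prems(1) ctx_rel_refl by blast
  have ty: "etypable \<Delta> n" "etypable \<Delta> n'" "etypable \<Delta> m"
    using alg_ne_app_rel.prems(3-5) m(1) etypable_head by blast+
  have n: "ety \<Delta> n (Pi Rel U s s' T)" "ety \<Delta> n' (Pi Rel U s s' T)" "neutral n" "neutral n'"
    using alg_sound(4)[OF alg_ne_app_rel.hyps(1) c ty(1,2)] by blast+
  have IH: "ne_eq_w \<Delta> n m (Pi Rel U s s' T)" "econv \<Delta> (Pi Rel U s s' T) X"
    using alg_ne_app_rel.IH(1)[OF alg_ne_app_rel.prems(1) X(1) ty] by blast+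
  have m': "ety \<Delta> m (Pi Rel U s s' T)" "neutral m" using alg_sound(4)[OF IH(1) c ty(1,3)] by blast+
  have u: "ety \<Delta> u U" "ety \<Delta> u' U" "ety \<Delta> w U"
    using ne_app_ety(1) n m' alg_ne_app_rel.prems(3-5) m(1) by blast+
  have "etype \<Delta> X" using ne_eq_etype(3) X(1) alg_ne_app_rel.prems(1) ty by blast
  then have X': "etype \<Delta> (Pi Rel U' r r' V')" "econv \<Delta> X (Pi Rel U' r r' V')"
    using eval_has_ty X(2) by blast+
  \<comment> \<open>Both codomains are erased under \<open>U\<close>, although \<open>V'\<close>
    lives over \<open>U'\<close>: the environment sees the annotation only.\<close>
  have "conv (mk_pi Rel (erase \<Delta> U) (erase ((Rel, U) # \<Delta>) T))
      (mk_pi Rel (erase \<Delta> U') (erase ((Rel, U) # \<Delta>) V'))"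
    using conv_trans[OF IH(2) X'(2)] by simp
  then have e: "econv \<Delta> U U'" "econv ((Rel, U) # \<Delta>) T V'" by (blast dest: conv_mk_pi_inject)+
  have "tm_eq \<Delta> u w U"
    using alg_ne_app_rel.IH(2)[OF alg_ne_app_rel.prems(1) m(4) _ e(1) u] etype_pi[OF X'(1)] by blast
  then have "ne_eq \<Delta> (App Rel n u) n'' (inst u T)"
    unfolding m(1) by (rule ty_eq_ty_eq_w_ne_eq_ne_eq_w_tm_eq_tm_eq_w.alg_ne_app_rel[OF IH(1)])
  moreover have "econv \<Delta> u u'" using alg_sound(5)[OF alg_ne_app_rel.hyps(2) c u(1,2)] .
  then have "econv \<Delta> (inst u T) V"
    unfolding m(2) erase_inst[OF has_ty_validity[OF n(1)]] erase_inst[OF X'(1)]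
    using e(2) by (simp add: conv_sub1)
  ultimately show ?case by blast
next
  case (alg_ne_app_irr \<Delta> n n' U s s' T u u')
  from alg_ne_app_irr.prems(2) obtain m w U' r r' V' where
    m: "n'' = App Irr m w" "V = inst u' V'" "ne_eq_w \<Delta>' n' m (Pi Irr U' r r' V')"
    by (rule ne_eq_irrE)
  from m(3) obtain X where X: "ne_eq \<Delta>' n' m X" "X \<searrow> Pi Irr U' r r' V'" by (rule ne_eq_wE)
  have c: "ctx_rel \<Delta> \<Delta>" using alg_ne_app_irr.prems(1) ctx_rel_refl by blast
  have ty: "etypable \<Delta> n" "etypable \<Delta> n'" "etypable \<Delta> m"
    using alg_ne_app_irr.prems(3-5) m(1) etypable_head by blast+
  have n: "ety \<Delta> n (Pi Irr U s s' T)"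
    using alg_sound(4)[OF alg_ne_app_irr.hyps(1) c ty(1,2)] by blast
  have IH: "ne_eq_w \<Delta> n m (Pi Irr U s s' T)" "econv \<Delta> (Pi Irr U s s' T) X"
    using alg_ne_app_irr.IH[OF alg_ne_app_irr.prems(1) X(1) ty] by blast+
  have "etype \<Delta> X" using ne_eq_etype(3) X(1) alg_ne_app_irr.prems(1) ty by blast
  then have X': "etype \<Delta> (Pi Irr U' r r' V')" "econv \<Delta> X (Pi Irr U' r r' V')"
    using eval_has_ty X(2) by blast+
  have "conv (mk_pi Irr (erase \<Delta> U) (erase ((Irr, U) # \<Delta>) T))
      (mk_pi Irr (erase \<Delta> U') (erase ((Irr, U) # \<Delta>) V'))"
    using conv_trans[OF IH(2) X'(2)] by simp
  then have e: "econv ((Irr, U) # \<Delta>) T V'" by (blast dest: conv_mk_pi_inject)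
  have "ne_eq \<Delta> (App Irr n u) n'' (inst u T)"
    unfolding m(1) by (rule ty_eq_ty_eq_w_ne_eq_ne_eq_w_tm_eq_tm_eq_w.alg_ne_app_irr[OF IH(1)])
  moreover have "econv \<Delta> (inst u T) V"
    unfolding m(2) erase_inst[OF has_ty_validity[OF n(1)]] erase_inst[OF X'(1)]
    using e by simp
  ultimately show ?case by blast
next
  case (alg_ne_w \<Delta> n n' T A)
  then have IH: "ne_eq \<Delta> n n'' T" "econv \<Delta> T V" by blast+
  have "etype \<Delta> T" using ne_eq_etype(3) IH(1) alg_ne_w.prems ctx_rel_refl by blast
  then have "econv \<Delta> T A" using eval_has_ty(2) alg_ne_w.hyps(2) by blast
  then show ?case using IH alg_ne_w.hyps(2) ty_eq_ty_eq_w_ne_eq_ne_eq_w_tm_eq_tm_eq_w.alg_ne_w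
      conv_sym conv_trans by blast
next
  case (alg_tm T A \<Delta> t t')
  have A: "etype \<Delta> A" "econv \<Delta> T A"
    using eval_has_ty[OF alg_tm.hyps(1)] has_ty_validity[OF alg_tm.prems(5)] by blast+
  have "ety \<Delta> t A" "ety \<Delta> t' A" "ety \<Delta> t'' A" using A alg_tm.prems t_conv by blast+
  moreover have "econv \<Delta> A V" using A(2) alg_tm.prems(4) conv_sym conv_trans by blast
  ultimately have "tm_eq_w \<Delta> t t'' A" using alg_tm.IH alg_tm.prems by blast
  then show ?case using alg_tm.hyps(1) ty_eq_ty_eq_w_ne_eq_ne_eq_w_tm_eq_tm_eq_w.alg_tm by blast
next
  case (alg_tm_pi st U \<Delta> t t' T s s')
  have pi: "etype \<Delta> U" "etype ((st, U) # \<Delta>) T"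
    using etype_pi[OF has_ty_validity[OF alg_tm_pi.prems(5)]] by blast+
  \<comment> \<open>The second derivation is directed by \<open>V\<close>, which also evaluates to a
    function type; this forces its last rule and yields a comparison of the applied terms.\<close>
  obtain U' r r' V' where V: "V \<searrow> Pi st U' r r' V'" "etype \<Delta> U'" "econv \<Delta> U U'"
    "etype ((st, U') # \<Delta>) V'" "econv ((st, U) # \<Delta>) T V'"
    using econv_pi_eval[OF alg_tm_pi.prems(3,4)] pi(2) by metis
  from alg_tm_pi.prems(2) obtain A where "V \<searrow> A" "tm_eq_w \<Delta>' t' t'' A" by (rule tm_eqE)
  then have "tm_eq_w \<Delta>' t' t'' (Pi st U' r r' V')" using V(1) eval_deterministic(1) by blast
  then have *: "tm_eq ((st, U') # \<Delta>') (App st (lift t') (Var 0)) (App st (lift t'') (Var 0)) V'"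
    by (rule tm_eq_w_piE) (simp_all add: neutral_not_lam)
  have "ctx_rel ((st, U) # \<Delta>) ((st, U') # \<Delta>)"
    using ctx_rel_consI ctx_rel_refl[OF alg_tm_pi.prems(1)] pi(1) V(2,3) by blast
  then have V': "etype ((st, U) # \<Delta>) V'" using V(4) etype_ctx_rel by blast
  have "ctx_rel ((st, U) # \<Delta>) ((st, U') # \<Delta>')"
    using ctx_rel_consI alg_tm_pi.prems(1) pi(1) V(2,3) by blast
  then have "tm_eq ((st, U) # \<Delta>) (App st (lift t) (Var 0)) (App st (lift t'') (Var 0)) T"
    using alg_tm_pi.IH * V' V(5) ety_app_var alg_tm_pi.prems(5-7) by blast
  then show ?case by (rule ty_eq_ty_eq_w_ne_eq_ne_eq_w_tm_eq_tm_eq_w.alg_tm_pi)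
next
  case (alg_tm_sort \<Delta> T T' s)
  then obtain s1 where s1: "V \<searrow> Sort s1" using conv_sort_eval conv_sym by (metis er.simps(1))
  from alg_tm_sort.prems(2) obtain A where "V \<searrow> A" "tm_eq_w \<Delta>' T' t'' A" by (rule tm_eqE)
  then have "tm_eq_w \<Delta>' T' t'' (Sort s1)" using s1 eval_deterministic(1) by blast
  then have "ty_eq \<Delta>' T' t''"
    by (rule tm_eq_w_sortE) (simp_all add: neutral_not_lam)
  then have "ty_eq \<Delta> T t''" using alg_tm_sort.IH alg_tm_sort.prems by simp
  then show ?case by (rule ty_eq_ty_eq_w_ne_eq_ne_eq_w_tm_eq_tm_eq_w.alg_tm_sort)
next
  case (alg_tm_ne N t n t' n' \<Delta> T)
  obtain N' where N': "V \<searrow> N'" "neutral N'"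
    using conv_neutral_eval[OF alg_tm_ne.prems(3) conv_sym[OF alg_tm_ne.prems(4)] alg_tm_ne.hyps(1)
        has_ty_validity[OF alg_tm_ne.prems(5)]] .
  from alg_tm_ne.prems(2) obtain A where "V \<searrow> A" "tm_eq_w \<Delta>' t' t'' A" by (rule tm_eqE)
  then have "tm_eq_w \<Delta>' t' t'' N'" using N'(1) eval_deterministic(1) by blast
  then obtain m n'' A where m: "t' \<searrow> m" "t'' \<searrow> n''" "ne_eq \<Delta>' m n'' A"
    using tm_eq_w_neutralD N'(2) by blast
  have "m = n'" using m(1) alg_tm_ne.hyps(3) eval_deterministic(1) by blast
  moreover have "etypable \<Delta> n" "etypable \<Delta> n'" "etypable \<Delta> n''"
    using eval_etypable alg_tm_ne.hyps m(2) alg_tm_ne.prems etypableI by blast+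
  ultimately have "ne_eq \<Delta> n n'' T" using alg_tm_ne.IH alg_tm_ne.prems(1) m(3) by blast
  then show ?case using alg_tm_ne.hyps(1,2) m(2) ty_eq_ty_eq_w_ne_eq_ne_eq_w_tm_eq_tm_eq_w.alg_tm_ne by blast
qed

text \<open>Soundness of erasure turns the declarative assumptions into the erased ones; the
  transport lemmas are then used on the diagonal, with \<open>\<Delta>' = \<Delta>\<close> and, for
  terms, \<open>V = T\<close>.\<close>

theorem theorem5p15:
  fixes \<Delta> :: ctx
  assumes "\<turnstile> \<Delta>"
  shows "(symp_on {T. is_type \<Delta> T} (ty_eq \<Delta>) \<and> transp_on {T. is_type \<Delta> T} (ty_eq \<Delta>))
    \<and> (\<forall>T. is_type \<Delta> T \<longrightarrow>
         symp_on {t. \<Delta> \<turnstile> t \<Colon> T} (\<lambda>t t'. tm_eq \<Delta> t t' T)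
       \<and> transp_on {t. \<Delta> \<turnstile> t \<Colon> T} (\<lambda>t t'. tm_eq \<Delta> t t' T))
    \<and> (symp_on {n. \<exists>T. \<Delta> \<turnstile> n \<Colon> T} (\<lambda>n n'. \<exists>U. ne_eq \<Delta> n n' U)
       \<and> transp_on {n. \<exists>T. \<Delta> \<turnstile> n \<Colon> T} (\<lambda>n n'. \<exists>U. ne_eq \<Delta> n n' U))"
proof -
  have c: "ctx_rel \<Delta> \<Delta>" using erase_sound(1)[OF assms] .
  have type: "etype \<Delta> T" if "is_type \<Delta> T" for T
    using that erase_sound(2) unfolding is_type_def by fastforce
  have ety: "ety \<Delta> t T" if "\<Delta> \<turnstile> t \<Colon> T" for t T
    using that erase_sound(2) by blast
  have typable: "etypable \<Delta> n" if "n \<in> {n. \<exists>T. \<Delta> \<turnstile> n \<Colon> T}" for n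
  proof -
    from that obtain T where "\<Delta> \<turnstile> n \<Colon> T" by blast
    from etypableI[OF ety[OF this]] show ?thesis .
  qed
  have "symp_on {T. is_type \<Delta> T} (ty_eq \<Delta>)"
    by (rule symp_onI) (simp add: alg_sym(1)[OF _ c] type)
  moreover have "transp_on {T. is_type \<Delta> T} (ty_eq \<Delta>)"
  proof (rule transp_onI)
    fix T1 T2 T3 assume *: "T1 \<in> {T. is_type \<Delta> T}" "T2 \<in> {T. is_type \<Delta> T}" "T3 \<in> {T. is_type \<Delta> T}"
      "ty_eq \<Delta> T1 T2" "ty_eq \<Delta> T2 T3"
    then show "ty_eq \<Delta> T1 T3" using alg_trans(1)[OF *(4) c *(5)] type by simp
  qed
  moreover have "symp_on {t. \<Delta> \<turnstile> t \<Colon> T} (\<lambda>t t'. tm_eq \<Delta> t t' T)" if "is_type \<Delta> T" for T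
    by (rule symp_onI) (simp add: alg_sym(5)[OF _ c _ _ type[OF that] conv_refl] ety)
  moreover have "transp_on {t. \<Delta> \<turnstile> t \<Colon> T} (\<lambda>t t'. tm_eq \<Delta> t t' T)" if "is_type \<Delta> T" for T
  proof (rule transp_onI)
    fix t1 t2 t3 assume *: "t1 \<in> {t. \<Delta> \<turnstile> t \<Colon> T}" "t2 \<in> {t. \<Delta> \<turnstile> t \<Colon> T}" "t3 \<in> {t. \<Delta> \<turnstile> t \<Colon> T}"
      "tm_eq \<Delta> t1 t2 T" "tm_eq \<Delta> t2 t3 T"
    then show "tm_eq \<Delta> t1 t3 T" using alg_trans(5)[OF *(4) c *(5) type[OF that] conv_refl] ety by simp
  qed
  moreover have "symp_on {n. \<exists>T. \<Delta> \<turnstile> n \<Colon> T} (\<lambda>n n'. \<exists>U. ne_eq \<Delta> n n' U)"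
  proof (rule symp_onI)
    fix n n' assume "n \<in> {n. \<exists>T. \<Delta> \<turnstile> n \<Colon> T}" "n' \<in> {n. \<exists>T. \<Delta> \<turnstile> n \<Colon> T}" "\<exists>U. ne_eq \<Delta> n n' U"
    then obtain U where U: "ne_eq \<Delta> n n' U" and n: "etypable \<Delta> n" "etypable \<Delta> n'"
      using typable by blast
    show "\<exists>U. ne_eq \<Delta> n' n U" using alg_sym(3)[OF U c n] by blast
  qed
  moreover have "transp_on {n. \<exists>T. \<Delta> \<turnstile> n \<Colon> T} (\<lambda>n n'. \<exists>U. ne_eq \<Delta> n n' U)"
  proof (rule transp_onI)
    fix n1 n2 n3
    assume "n1 \<in> {n. \<exists>T. \<Delta> \<turnstile> n \<Colon> T}" "n2 \<in> {n. \<exists>T. \<Delta> \<turnstile> n \<Colon> T}" "n3 \<in> {n. \<exists>T. \<Delta> \<turnstile> n \<Colon> T}"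
    note n = this[THEN typable]
    assume "\<exists>U. ne_eq \<Delta> n1 n2 U" "\<exists>U. ne_eq \<Delta> n2 n3 U"
    then obtain U V where U: "ne_eq \<Delta> n1 n2 U" and V: "ne_eq \<Delta> n2 n3 V" by blast
    \<comment> \<open>The middle expression may be inferred at two different types;
      \<open>alg_trans\<close> admits this and keeps the first.\<close>
    show "\<exists>U. ne_eq \<Delta> n1 n3 U" using alg_trans(3)[OF U c V n] by blast
  qed
  ultimately show ?thesis by blast
qed

end
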